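(* Let $N\ge 2$, $1\le M\le N-1$, $1<p\le N$, $\hat\gamma>1$, and let $\mathbb{H}^M=\{(x_1,\dots,x_M,0,\dots,0)\}\subset\mathbb{R}^N$. Let $u\in[DG]^+_p(\mathbb{R}^N,\hat\gamma)$ be non-negative with $u\not\equiv0$ in $\mathbb{R}^N$, and assume that $u$ vanishes on $\mathbb{H}^M$. If $N-M<p\le N$, then there exists $\alpha_2\in(0,1)$, depending only on $N$, $p$, $M$ and $\hat\gamma$, such that $$0<\liminf_{r\to\infty}\frac{\mu_+(r)}{r^{\alpha_2}},\qquad\text{where }\ \mu_+(r)=\sup_{B_r}u,$$ and $B_r$ is the ball of radius $r$ centered at the origin.
   Context: For $x_o\in\mathbb{R}^N$, $B_\rho(x_o)$ is the open ball of radius $\rho$ centered at $x_o$; $(s)_+=\max\{s,0\}$. For an open $\Omega\subseteq\mathbb{R}^N$, $1<p\le N$, $\hat\gamma>1$, the De Giorgi class $[DG]^{+}_p(\Omega,\hat\gamma)$ consists of all $u\in W^{1,p}_{\mathrm{loc}}(\Omega)$ such that for all $\sigma\in(0,1)$, $\rho>0$, $x_o\in\Omega$ with $B_\rho(x_o)\subset\Omega$, and all $k\in\mathbb{R}$, $$\int_{B_{\sigma\rho}(x_o)}|D(u-k)_+|^p\,dx\le\frac{\hat\gamma}{[(1-\sigma)\rho]^p}\int_{B_\rho(x_o)}|(u-k)_+|^p\,dx.$$ Since Sobolev functions are defined up to sets of $p$-capacity zero, "u vanishes on $\mathbb{H}^M$" is understood for the (quasi-continuous) representative of $u$, i.e.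 up to a set of $p$-capacity zero. *)

theory Defs
  imports "HOL-Analysis.Analysis" "HOL-Probability.Essential_Supremum"
begin

fun pd :: "'n::finite list \<Rightarrow> (real^'n \<Rightarrow> real) \<Rightarrow> (real^'n \<Rightarrow> real)" where
  "pd [] \<phi> = \<phi>"
| "pd (i # is) \<phi> = (\<lambda>x. frechet_derivative (pd is \<phi>) (at x) (axis i 1))"

definition smooth_fun :: "(real^'n::finite \<Rightarrow> real) \<Rightarrow> bool" where
  "smooth_fun \<phi> \<longleftrightarrow> (\<forall>is. \<forall>x. pd is \<phi> differentiable (at x))"

definition test_fun :: "(real^'n::finite \<Rightarrow> real) \<Rightarrow> bool" where
  "test_fun \<phi> \<longleftrightarrow> smooth_fun \<phi> \<and> compact (closure {x. \<phi> x \<noteq> 0})"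

definition loc_integrable :: "(real^'n::finite \<Rightarrow> real) \<Rightarrow> bool" where
  "loc_integrable f \<longleftrightarrow> (\<forall>K. compact K \<longrightarrow> set_integrable lebesgue K f)"

definition weak_grad :: "(real^'n::finite \<Rightarrow> real) \<Rightarrow> (real^'n \<Rightarrow> real^'n) \<Rightarrow> bool" where
  "weak_grad u g \<longleftrightarrow> loc_integrable u \<and> (\<forall>i. loc_integrable (\<lambda>x. g x $ i)) \<and>
     (\<forall>\<phi> i. test_fun \<phi> \<longrightarrow>
        (LINT x|lebesgue. u x * pd [i] \<phi> x) = - (LINT x|lebesgue. g x $ i * \<phi> x))"

definition Lp_loc :: "real \<Rightarrow> (real^'n::finite \<Rightarrow> 'b::real_normed_vector) \<Rightarrow> bool" where
  "Lp_loc p f \<longleftrightarrow> f \<in> borel_measurable lebesgue \<and>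
     (\<forall>x r. set_integrable lebesgue (ball x r) (\<lambda>y. norm (f y) powr p))"

definition Lp :: "real \<Rightarrow> (real^'n::finite \<Rightarrow> 'b::real_normed_vector) \<Rightarrow> bool" where
  "Lp p f \<longleftrightarrow> f \<in> borel_measurable lebesgue \<and> integrable lebesgue (\<lambda>y. norm (f y) powr p)"

definition W1p_loc :: "real \<Rightarrow> (real^'n::finite \<Rightarrow> real) \<Rightarrow> bool" where
  "W1p_loc p u \<longleftrightarrow> (\<exists>g. weak_grad u g \<and> Lp_loc p u \<and> Lp_loc p g)"

definition DG_plus :: "real \<Rightarrow> real \<Rightarrow> (real^'n::finite \<Rightarrow> real) \<Rightarrow> bool" where
  "DG_plus p \<gamma> u \<longleftrightarrow> W1p_loc p u \<and>
     (\<forall>\<sigma> \<rho> x0 k. 0 < \<sigma> \<and> \<sigma> < 1 \<and> 0 < \<rho> \<longrightarrow>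
        (\<exists>g. weak_grad (\<lambda>x. max (u x - k) 0) g \<and>
          (LINT y:ball x0 (\<sigma> * \<rho>)|lebesgue. norm (g y) powr p)
            \<le> \<gamma> / ((1 - \<sigma>) * \<rho>) powr p *
              (LINT y:ball x0 \<rho>|lebesgue. \<bar>max (u y - k) 0\<bar> powr p)))"

definition p_cap :: "real \<Rightarrow> (real^'n::finite) set \<Rightarrow> ennreal" where
  "p_cap p E = Inf {(\<integral>\<^sup>+ x. ennreal (\<bar>\<phi> x\<bar> powr p + norm (g x) powr p) \<partial>lebesgue) | \<phi> g.
      weak_grad \<phi> g \<and> Lp p \<phi> \<and> Lp p g \<and>
      (\<exists>U. open U \<and> E \<subseteq> U \<and> (AE x in lebesgue. x \<in> U \<longrightarrow> \<phi> x \<ge> 1))}"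

definition quasi_continuous :: "real \<Rightarrow> (real^'n::finite \<Rightarrow> real) \<Rightarrow> bool" where
  "quasi_continuous p v \<longleftrightarrow>
     (\<forall>\<epsilon>>0. \<exists>G. open G \<and> p_cap p G < ennreal \<epsilon> \<and> continuous_on (- G) v)"

definition vanishes_on :: "real \<Rightarrow> (real^'n::finite \<Rightarrow> real) \<Rightarrow> (real^'n) set \<Rightarrow> bool" where
  "vanishes_on p u H \<longleftrightarrow> (\<exists>v. (AE x in lebesgue. v x = u x) \<and> quasi_continuous p v \<and>
       p_cap p {x \<in> H. v x \<noteq> 0} = 0)"

text \<open>H^M: points whose coordinates beyond the first M (w.r.t. the order of the index type) vanish.\<close>
definition HM :: "nat \<Rightarrow> (real^'n::{finite,linorder}) set" where
  "HM M = {x. \<forall>i. M \<le> card {j. j < i} \<longrightarrow> x $ i = 0}"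

definition mu_plus :: "(real^'n::finite \<Rightarrow> real) \<Rightarrow> real \<Rightarrow> ereal" where
  "mu_plus u r = esssup (restrict_space lebesgue (ball 0 r)) (\<lambda>x. ereal (u x))"

end

theory Submission
  imports Defs
begin

text \<open>The bound \<open>mu_plus u r \<le> \<eta> * mu_plus u (8 * r)\<close> with \<open>\<eta> < 1\<close> depending only on the data gives power growth by iteration.
  It comes from De Giorgi's method. With \<open>\<mu> = mu_plus u (8 * r)\<close> and \<open>k j = \<mu> * (1 - 2 powr (- j))\<close>, the truncations of \<open>u\<close> between
  consecutive levels vanish on the plane up to capacity zero, so for an exponent \<open>q\<close> strictly between the codimension and \<open>p\<close>
  they satisfy a Poincare inequality without boundary term, obtained by integrating along dilations that contract space onto the
  plane. The energy inequality and \<open>q < p\<close> control the right-hand side by the measure of \<open>{k j < u \<le> k (j + 1)}\<close>; these sets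
  are disjoint, hence some level set \<open>{u > k J}\<close> has small measure, and the usual iteration over shrinking balls then lowers
  the supremum. Capacity potentials multiplied by the height of the truncation are subtracted first, which makes the truncation nonpositive
  in a neighbourhood of the plane; the error disappears in the limit.\<close>

section \<open>Smooth bump functions\<close>

text \<open>The plane is a null set, so the vanishing of \<open>u\<close> there is invisible to
  integrals. It becomes usable because nonpositivity on an open neighbourhood survives mollification
  at small scale: the mollified function is nonpositive on the plane itself, and the fundamental
  theorem of calculus can be applied along curves that end there. The exponent has to drop below
  \<open>p\<close> because at exponent \<open>p\<close> the Poincare inequality would bound a level
  set by the full energy, without any gain from a thin strip of values. Below \<open>p\<close> the
  gradient on a strip can be split at a threshold: small values are charged to the measure of the
  strip, large values to the energy with a small factor. The assumption on \<open>p\<close> leaves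
  room for an exponent that is also above the codimension. Hoelder and Sobolev inequalities never
  enter. The former is replaced by splittings at free thresholds, fixed only at the end, and the
  latter by averaging over translations: a function with small support is controlled by its
  differences at the scale of a small ball.\<close>

definition flat_exp :: "nat \<Rightarrow> real \<Rightarrow> real" where
  "flat_exp m t = (if t > 0 then exp (- 1 / t) / t ^ m else 0)"

lemma flat_tendsto_0: "(flat_exp m \<longlongrightarrow> 0) (at_right 0)"
proof -
  have "((\<lambda>s::real. s ^ m / exp s) \<longlongrightarrow> 0) at_top"
    by (rule tendsto_power_div_exp_0)
  then have "((\<lambda>t::real. (inverse t) ^ m / exp (inverse t)) \<longlongrightarrow> 0) (at_right 0)"
    using filterlim_compose filterlim_inverse_at_top_right by blast
  then show ?thesis
  proof (rule Lim_transform_eventually)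
    show "\<forall>\<^sub>F t in at_right 0. (inverse t) ^ m / exp (inverse t) = flat_exp m t"
      by (auto simp: eventually_at_right_field flat_exp_def exp_minus divide_simps power_inverse intro!: exI[of _ 1])
  qed
qed

text \<open>Dividing by \<open>t ^ m\<close> makes the family closed under differentiation, up to
  linear combinations. At 0 the difference quotient from the right is
  \<open>flat_exp (m + 1)\<close>, which tends to 0 because the exponential beats every
  power.\<close>

lemma flat_DERIV: "(flat_exp m has_real_derivative flat_exp (m + 2) t - real m * flat_exp (m + 1) t) (at t)"
proof -
  consider "t > 0" | "t < 0" | "t = 0" by linarith
  then show ?thesis
  proof cases
    case 1
    have *: "real m * t ^ m = real m * t ^ (m - 1) * t"
      by (cases m) auto
    have "((\<lambda>t. exp (- 1 / t) / t ^ m) has_real_derivative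
        (exp (- 1 / t) * (1 / t\<^sup>2) * t ^ m - exp (- 1 / t) * (real m * t ^ (m - 1))) / (t ^ m * t ^ m)) (at t)"
      using 1 by (auto intro!: derivative_eq_intros simp: power2_eq_square)
    also have "(exp (- 1 / t) * (1 / t\<^sup>2) * t ^ m - exp (- 1 / t) * (real m * t ^ (m - 1))) / (t ^ m * t ^ m)
        = flat_exp (m + 2) t - real m * flat_exp (m + 1) t"
      using 1 * by (simp add: flat_exp_def divide_simps power2_eq_square power_add) (simp add: algebra_simps)
    finally have "((\<lambda>t. exp (- 1 / t) / t ^ m) has_real_derivative flat_exp (m + 2) t - real m * flat_exp (m + 1) t) (at t)" .
    then show ?thesis
    proof (rule has_field_derivative_transform_within_open[where S="{0<..}"])
      show "\<And>x. x \<in> {0<..} \<Longrightarrow> exp (- 1 / x) / x ^ m = flat_exp m x" by (auto simp: flat_exp_def)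
    qed (use 1 in auto)
  next
    case 2
    have "((\<lambda>t. 0) has_real_derivative 0) (at t)" by simp
    then have "(flat_exp m has_real_derivative 0) (at t)"
      by (rule has_field_derivative_transform_within_open[where S="{..<0}"]) (use 2 in \<open>auto simp: flat_exp_def\<close>)
    then show ?thesis using 2 by (simp add: flat_exp_def)
  next
    case 3
    have r: "((\<lambda>y. (flat_exp m y - flat_exp m 0) / (y - 0)) \<longlongrightarrow> 0) (at_right 0)"
      using flat_tendsto_0[of "m+1"]
    proof (rule Lim_transform_eventually)
      show "\<forall>\<^sub>F y in at_right 0. flat_exp (m + 1) y = (flat_exp m y - flat_exp m 0) / (y - 0)"
        by (auto simp: eventually_at_right_field flat_exp_def intro!: exI[of _ 1])
    qed
    have l: "((\<lambda>y. (flat_exp m y - flat_exp m 0) / (y - 0)) \<longlongrightarrow> 0) (at_left 0)"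
    proof (rule Lim_transform_eventually[OF tendsto_const])
      show "\<forall>\<^sub>F y in at_left 0. 0 = (flat_exp m y - flat_exp m 0) / (y - 0)"
        by (auto simp: eventually_at_left_field flat_exp_def intro!: exI[of _ "-1"])
    qed
    show ?thesis using l r 3
      by (auto simp: has_field_derivative_iff filterlim_split_at flat_exp_def)
  qed
qed

lemma flat_nonneg: "flat_exp m t \<ge> 0"
  by (simp add: flat_exp_def)

lemma continuous_on_flat [continuous_intros]: "continuous_on S f \<Longrightarrow> continuous_on S (\<lambda>x. flat_exp m (f x))"
  using continuous_on_compose2[of UNIV "flat_exp m"] flat_DERIV DERIV_isCont
  by (metis continuous_at_imp_continuous_on subset_UNIV)

text \<open>\<open>smooth_fun\<close> asks for differentiability of all iterated partial
  derivatives. A generated class that is stable under a single partial derivative gives this by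
  induction on the list of indices.\<close>

inductive smooth_class :: "(real^'n::finite \<Rightarrow> real) \<Rightarrow> bool" where
  smooth_class_const: "smooth_class (\<lambda>x. c)"
| smooth_class_coord: "smooth_class (\<lambda>x. x $ i)"
| smooth_class_add: "smooth_class f \<Longrightarrow> smooth_class g \<Longrightarrow> smooth_class (\<lambda>x. f x + g x)"
| smooth_class_mult: "smooth_class f \<Longrightarrow> smooth_class g \<Longrightarrow> smooth_class (\<lambda>x. f x * g x)"
| smooth_class_flat: "smooth_class f \<Longrightarrow> smooth_class (\<lambda>x. flat_exp m (f x))"

lemma smooth_class_derivative:
  "smooth_class f \<Longrightarrow> \<exists>f'. (\<forall>x. (f has_derivative f' x) (at x)) \<and> (\<forall>i. smooth_class (\<lambda>x. f' x (axis i 1)))"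
proof (induction rule: smooth_class.induct)
  case (smooth_class_const c)
  then show ?case by (intro exI[of _ "\<lambda>x y. 0"]) (auto intro: smooth_class.intros)
next
  case (smooth_class_coord i)
  have "((\<lambda>x. x $ i) has_derivative (\<lambda>y. y $ i)) (at x)" for x
    by (simp add: bounded_linear_imp_has_derivative bounded_linear_vec_nth)
  then show ?case by (intro exI[of _ "\<lambda>x y. y $ i"]) (auto intro: smooth_class.intros)
next
  case (smooth_class_add f g)
  then obtain f' g' where *: "\<And>x. (f has_derivative f' x) (at x)" "\<And>i. smooth_class (\<lambda>x. f' x (axis i 1))"
    "\<And>x. (g has_derivative g' x) (at x)" "\<And>i. smooth_class (\<lambda>x. g' x (axis i 1))" by blast
  then show ?case
    by (intro exI[of _ "\<lambda>x y. f' x y + g' x y"]) (auto intro!: smooth_class.intros has_derivative_add)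
next
  case (smooth_class_mult f g)
  then obtain f' g' where *: "\<And>x. (f has_derivative f' x) (at x)" "\<And>i. smooth_class (\<lambda>x. f' x (axis i 1))"
    "\<And>x. (g has_derivative g' x) (at x)" "\<And>i. smooth_class (\<lambda>x. g' x (axis i 1))" by blast
  with smooth_class_mult show ?case
    by (intro exI[of _ "\<lambda>x y. f x * g' x y + f' x y * g x"]) (auto intro!: smooth_class.intros has_derivative_mult)
next
  case (smooth_class_flat f m)
  then obtain f' where *: "\<And>x. (f has_derivative f' x) (at x)" "\<And>i. smooth_class (\<lambda>x. f' x (axis i 1))"
    by blast
  have "((\<lambda>x. flat_exp m (f x)) has_derivative (\<lambda>y. f' x y * (flat_exp (m+2) (f x) + (- real m) * flat_exp (m+1) (f x)))) (at x)" for x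
    using has_derivative_compose[OF *(1) has_field_derivative_imp_has_derivative[OF flat_DERIV]]
    by (simp add: algebra_simps)
  moreover have "smooth_class (\<lambda>x. flat_exp (m+2) (f x) + (- real m) * flat_exp (m+1) (f x))"
    by (intro smooth_class.intros smooth_class_flat.hyps)
  ultimately show ?case using *(2)
    by (intro exI[of _ "\<lambda>x y. f' x y * (flat_exp (m+2) (f x) + (- real m) * flat_exp (m+1) (f x))"]) 
      (auto simp del: add_uminus_conv_diff intro!: smooth_class_mult)
qed

lemma smooth_class_pd: "smooth_class f \<Longrightarrow> smooth_class (pd is f)"
proof (induction "is")
  case (Cons i "is")
  then obtain f' where "\<And>x. (pd is f has_derivative f' x) (at x)" "\<And>i. smooth_class (\<lambda>x. f' x (axis i 1))"
    using smooth_class_derivative by blast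
  moreover from this(1) have "frechet_derivative (pd is f) (at x) = f' x" for x
    by (metis frechet_derivative_at)
  ultimately show ?case by simp
qed simp

lemma smooth_class_smooth_fun: "smooth_class f \<Longrightarrow> smooth_fun f"
  unfolding smooth_fun_def differentiable_def using smooth_class_pd smooth_class_derivative by blast

lemma smooth_class_sum: "finite I \<Longrightarrow> (\<And>i. i \<in> I \<Longrightarrow> smooth_class (f i)) \<Longrightarrow> smooth_class (\<lambda>x. \<Sum>i\<in>I. f i x)"
  by (induction rule: finite_induct) (auto intro!: smooth_class.intros)

section \<open>The radial mollification kernel and its gradient\<close>

definition bump :: "real \<Rightarrow> real^'n::finite \<Rightarrow> real" where
  "bump e z = flat_exp 0 (e\<^sup>2 - z \<bullet> z)"

lemma bump_nonneg: "bump e z \<ge> 0"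
  by (simp add: bump_def flat_nonneg)

lemma bump_eq_0: "e \<ge> 0 \<Longrightarrow> norm z \<ge> e \<Longrightarrow> bump e z = 0"
  by (simp add: bump_def flat_exp_def power2_norm_eq_inner[symmetric] linorder_not_less power_mono)

lemma bump_pos: "norm z < e \<Longrightarrow> bump e z > 0"
  by (auto simp: bump_def flat_exp_def power2_norm_eq_inner[symmetric] power_strict_mono)

lemma continuous_on_bump [continuous_intros]: "continuous_on S f \<Longrightarrow> continuous_on S (\<lambda>x. bump e (f x))"
  unfolding bump_def by (intro continuous_intros)

text \<open>The bump depends on \<open>z \<bullet> z\<close> and not on the norm, so its argument is
  a polynomial in the coordinates and the function lies in \<open>smooth_class\<close>.\<close>

lemma bump_test_fun: 
  assumes "e > 0" shows "test_fun (\<lambda>y. c * bump e (x - y))"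
  unfolding test_fun_def
proof
  have "smooth_class (\<lambda>y. c * flat_exp 0 (e\<^sup>2 + (-1) * (\<Sum>i\<in>UNIV. (x $ i + (-1) * y $ i) * (x $ i + (-1) * y $ i))))"
    by (intro smooth_class.intros smooth_class_sum) auto
  then show "smooth_fun (\<lambda>y. c * bump e (x - y))"
    by (intro smooth_class_smooth_fun) (simp add: bump_def inner_vec_def)
  have "{y. c * bump e (x - y) \<noteq> 0} \<subseteq> cball x e"
    using bump_eq_0[of e] assms by (force simp: dist_norm)
  then show "compact (closure {y. c * bump e (x - y) \<noteq> 0})"
    by (meson bounded_cball bounded_subset compact_closure)
qed

definition eta :: "real \<Rightarrow> real^'n::finite \<Rightarrow> real" where
  "eta e z = bump e z / (\<integral>y. bump e (y::real^'n) \<partial>lborel)"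

text \<open>This is the gradient of \<open>eta e\<close>. Only \<open>flat_exp 2\<close> appears
  because the other term in \<open>flat_DERIV\<close> carries the factor
  \<open>m = 0\<close>.\<close>

definition eta' :: "real \<Rightarrow> real^'n::finite \<Rightarrow> real^'n" where
  "eta' e z = (- 2 * flat_exp 2 (e\<^sup>2 - z \<bullet> z) / (\<integral>y. bump e (y::real^'n) \<partial>lborel)) *\<^sub>R z"

lemma continuous_on_eta [continuous_intros]: "continuous_on S f \<Longrightarrow> continuous_on S (\<lambda>x. eta e (f x))"
  unfolding eta_def divide_inverse by (intro continuous_intros)

lemma continuous_on_eta' [continuous_intros]: "continuous_on S f \<Longrightarrow> continuous_on S (\<lambda>x. eta' e (f x))"
  unfolding eta'_def divide_inverse by (intro continuous_intros)

lemma borel_measurable_eta [measurable]: "f \<in> borel_measurable M \<Longrightarrow> (\<lambda>x. eta e (f x)) \<in> borel_measurable M"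
  using borel_measurable_continuous_onI[OF continuous_on_eta[OF continuous_on_id]] measurable_compose by blast

lemma borel_measurable_eta' [measurable]: "f \<in> borel_measurable M \<Longrightarrow> (\<lambda>x. eta' e (f x)) \<in> borel_measurable M"
  using borel_measurable_continuous_onI[OF continuous_on_eta'[OF continuous_on_id]] measurable_compose by blast

lemma integrable_bounded_support:
  fixes f :: "'a::euclidean_space \<Rightarrow> 'b::{banach,second_countable_topology}"
  assumes "continuous_on UNIV f" "\<And>z. norm z > e \<Longrightarrow> f z = 0"
  shows "integrable lborel f"
proof -
  have "integrable lborel (\<lambda>x. indicator (cball 0 e) x *\<^sub>R f x)"
    using borel_integrable_compact[of "cball 0 e" f] assms(1) continuous_on_subset
    by (simp add: set_integrable_def) blast
  also have "(\<lambda>x. indicator (cball 0 e) x *\<^sub>R f x) = f"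
    using assms(2) by (auto simp: indicator_def)
  finally show ?thesis .
qed

lemma integrable_bump: "e > 0 \<Longrightarrow> integrable lborel (bump e)"
  by (rule integrable_bounded_support[of _ e]) (auto intro!: continuous_intros bump_eq_0)

lemma integral_bump_pos: 
  assumes "e > 0" shows "(\<integral>y. bump e (y::real^'n::finite) \<partial>lborel) > 0"
proof -
  have "(\<integral>y. bump e (y::real^'n) \<partial>lborel) \<noteq> 0"
  proof
    assume "(\<integral>y. bump e (y::real^'n) \<partial>lborel) = 0"
    then have "AE y::real^'n in lborel. bump e y = 0"
      using integral_nonneg_eq_0_iff_AE[OF integrable_bump[OF assms]] bump_nonneg by auto
    then have "AE y::real^'n in lborel. y \<notin> ball 0 e"
      by (rule AE_mp) (use bump_pos in \<open>force intro!: AE_I2\<close>)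
    then have "ball (0::real^'n) e \<in> null_sets lborel"
      by (subst AE_iff_null_sets) auto
    then show False
      using assms by (metis ball_eq_empty not_less open_ball open_not_negligible negligible_iff_null_sets null_sets_completionI)
  qed
  then show ?thesis using Bochner_Integration.integral_nonneg[of lborel "bump e::real^'n \<Rightarrow> real"] bump_nonneg by (smt (verit, ccfv_SIG))
qed

context fixes e :: real assumes e: "e > 0" begin

lemma eta_nonneg: "eta e z \<ge> 0"
  by (simp add: eta_def bump_nonneg integral_bump_pos e less_imp_le)

lemma eta_eq_0: "norm z \<ge> e \<Longrightarrow> eta e z = 0"
  using e by (simp add: eta_def bump_eq_0)

lemma eta'_eq_0: 
  assumes "norm z \<ge> e" shows "eta' e z = 0"
proof -
  have "\<not> (norm z)\<^sup>2 < e\<^sup>2" using assms e by (simp add: linorder_not_less power_mono)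
  then show ?thesis by (simp add: eta'_def flat_exp_def power2_norm_eq_inner[symmetric])
qed

lemma integrable_eta: "integrable lborel (eta e)"
  by (rule integrable_bounded_support[of _ e]) (auto intro!: continuous_intros eta_eq_0)

lemma integral_eta: "(\<integral>z. eta e (z::real^'n::finite) \<partial>lborel) = 1"
  using integral_bump_pos[OF e, where 'n='n] by (simp add: eta_def)

lemma eta_derivative: 
  fixes z :: "real^'n::finite"
  shows "(eta e has_derivative (\<lambda>w. eta' e z \<bullet> w)) (at z)"
proof -
  have "((\<lambda>z. e\<^sup>2 - z \<bullet> z) has_derivative (\<lambda>w. - 2 * (z \<bullet> w))) (at z)"
    by (auto intro!: derivative_eq_intros simp: inner_commute)
  from has_derivative_compose[OF this has_field_derivative_imp_has_derivative[OF flat_DERIV[of 0]]]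
  have "(bump e has_derivative (\<lambda>w. (- 2 * (z \<bullet> w)) * flat_exp 2 (e\<^sup>2 - z \<bullet> z))) (at z)"
    by (simp add: bump_def[abs_def] mult.commute numeral_2_eq_2)
  then show ?thesis
    unfolding eta_def[abs_def] eta'_def
    using integral_bump_pos[OF e, where 'n='n]
    by (auto intro!: derivative_eq_intros simp: divide_simps)
qed

lemma eta_test_fun: "test_fun (\<lambda>y. eta e (x - y))"
  using bump_test_fun[OF e, of "1 / (\<integral>y. bump e (y::real^'n) \<partial>lborel)" x for x :: "real^'n"] by (simp add: eta_def)

lemma eta_pd: "pd [i] (\<lambda>y. eta e (x - y)) y = - eta' e (x - y) $ i"
proof -
  have "((\<lambda>y. eta e (x - y)) has_derivative (\<lambda>w. eta' e (x - y) \<bullet> (- w))) (at y)"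
    by (rule has_derivative_compose[of "\<lambda>y. x - y" "\<lambda>w. - w" y UNIV "eta e"]) (auto intro!: derivative_eq_intros eta_derivative)
  from frechet_derivative_at[OF this, symmetric] show ?thesis
    by (simp add: inner_axis)
qed

end

section \<open>Continuity of translations in the mean\<close>

lemma distr_reflect: "distr lborel borel (\<lambda>z. x - z) = (lborel :: 'a::euclidean_space measure)"
  using lborel_affine[of "-1" x] by (simp add: density_1)

lemma nn_integral_reflect:
  fixes f :: "'a::euclidean_space \<Rightarrow> ennreal"
  assumes [measurable]: "f \<in> borel_measurable borel"
  shows "(\<integral>\<^sup>+z. f (x - z) \<partial>lborel) = (\<integral>\<^sup>+z. f z \<partial>lborel)"
  by (subst distr_reflect[of x, symmetric]) (simp add: nn_integral_distr)

lemma integral_reflect: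
  fixes f :: "'a::euclidean_space \<Rightarrow> 'b::{banach,second_countable_topology}"
  assumes [measurable]: "f \<in> borel_measurable borel"
  shows "(\<integral>z. f (x - z) \<partial>lborel) = (\<integral>z. f z \<partial>lborel)"
  by (subst distr_reflect[of x, symmetric]) (simp add: integral_distr)

lemma nn_integral_translate:
  fixes f :: "'a::euclidean_space \<Rightarrow> ennreal"
  assumes [measurable]: "f \<in> borel_measurable borel"
  shows "(\<integral>\<^sup>+z. f (z + a) \<partial>lborel) = (\<integral>\<^sup>+z. f z \<partial>lborel)"
  by (subst lborel_distr_plus[of a, symmetric]) (simp add: nn_integral_distr add.commute)

lemma integral_translate:
  fixes f :: "'a::euclidean_space \<Rightarrow> 'b::{banach,second_countable_topology}"
  assumes [measurable]: "f \<in> borel_measurable borel"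
  shows "(\<integral>z. f (z + a) \<partial>lborel) = (\<integral>z. f z \<partial>lborel)"
  by (subst lborel_distr_plus[of a, symmetric]) (simp add: integral_distr add.commute)

lemma tonelli_lborel:
  fixes f :: "'a::euclidean_space \<Rightarrow> 'b::euclidean_space \<Rightarrow> ennreal"
  assumes [measurable]: "case_prod f \<in> borel_measurable (lborel \<Otimes>\<^sub>M lborel)"
  shows "(\<integral>\<^sup>+x. \<integral>\<^sup>+y. f x y \<partial>lborel \<partial>lborel) = (\<integral>\<^sup>+y. \<integral>\<^sup>+x. f x y \<partial>lborel \<partial>lborel)"
  using lborel_pair.Fubini'[of f] by simp

context
  fixes z :: "nat \<Rightarrow> 'a::euclidean_space"
  assumes z: "z \<longlonglongrightarrow> 0"
begin

text \<open>Continuity is stated along one fixed null sequence so that dominated convergence applies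
  directly; \<open>L1_translation_cont\<close> returns to the epsilon-delta form by
  contradiction.\<close>

definition translation_cont :: "('a \<Rightarrow> 'b::euclidean_space) \<Rightarrow> bool" where
  "translation_cont f \<longleftrightarrow> (\<forall>e::real>0. \<forall>\<^sub>F n in sequentially. (\<integral>\<^sup>+x. norm (f (x + z n) - f x) \<partial>lborel) < ennreal e)"

text \<open>Translations preserve the \<open>L1\<close> norm, so replacing \<open>f\<close> by
  \<open>h\<close> costs the same error at \<open>x + z n\<close> and at \<open>x\<close>; together
  with the modulus of \<open>h\<close> this makes three thirds of \<open>e\<close>.\<close>

lemma translation_cont_approx:
  fixes f :: "'a \<Rightarrow> 'b::euclidean_space"
  assumes [measurable]: "f \<in> borel_measurable borel"
    and *: "\<And>e::real. e > 0 \<Longrightarrow> \<exists>h\<in>borel_measurable borel. translation_cont h \<and> (\<integral>\<^sup>+x. norm (f x - h x) \<partial>lborel) < ennreal e"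
  shows "translation_cont f"
  unfolding translation_cont_def
proof (intro allI impI)
  fix e :: real assume "e > 0"
  then obtain h where [measurable]: "h \<in> borel_measurable borel" and h: "translation_cont h"
    and fh: "(\<integral>\<^sup>+x. norm (f x - h x) \<partial>lborel) < ennreal (e/3)"
    using *[of "e/3"] by auto
  have "\<forall>\<^sub>F n in sequentially. (\<integral>\<^sup>+x. norm (h (x + z n) - h x) \<partial>lborel) < ennreal (e/3)"
    using h \<open>e > 0\<close> unfolding translation_cont_def by auto
  then show "\<forall>\<^sub>F n in sequentially. (\<integral>\<^sup>+x. norm (f (x + z n) - f x) \<partial>lborel) < ennreal e"
  proof eventually_elim
    case (elim n)
    have "(\<integral>\<^sup>+x. norm (f (x + z n) - f x) \<partial>lborel) \<le>
      (\<integral>\<^sup>+x. (norm (f (x + z n) - h (x + z n)) + norm (h (x + z n) - h x)) + norm (f x - h x) \<partial>lborel)"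
    proof (rule nn_integral_mono)
      fix x
      have "norm (f (x + z n) - f x) \<le> norm (f (x + z n) - h (x + z n)) + norm (h (x + z n) - h x) + norm (f x - h x)"
        using norm_triangle_ineq[of "f (x + z n) - h (x + z n)" "h (x + z n) - h x"]
          norm_triangle_ineq4[of "f (x + z n) - h x" "f x - h x"] by simp
      then show "ennreal (norm (f (x + z n) - f x)) \<le> ennreal (norm (f (x + z n) - h (x + z n)) + norm (h (x + z n) - h x) + norm (f x - h x))"
        by (rule ennreal_leI)
    qed
    also have "\<dots> = (\<integral>\<^sup>+x. norm (f (x + z n) - h (x + z n)) \<partial>lborel) + (\<integral>\<^sup>+x. norm (h (x + z n) - h x) \<partial>lborel)
         + (\<integral>\<^sup>+x. norm (f x - h x) \<partial>lborel)"
      by (simp add: nn_integral_add ennreal_plus)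
    also have "(\<integral>\<^sup>+x. norm (f (x + z n) - h (x + z n)) \<partial>lborel) = (\<integral>\<^sup>+x. norm (f x - h x) \<partial>lborel)"
      by (rule nn_integral_translate[of "\<lambda>x. norm (f x - h x)"]) simp
    also have "(\<integral>\<^sup>+x. norm (f x - h x) \<partial>lborel) + (\<integral>\<^sup>+x. norm (h (x + z n) - h x) \<partial>lborel) + (\<integral>\<^sup>+x. norm (f x - h x) \<partial>lborel)
      < ennreal (e/3) + ennreal (e/3) + ennreal (e/3)"
      using fh elim by (intro add_strict_mono)
    also have "\<dots> = ennreal e" using \<open>e > 0\<close> by (simp flip: ennreal_plus)
    finally show ?case .
  qed
qed

text \<open>A point of an open set stays in the set under small shifts, so the part of
  \<open>U\<close> that is shifted out vanishes by dominated convergence. The points shifted in are,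
  after a translation, those shifted out by \<open>- z n\<close>.\<close>

lemma translation_cont_open:
  fixes c :: "'b::euclidean_space"
  assumes U: "open U" "emeasure lborel U < \<infinity>"
  shows "translation_cont (\<lambda>x. indicator U x *\<^sub>R c)"
  unfolding translation_cont_def
proof (intro allI impI)
  fix e :: real assume "e > 0"
  have [measurable]: "U \<in> sets borel" using U by simp
  have *: "(\<lambda>n. \<integral>\<^sup>+x. indicator U x * indicator (- U) (x + s n) \<partial>lborel) \<longlonglongrightarrow> 0" if s: "s \<longlonglongrightarrow> 0" for s
  proof -
    have "(\<lambda>n. \<integral>\<^sup>+x. indicator U x * indicator (- U) (x + s n) \<partial>lborel) \<longlonglongrightarrow> (\<integral>\<^sup>+(x::'a). 0 \<partial>lborel)"
    proof (rule nn_integral_dominated_convergence[where w="indicator U"])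
      show "AE x in lborel. (\<lambda>n. indicator U x * indicator (- U) (x + s n)) \<longlonglongrightarrow> (0::ennreal)"
      proof (rule AE_I2)
        fix x
        show "(\<lambda>n. indicator U x * indicator (- U) (x + s n)) \<longlonglongrightarrow> (0::ennreal)"
        proof (cases "x \<in> U")
          case True
          have "(\<lambda>n. x + s n) \<longlonglongrightarrow> x" using tendsto_add[OF tendsto_const s, of x] by simp
          then have "\<forall>\<^sub>F n in sequentially. x + s n \<in> U"
            using True U topological_tendstoD by blast
          then show ?thesis
            by (intro tendsto_eventually) (auto elim: eventually_mono simp: indicator_def)
        qed simp
      qed
    qed (use U in \<open>auto split: split_indicator\<close>)
    then show ?thesis by simp
  qed
  have "(\<lambda>n. ennreal (norm c) * ((\<integral>\<^sup>+x. indicator U x * indicator (- U) (x + z n) \<partial>lborel)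
      + (\<integral>\<^sup>+x. indicator U x * indicator (- U) (x + (- z n)) \<partial>lborel))) \<longlonglongrightarrow> ennreal (norm c) * (0 + 0)"
    by (intro tendsto_intros ennreal_tendsto_cmult * z tendsto_minus_cancel_left[THEN iffD1]) (use z in \<open>auto intro: tendsto_eq_intros\<close>)
  then have "\<forall>\<^sub>F n in sequentially. ennreal (norm c) * ((\<integral>\<^sup>+x. indicator U x * indicator (- U) (x + z n) \<partial>lborel)
      + (\<integral>\<^sup>+x. indicator U x * indicator (- U) (x + (- z n)) \<partial>lborel)) < ennreal e"
    by (rule order_tendstoD) (use \<open>e > 0\<close> in simp)
  then show "\<forall>\<^sub>F n in sequentially. (\<integral>\<^sup>+x. norm (indicator U (x + z n) *\<^sub>R c - indicator U x *\<^sub>R c) \<partial>lborel) < ennreal e"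
  proof eventually_elim
    case (elim n)
    have "(\<integral>\<^sup>+x. norm (indicator U (x + z n) *\<^sub>R c - indicator U x *\<^sub>R c) \<partial>lborel) =
       (\<integral>\<^sup>+x. ennreal (norm c) * (indicator U x * indicator (- U) (x + z n) + indicator U (x + z n) * indicator (- U) x) \<partial>lborel)"
      by (intro nn_integral_cong) (auto simp: indicator_def)
    also have "\<dots> = ennreal (norm c) * ((\<integral>\<^sup>+x. indicator U x * indicator (- U) (x + z n) \<partial>lborel) + (\<integral>\<^sup>+x. indicator U (x + z n) * indicator (- U) x \<partial>lborel))"
      by (simp add: nn_integral_cmult nn_integral_add)
    also have "(\<integral>\<^sup>+x. indicator U (x + z n) * indicator (- U) x \<partial>lborel) = (\<integral>\<^sup>+x. indicator U x * indicator (- U) (x + (- z n)) \<partial>lborel)"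
      using nn_integral_translate[of "\<lambda>x. indicator U x * indicator (- U) (x + (- z n))" "z n"] by simp
    finally show ?case using elim by simp
  qed
qed

text \<open>In the induction over integrable functions a measurable set is first replaced by an open
  superset, by outer regularity, since openness is what makes the case of an indicator
  elementary.\<close>

lemma translation_cont_integrable:
  fixes f :: "'a \<Rightarrow> 'b::euclidean_space"
  assumes "integrable lborel f"
  shows "translation_cont f"
  using assms
proof (induction rule: integrable_induct)
  case (base A c)
  have [measurable]: "A \<in> sets borel" using base by simp
  show ?case
  proof (rule translation_cont_approx)
    fix e :: real assume "e > 0"
    define d where "d = e / (norm c + 1)"
    have d: "d > 0" using \<open>e > 0\<close> by (auto simp: d_def intro!: divide_pos_pos add_nonneg_pos)
    obtain U where U: "open U" "A \<subseteq> U" "emeasure lborel (U - A) < d"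
      using outer_regular_lborel[OF _ d, of A] by auto
    have [measurable]: "U \<in> sets borel" using U by simp
    have "emeasure lborel U = emeasure lborel A + emeasure lborel (U - A)"
      using U by (subst plus_emeasure) (auto simp: Un_absorb1)
    also have "\<dots> < \<infinity>" using base U(3) by (simp add: less_top) (metis ennreal_less_top less_trans top.not_eq_extremum)
    finally have fin: "emeasure lborel U < \<infinity>" .
    have "(\<integral>\<^sup>+x. norm (indicator A x *\<^sub>R c - indicator U x *\<^sub>R c) \<partial>lborel) = (\<integral>\<^sup>+x. ennreal (norm c) * indicator (U - A) x \<partial>lborel)"
      using U by (intro nn_integral_cong) (auto simp: indicator_def)
    also have "\<dots> = ennreal (norm c) * emeasure lborel (U - A)" by (simp add: nn_integral_cmult)
    also have "\<dots> \<le> ennreal (norm c) * ennreal d" using U(3) by (intro mult_left_mono) auto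
    also have "\<dots> = ennreal (norm c * d)" using d by (simp add: ennreal_mult)
    also have "\<dots> < ennreal e"
    proof (rule ennreal_lessI)
      show "norm c * d < e" using \<open>e > 0\<close> add_nonneg_pos[of "norm c" 1] by (simp add: d_def divide_simps)
    qed (use \<open>e > 0\<close> in auto)
    finally have "(\<integral>\<^sup>+x. norm (indicator A x *\<^sub>R c - indicator U x *\<^sub>R c) \<partial>lborel) < ennreal e" .
    then show "\<exists>h\<in>borel_measurable borel. translation_cont h \<and> (\<integral>\<^sup>+x. norm (indicator A x *\<^sub>R c - h x) \<partial>lborel) < ennreal e"
      by (intro bexI[of _ "\<lambda>x. indicator U x *\<^sub>R c"] conjI translation_cont_open[OF U(1) fin]) auto
  qed simp
next
  case (add f g)
  have [measurable]: "f \<in> borel_measurable borel" "g \<in> borel_measurable borel" using add by auto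
  show ?case unfolding translation_cont_def
  proof (intro allI impI)
    fix e :: real assume "e > 0"
    then have "\<forall>\<^sub>F n in sequentially. (\<integral>\<^sup>+x. norm (f (x + z n) - f x) \<partial>lborel) < ennreal (e/2)"
       "\<forall>\<^sub>F n in sequentially. (\<integral>\<^sup>+x. norm (g (x + z n) - g x) \<partial>lborel) < ennreal (e/2)"
      using add unfolding translation_cont_def by auto
    then show "\<forall>\<^sub>F n in sequentially. (\<integral>\<^sup>+x. norm (f (x + z n) + g (x + z n) - (f x + g x)) \<partial>lborel) < ennreal e"
    proof eventually_elim
      case (elim n)
      have "(\<integral>\<^sup>+x. norm (f (x + z n) + g (x + z n) - (f x + g x)) \<partial>lborel) \<le>
        (\<integral>\<^sup>+x. norm (f (x + z n) - f x) + norm (g (x + z n) - g x) \<partial>lborel)"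
        by (intro nn_integral_mono ennreal_leI) (metis add_diff_add norm_triangle_ineq)
      also have "\<dots> = (\<integral>\<^sup>+x. norm (f (x + z n) - f x) \<partial>lborel) + (\<integral>\<^sup>+x. norm (g (x + z n) - g x) \<partial>lborel)"
        by (simp add: nn_integral_add ennreal_plus)
      also have "\<dots> < ennreal (e/2) + ennreal (e/2)" using elim by (intro add_strict_mono)
      also have "\<dots> = ennreal e" using \<open>e > 0\<close> by (simp flip: ennreal_plus)
      finally show ?case .
    qed
  qed
next
  case (lim f s)
  have [measurable]: "f \<in> borel_measurable borel" "\<And>i. s i \<in> borel_measurable borel" using lim by auto
  have bound: "norm (s i x) \<le> 2 * norm (f x)" and conv: "(\<lambda>i. s i x) \<longlonglongrightarrow> f x" for i x
    using lim by auto
  show ?case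
  proof (rule translation_cont_approx)
    fix e :: real assume "e > 0"
    have "(\<lambda>i. \<integral>\<^sup>+x. norm (f x - s i x) \<partial>lborel) \<longlonglongrightarrow> (\<integral>\<^sup>+(x::'a). 0 \<partial>lborel)"
    proof (rule nn_integral_dominated_convergence[where w="\<lambda>x. 3 * norm (f x)"])
      show "AE x in lborel. ennreal (norm (f x - s j x)) \<le> ennreal (3 * norm (f x))" for j
      proof (rule AE_I2)
        fix x show "ennreal (norm (f x - s j x)) \<le> ennreal (3 * norm (f x))"
          using norm_triangle_ineq4[of "f x" "s j x"] bound[of j x] by (intro ennreal_leI) auto
      qed
      show "(\<integral>\<^sup>+ x. ennreal (3 * norm (f x)) \<partial>lborel) < \<infinity>"
        using \<open>integrable lborel f\<close> by (simp add: integrable_iff_bounded ennreal_mult nn_integral_cmult ennreal_mult_less_top)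
      show "AE x in lborel. (\<lambda>i. ennreal (norm (f x - s i x))) \<longlonglongrightarrow> 0"
      proof (rule AE_I2)
        fix x
        have "(\<lambda>i. norm (f x - s i x)) \<longlonglongrightarrow> norm (f x - f x)" by (intro tendsto_intros conv)
        then show "(\<lambda>i. ennreal (norm (f x - s i x))) \<longlonglongrightarrow> 0" 
          using tendsto_ennrealI by fastforce
      qed
    qed auto
    then have "\<forall>\<^sub>F i in sequentially. (\<integral>\<^sup>+x. norm (f x - s i x) \<partial>lborel) < ennreal e"
      by (rule order_tendstoD) (use \<open>e > 0\<close> in simp)
    then obtain i where "(\<integral>\<^sup>+x. norm (f x - s i x) \<partial>lborel) < ennreal e"
      using eventually_happens'[OF sequentially_bot] by blast
    then show "\<exists>h\<in>borel_measurable borel. translation_cont h \<and> (\<integral>\<^sup>+x. norm (f x - h x) \<partial>lborel) < ennreal e"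
      using lim by (intro bexI[of _ "s i"]) auto
  qed simp
qed

end

lemma L1_translation_cont:
  fixes f :: "'a::euclidean_space \<Rightarrow> 'b::euclidean_space"
  assumes "integrable lborel f" "(e::real) > 0"
  shows "\<exists>d>0. \<forall>z. norm z < d \<longrightarrow> (\<integral>\<^sup>+x. norm (f (x + z) - f x) \<partial>lborel) \<le> ennreal e"
proof (rule ccontr)
  assume "\<not> ?thesis"
  then have "\<exists>z. norm z < 1 / real (Suc n) \<and> \<not> (\<integral>\<^sup>+x. norm (f (x + z) - f x) \<partial>lborel) \<le> ennreal e" for n
    by (metis of_nat_0_less_iff zero_less_Suc zero_less_divide_1_iff)
  then obtain z where z: "\<And>n. norm (z n) < 1 / real (Suc n)"
    and ze: "\<And>n. \<not> (\<integral>\<^sup>+x. norm (f (x + z n) - f x) \<partial>lborel) \<le> ennreal e" by metis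
  have "z \<longlonglongrightarrow> 0"
    using z by (intro Lim_null_comparison[OF always_eventually LIMSEQ_Suc[OF lim_1_over_n]]) (auto intro: less_imp_le)
  from translation_cont_integrable[OF this assms(1)] assms(2)
  have "\<forall>\<^sub>F n in sequentially. (\<integral>\<^sup>+x. norm (f (x + z n) - f x) \<partial>lborel) < ennreal e"
    unfolding translation_cont_def[OF \<open>z \<longlonglongrightarrow> 0\<close>] by auto
  then show False using ze less_imp_le by (auto simp: eventually_sequentially)
qed

section \<open>Mollification\<close>

lemma borel_ball [measurable]: "ball (x :: 'a::metric_space) r \<in> sets borel"
  by (intro borel_open open_ball)

text \<open>The analysis runs on Borel functions over \<open>lborel\<close>, where Tonelli applies
  to expressions in \<open>x + z\<close> or \<open>x - y\<close>; Lebesgue measurable data enter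
  only through Borel representatives.\<close>

definition loc_int :: "(real^'n::finite \<Rightarrow> 'b::euclidean_space) \<Rightarrow> bool" where
  "loc_int u \<longleftrightarrow> u \<in> borel_measurable borel \<and> (\<forall>R. integrable lborel (\<lambda>x. indicator (ball 0 R) x *\<^sub>R u x))"

lemma loc_int_measurable [measurable_dest]: "loc_int u \<Longrightarrow> u \<in> borel_measurable borel"
  by (simp add: loc_int_def)

lemma loc_int_integrable_mult:
  fixes u :: "real^'n::finite \<Rightarrow> 'b::euclidean_space" and K :: "real^'n::finite \<Rightarrow> real"
  assumes u: "loc_int u" and [measurable]: "K \<in> borel_measurable borel"
    and K: "\<And>y. norm y \<ge> R \<Longrightarrow> K y = 0" "\<And>y. \<bar>K y\<bar> \<le> B"
  shows "integrable lborel (\<lambda>y. K y *\<^sub>R u y)"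
proof (rule Bochner_Integration.integrable_bound)
  show "integrable lborel (\<lambda>y. B *\<^sub>R (indicator (ball 0 R) y *\<^sub>R u y))"
    using u by (intro integrable_scaleR_right) (auto simp: loc_int_def)
  show "AE y in lborel. norm (K y *\<^sub>R u y) \<le> norm (B *\<^sub>R (indicator (ball 0 R) y *\<^sub>R u y))"
  proof (rule AE_I2)
    fix y show "norm (K y *\<^sub>R u y) \<le> norm (B *\<^sub>R (indicator (ball 0 R) y *\<^sub>R u y))"
      using K(1)[of y] K(2)[of y] by (cases "norm y \<ge> R") (auto intro!: mult_right_mono)
  qed
qed (use u in measurable)

lemma bounded_support_bounded:
  fixes K :: "'a::euclidean_space \<Rightarrow> 'b::real_normed_vector"
  assumes "continuous_on UNIV K" "\<And>y. norm y \<ge> R \<Longrightarrow> K y = 0"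
  obtains B where "\<And>y. norm (K y) \<le> B" "B > 0"
proof -
  have "compact (K ` cball 0 R)"
    using assms(1) by (intro compact_continuous_image) (auto intro: continuous_on_subset)
  then obtain B where "B > 0" "\<forall>y\<in>K ` cball 0 R. norm y \<le> B" using bounded_pos compact_imp_bounded by blast
  then have "norm (K y) \<le> B" for y
    using assms(2)[of y] by (cases "norm y \<ge> R") auto
  then show ?thesis using \<open>B > 0\<close> that by blast
qed

lemma bounded_support_uniform:
  fixes K :: "'a::euclidean_space \<Rightarrow> 'b::real_normed_vector"
  assumes "continuous_on UNIV K" "\<And>y. norm y \<ge> R \<Longrightarrow> K y = 0" "e > 0"
  obtains d where "d > 0" "d < 1" "\<And>a w. norm w < d \<Longrightarrow> norm (K (a + w) - K a) \<le> e"
proof -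
  have "uniformly_continuous_on (cball 0 (R + 1)) K"
    using assms(1) by (intro compact_uniformly_continuous) (auto intro: continuous_on_subset)
  then obtain d where d: "d > 0" "\<And>x y. x \<in> cball 0 (R+1) \<Longrightarrow> y \<in> cball 0 (R+1) \<Longrightarrow> dist y x < d \<Longrightarrow> dist (K y) (K x) < e"
    using \<open>e > 0\<close> unfolding uniformly_continuous_on_def by metis
  have "norm (K (a + w) - K a) \<le> e" if "norm w < min d (1/2)" for a w
  proof (cases "norm a \<le> R + 1 \<and> norm (a + w) \<le> R + 1")
    case True
    then show ?thesis using less_imp_le[OF d(2)[of a "a + w"]] that by (simp only: dist_norm mem_cball_0 add_diff_cancel_left')
  next
    case False
    then have "norm a \<ge> R" "norm (a + w) \<ge> R"
      using that norm_triangle_ineq[of a w] norm_triangle_ineq4[of "a + w" w] by auto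
    then show ?thesis using assms by simp
  qed
  then show ?thesis using d(1) that[of "min d (1/2)"] by simp
qed

definition moll :: "real \<Rightarrow> (real^'n::finite \<Rightarrow> 'b::euclidean_space) \<Rightarrow> real^'n \<Rightarrow> 'b" where
  "moll e u x = (\<integral>y. eta e (x - y) *\<^sub>R u y \<partial>lborel)"

context fixes e :: real assumes e: "e > 0" begin

lemma eta_shift_support: "norm y \<ge> norm x + e \<Longrightarrow> eta e (x - y) = 0"
  using norm_triangle_ineq2[of y x] by (intro eta_eq_0[OF e]) (simp add: norm_minus_commute)

lemma eta'_shift_support: "norm y \<ge> norm x + e \<Longrightarrow> eta' e (x - y) = 0"
  using norm_triangle_ineq2[of y x] by (intro eta'_eq_0[OF e]) (simp add: norm_minus_commute)

lemma moll_integrable: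
  fixes u :: "real^'n::finite \<Rightarrow> 'b::euclidean_space" and x :: "real^'n::finite"
  assumes "loc_int u" shows "integrable lborel (\<lambda>y. eta e (x - y) *\<^sub>R u y)"
proof -
  obtain B where "\<And>y::real^'n. norm (eta e y) \<le> B"
    using bounded_support_bounded[of "eta e :: real^'n \<Rightarrow> real" e] eta_eq_0[OF e] continuous_on_eta[OF continuous_on_id] by metis
  then show ?thesis
    using eta_shift_support[of x] by (intro loc_int_integrable_mult[OF assms, of _ "norm x + e" B]) auto
qed

lemma moll_local_bound:
  fixes u :: "real^'n::finite \<Rightarrow> 'b::euclidean_space" and K :: "real^'n::finite \<Rightarrow> real"
  assumes u: "loc_int u" and [measurable]: "K \<in> borel_measurable borel"
    and K: "\<And>y. norm y \<ge> R \<Longrightarrow> K y = 0" "\<And>y. \<bar>K y\<bar> \<le> B" and "B \<ge> 0"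
  shows "norm (\<integral>y. K y *\<^sub>R u y \<partial>lborel) \<le> B * (\<integral>y. norm (indicator (ball 0 R) y *\<^sub>R u y) \<partial>lborel)"
proof -
  have "norm (\<integral>y. K y *\<^sub>R u y \<partial>lborel) \<le> (\<integral>y. norm (K y *\<^sub>R u y) \<partial>lborel)"
    by (rule integral_norm_bound)
  also have "\<dots> \<le> (\<integral>y. B * norm (indicator (ball 0 R) y *\<^sub>R u y) \<partial>lborel)"
  proof (rule integral_mono)
    show "integrable lborel (\<lambda>y. norm (K y *\<^sub>R u y))"
      by (intro integrable_norm loc_int_integrable_mult[OF u _ K]) auto
    show "integrable lborel (\<lambda>y. B * norm (indicator (ball 0 R) y *\<^sub>R u y))"
      using u by (intro integrable_mult_right integrable_norm) (auto simp: loc_int_def)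
    show "norm (K y *\<^sub>R u y) \<le> B * norm (indicator (ball 0 R) y *\<^sub>R u y)" for y
      using K(1)[of y] K(2)[of y] by (cases "norm y \<ge> R") (auto intro!: mult_right_mono)
  qed
  finally show ?thesis by simp
qed

lemma continuous_moll:
  fixes u :: "real^'n::finite \<Rightarrow> 'b::euclidean_space"
  assumes u: "loc_int u" shows "continuous_on UNIV (moll e u)"
  unfolding continuous_on_iff
proof (intro ballI allI impI)
  fix x :: "real^'n" and \<epsilon> :: real assume "\<epsilon> > 0"
  define I where "I = (\<integral>y. norm (indicator (ball 0 (norm x + e + 1)) y *\<^sub>R u y) \<partial>lborel)"
  have I: "I \<ge> 0" unfolding I_def by simp
  define \<epsilon>' where "\<epsilon>' = \<epsilon> / (I + 1) / 2"
  have \<epsilon>': "\<epsilon>' > 0" "\<epsilon>' * I < \<epsilon>" using I \<open>\<epsilon> > 0\<close> add_nonneg_pos[of "I * \<epsilon>" "\<epsilon> * 2"] by (auto simp: \<epsilon>'_def divide_simps algebra_simps)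
  obtain d where d: "d > 0" "d < 1" "\<And>a w::real^'n. norm w < d \<Longrightarrow> norm (eta e (a + w) - eta e a) \<le> \<epsilon>'"
    using bounded_support_uniform[of "eta e :: real^'n \<Rightarrow> real" e \<epsilon>'] eta_eq_0[OF e] continuous_on_eta[OF continuous_on_id] \<epsilon>' by metis
  have "dist (moll e u x') (moll e u x) < \<epsilon>" if "dist x' x < d" for x'
  proof -
    \<comment> \<open>Both kernels vanish outside one ball, since their centres differ by less than
      1.\<close>
    have nx: "norm x' \<le> norm x + 1" using norm_triangle_ineq2[of x' x] that d(2) by (simp add: dist_norm)
    have "moll e u x' - moll e u x = (\<integral>y. (eta e (x' - y) - eta e (x - y)) *\<^sub>R u y \<partial>lborel)"
      unfolding moll_def by (simp add: scaleR_diff_left Bochner_Integration.integral_diff moll_integrable[OF u])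
    also have "norm \<dots> \<le> \<epsilon>' * I"
      unfolding I_def
    proof (rule moll_local_bound[OF u])
      show "eta e (x' - y) - eta e (x - y) = 0" if "norm x + e + 1 \<le> norm y" for y
        using eta_shift_support[of x y] eta_shift_support[of x' y] nx that by simp
      show "\<bar>eta e (x' - y) - eta e (x - y)\<bar> \<le> \<epsilon>'" for y
        using d(3)[of "x' - x" "x - y"] that by (simp add: dist_norm)
    qed (use \<epsilon>' in auto)
    finally show ?thesis using \<epsilon>' by (simp add: dist_norm)
  qed
  then show "\<exists>d>0. \<forall>x'\<in>UNIV. dist x' x < d \<longrightarrow> dist (moll e u x') (moll e u x) < \<epsilon>"
    using d by blast
qed

lemma eta'_integrable:
  fixes u :: "real^'n::finite \<Rightarrow> real" and x :: "real^'n::finite"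
  assumes u: "loc_int u" shows "integrable lborel (\<lambda>y. u y *\<^sub>R eta' e (x - y))"
proof -
  obtain B where B: "\<And>y::real^'n. norm (eta' e y) \<le> B" "B > 0"
    using bounded_support_bounded[of "eta' e :: real^'n \<Rightarrow> _" e] eta'_eq_0[OF e] continuous_on_eta'[OF continuous_on_id] by metis
  show "integrable lborel (\<lambda>y. u y *\<^sub>R eta' e (x - y))"
  proof (rule Bochner_Integration.integrable_bound)
    show "integrable lborel (\<lambda>y. B * (indicator (ball 0 (norm x + e)) y *\<^sub>R u y))"
      using u by (intro integrable_mult_right) (auto simp: loc_int_def)
    show "AE y in lborel. norm (u y *\<^sub>R eta' e (x - y)) \<le> norm (B * (indicator (ball 0 (norm x + e)) y *\<^sub>R u y))"
    proof (rule AE_I2)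
      fix y show "norm (u y *\<^sub>R eta' e (x - y)) \<le> norm (B * (indicator (ball 0 (norm x + e)) y *\<^sub>R u y))"
        using B(1)[of "x - y"] B(2) eta'_shift_support[of x y] 
        by (cases "norm y \<ge> norm x + e") (auto simp: abs_mult mult.commute[of B] intro!: mult_left_mono)
    qed
  qed (use u in measurable)
qed

text \<open>Differentiation under the integral sign: uniform continuity of \<open>eta'\<close>
  bounds the first-order remainder of the kernel by \<open>norm w * \<epsilon>'\<close>, uniformly
  in \<open>y\<close>, and the remainder lives in a fixed ball on which \<open>u\<close> is
  integrable.\<close>

lemma moll_has_derivative_aux:
  fixes u :: "real^'n::finite \<Rightarrow> real"
  assumes u: "loc_int u" 
  shows "(moll e u has_derivative (\<lambda>w. (\<integral>y. u y *\<^sub>R eta' e (x - y) \<partial>lborel) \<bullet> w)) (at x)"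
  unfolding has_derivative_at_alt
proof (intro conjI allI impI)
  show "bounded_linear (\<lambda>w. (\<integral>y. u y *\<^sub>R eta' e (x - y) \<partial>lborel) \<bullet> w)"
    by (rule bounded_linear_inner_right)
  fix \<epsilon> :: real assume "\<epsilon> > 0"
  define I where "I = (\<integral>y. norm (indicator (ball 0 (norm x + e + 1)) y *\<^sub>R u y) \<partial>lborel)"
  have I: "I \<ge> 0" unfolding I_def by simp
  define \<epsilon>' where "\<epsilon>' = \<epsilon> / (I + 1) / 2"
  have \<epsilon>': "\<epsilon>' > 0" "\<epsilon>' * I < \<epsilon>" using I \<open>\<epsilon> > 0\<close> add_nonneg_pos[of "I * \<epsilon>" "\<epsilon> * 2"] by (auto simp: \<epsilon>'_def divide_simps algebra_simps)
  obtain d where d: "d > 0" "d < 1" "\<And>a w::real^'n. norm w < d \<Longrightarrow> norm (eta' e (a + w) - eta' e a) \<le> \<epsilon>'"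
    using bounded_support_uniform[of "eta' e :: real^'n \<Rightarrow> _" e \<epsilon>'] eta'_eq_0[OF e] continuous_on_eta'[OF continuous_on_id] \<epsilon>' by metis
  note int' = eta'_integrable[OF u, of x]
  have "norm (moll e u x' - moll e u x - (\<integral>y. u y *\<^sub>R eta' e (x - y) \<partial>lborel) \<bullet> (x' - x)) \<le> \<epsilon> * norm (x' - x)"
    if "norm (x' - x) < d" for x'
  proof -
    define w where "w = x' - x"
    have nx: "norm x' \<le> norm x + 1" using norm_triangle_ineq2[of x' x] that d(2) by simp
    have taylor: "norm (eta e (a + w) - eta e a - eta' e a \<bullet> w) \<le> norm w * \<epsilon>'" for a
    proof -
      have "norm (eta e (a + w) - eta e a - eta' e a \<bullet> (a + w - a)) \<le> norm (a + w - a) * \<epsilon>'"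
      proof (rule differentiable_bound_linearization[where a=a and b="a + w" and S="ball a d" and f="eta e" and f'="\<lambda>y v. eta' e y \<bullet> v" and ?x0.0=a and B=\<epsilon>'])
        show "t \<in> {0..1} \<Longrightarrow> a + t *\<^sub>R (a + w - a) \<in> ball a d" for t
          using that mult_left_le_one_le[of "norm w" t] by (auto simp: w_def dist_norm)
        show "(eta e has_derivative (\<lambda>v. eta' e y \<bullet> v)) (at y within ball a d)" for y
          by (rule has_derivative_at_withinI[OF eta_derivative[OF e]])
        show "onorm ((\<lambda>v. eta' e y \<bullet> v) - (\<lambda>v. eta' e a \<bullet> v)) \<le> \<epsilon>'" if "y \<in> ball a d" for y
        proof (rule onorm_le)
          fix v
          have "norm (((\<lambda>v. eta' e y \<bullet> v) - (\<lambda>v. eta' e a \<bullet> v)) v) = \<bar>(eta' e y - eta' e a) \<bullet> v\<bar>"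
            by (simp add: inner_diff_left)
          also have "\<dots> \<le> norm (eta' e y - eta' e a) * norm v" by (rule Cauchy_Schwarz_ineq2)
          also have "\<dots> \<le> \<epsilon>' * norm v"
            using d(3)[of "y - a" a] that by (intro mult_right_mono) (auto simp: dist_norm norm_minus_commute)
          finally show "norm (((\<lambda>v. eta' e y \<bullet> v) - (\<lambda>v. eta' e a \<bullet> v)) v) \<le> \<epsilon>' * norm v" .
        qed
      qed (use d in auto)
      then show ?thesis by simp
    qed
    have "moll e u x' - moll e u x - (\<integral>y. u y *\<^sub>R eta' e (x - y) \<partial>lborel) \<bullet> w
       = (\<integral>y. (eta e (x' - y) - eta e (x - y) - eta' e (x - y) \<bullet> w) *\<^sub>R u y \<partial>lborel)"
    proof -
      have "(\<integral>y. u y *\<^sub>R eta' e (x - y) \<partial>lborel) \<bullet> w = (\<integral>y. (u y *\<^sub>R eta' e (x - y)) \<bullet> w \<partial>lborel)"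
        by (rule integral_inner_left[symmetric]) (use int' in simp)
      moreover have "integrable lborel (\<lambda>y. (u y *\<^sub>R eta' e (x - y)) \<bullet> w)"
        using int' by (intro integrable_inner_left) simp
      ultimately show ?thesis
        unfolding moll_def using moll_integrable[OF u, of x] moll_integrable[OF u, of x']
        by (simp add: right_diff_distrib mult.commute)
    qed
    also have "norm \<dots> \<le> (norm w * \<epsilon>') * I"
      unfolding I_def
    proof (rule moll_local_bound[OF u])
      show "eta e (x' - y) - eta e (x - y) - eta' e (x - y) \<bullet> w = 0" if "norm x + e + 1 \<le> norm y" for y
        using eta_shift_support[of x y] eta_shift_support[of x' y] eta'_shift_support[of x y] nx that by simp
      show "\<bar>eta e (x' - y) - eta e (x - y) - eta' e (x - y) \<bullet> w\<bar> \<le> norm w * \<epsilon>'" for y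
        using taylor[of "x - y"] by (simp add: w_def)
    qed (use \<epsilon>' in auto)
    also have "\<dots> \<le> norm w * \<epsilon>" using \<epsilon>' by (simp add: mult.assoc mult_left_mono)
    finally show ?thesis by (simp add: w_def mult.commute)
  qed
  then show "\<exists>d>0. \<forall>x'. norm (x' - x) < d \<longrightarrow> 
      norm (moll e u x' - moll e u x - (\<integral>y. u y *\<^sub>R eta' e (x - y) \<partial>lborel) \<bullet> (x' - x)) \<le> \<epsilon> * norm (x' - x)"
    using d by blast
qed

lemma nn_integral_eta: "(\<integral>\<^sup>+z. eta e (z::real^'n::finite) \<partial>lborel) = 1"
  using integrable_eta[OF e] integral_eta[OF e] eta_nonneg[OF e]
  by (subst nn_integral_eq_integral) auto

text \<open>The difference between \<open>moll e u\<close> and \<open>u\<close> is an average of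
  \<open>u (x - z) - u x\<close> over \<open>norm z \<le> e\<close>, so Tonelli bounds it by the
  worst translate. Cutting \<open>u\<close> off at radius \<open>R + 1\<close> makes it integrable
  and, because \<open>e \<le> 1\<close>, changes nothing that is seen from
  \<open>ball 0 R\<close>.\<close>

lemma moll_conv_bound:
  fixes u :: "real^'n::finite \<Rightarrow> 'b::euclidean_space"
  assumes u: "loc_int u" and "e \<le> 1"
    and d: "\<And>z. norm z \<le> e \<Longrightarrow> (\<integral>\<^sup>+x. norm (indicator (ball 0 (R + 1)) (x + z) *\<^sub>R u (x + z) - indicator (ball 0 (R + 1)) x *\<^sub>R u x) \<partial>lborel) \<le> \<epsilon>"
  shows "(\<integral>\<^sup>+x\<in>ball 0 R. norm (moll e u x - u x) \<partial>lborel) \<le> \<epsilon>"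
proof -
  define F where "F x = indicator (ball 0 (R + 1)) x *\<^sub>R u x" for x
  have um[measurable]: "u \<in> borel_measurable borel" using u by (simp add: loc_int_def)
  have [measurable]: "F \<in> borel_measurable borel" 
    unfolding F_def by (intro borel_measurable_scaleR borel_measurable_indicator um) simp
  have ie: "integrable lborel (eta e :: real^'n \<Rightarrow> real)" by (rule integrable_eta[OF e])
  have F: "loc_int F"
    unfolding loc_int_def
  proof (intro conjI allI)
    fix r
    show "integrable lborel (\<lambda>x. indicator (ball 0 r) x *\<^sub>R F x)"
    proof (rule Bochner_Integration.integrable_bound)
      show "integrable lborel F" using u by (simp add: F_def[abs_def] loc_int_def)
      show "AE x in lborel. norm (indicator (ball 0 r) x *\<^sub>R F x) \<le> norm (F x)" 
        by (intro AE_I2) (simp add: indicator_def)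
    qed simp
  qed simp
  have bd: "norm (moll e u x - u x) \<le> (\<integral>\<^sup>+z. eta e z * ennreal (norm (F (x - z) - F x)) \<partial>lborel)" if x: "x \<in> ball 0 R" for x
  proof -
    have "moll e u x = (\<integral>y. eta e (x - y) *\<^sub>R F y \<partial>lborel)" unfolding moll_def
    proof (intro Bochner_Integration.integral_cong refl)
      fix y show "eta e (x - y) *\<^sub>R u y = eta e (x - y) *\<^sub>R F y"
        using eta_shift_support[of x y] x \<open>e \<le> 1\<close> by (cases "norm y < R + 1") (auto simp: F_def)
    qed
    also have "\<dots> = (\<integral>z. eta e z *\<^sub>R F (x - z) \<partial>lborel)"
      using integral_reflect[of "\<lambda>y. eta e (x - y) *\<^sub>R F y" x] by simp
    finally have m: "moll e u x = (\<integral>z. eta e z *\<^sub>R F (x - z) \<partial>lborel)" .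
    have ux: "u x = (\<integral>(z::real^'n). eta e z *\<^sub>R F x \<partial>lborel)"
      using x integral_eta[OF e, where 'n='n] ie by (subst integral_scaleR_left) (auto simp: F_def)
    have int1: "integrable lborel (\<lambda>z. eta e z *\<^sub>R F (x - z))"
    proof -
      have "integrable (distr lborel borel (\<lambda>z. x - z)) (\<lambda>y. eta e (x - y) *\<^sub>R F y)"
        unfolding distr_reflect by (rule moll_integrable[OF F])
      then show ?thesis by (subst (asm) integrable_distr_eq) auto
    qed
    have int2: "integrable lborel (\<lambda>z::real^'n. eta e z *\<^sub>R F x)" 
      using ie by (intro integrable_scaleR_left) auto
    have "moll e u x - u x = (\<integral>z. eta e z *\<^sub>R F (x - z) - eta e z *\<^sub>R F x \<partial>lborel)"
      by (subst m, subst ux, rule Bochner_Integration.integral_diff[OF int1 int2, symmetric])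
    moreover have "norm (\<integral>z. eta e z *\<^sub>R F (x - z) - eta e z *\<^sub>R F x \<partial>lborel) \<le> 
        (\<integral>\<^sup>+z. norm (eta e z *\<^sub>R F (x - z) - eta e z *\<^sub>R F x) \<partial>lborel)"
      by (rule integral_norm_bound_ennreal[OF Bochner_Integration.integrable_diff[OF int1 int2]])
    ultimately have "norm (moll e u x - u x) \<le> (\<integral>\<^sup>+z. norm (eta e z *\<^sub>R (F (x - z) - F x)) \<partial>lborel)"
      by (simp only: scaleR_diff_right)
    also have "\<dots> = (\<integral>\<^sup>+z. eta e z * ennreal (norm (F (x - z) - F x)) \<partial>lborel)"
      by (intro nn_integral_cong) (simp add: ennreal_mult eta_nonneg[OF e] abs_of_nonneg)
    finally show ?thesis .
  qed
  have "(\<integral>\<^sup>+x\<in>ball 0 R. norm (moll e u x - u x) \<partial>lborel) \<le> (\<integral>\<^sup>+x. \<integral>\<^sup>+z. eta e z * ennreal (norm (F (x - z) - F x)) \<partial>lborel \<partial>lborel)"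
    using bd by (intro nn_integral_mono) (auto split: split_indicator)
  also have "\<dots> = (\<integral>\<^sup>+z. \<integral>\<^sup>+x. eta e z * ennreal (norm (F (x - z) - F x)) \<partial>lborel \<partial>lborel)"
    by (rule tonelli_lborel) measurable
  also have "\<dots> = (\<integral>\<^sup>+z. eta e z * (\<integral>\<^sup>+x. norm (F (x - z) - F x) \<partial>lborel) \<partial>lborel)"
    by (intro nn_integral_cong nn_integral_cmult) measurable
  also have "\<dots> \<le> (\<integral>\<^sup>+(z::real^'n). eta e z * \<epsilon> \<partial>lborel)"
  proof (intro nn_integral_mono)
    fix z :: "real^'n"
    show "ennreal (eta e z) * (\<integral>\<^sup>+x. norm (F (x - z) - F x) \<partial>lborel) \<le> eta e z * \<epsilon>"
    proof (cases "norm z \<le> e")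
      case True
      then have "(\<integral>\<^sup>+x. norm (F (x - z) - F x) \<partial>lborel) \<le> \<epsilon>"
        using d[of "- z"] by (simp add: F_def)
      then show ?thesis by (intro mult_left_mono) auto
    next
      case False
      then show ?thesis using eta_eq_0[OF e, of z] by simp
    qed
  qed
  also have "\<dots> = \<epsilon>" using nn_integral_eta[where 'n='n] by (simp add: nn_integral_multc)
  finally show ?thesis .
qed

end

lemma moll_tendsto:
  fixes u :: "real^'n::finite \<Rightarrow> 'b::euclidean_space"
  assumes u: "loc_int u"
  shows "((\<lambda>e. \<integral>\<^sup>+x\<in>ball 0 R. norm (moll e u x - u x) \<partial>lborel) \<longlongrightarrow> 0) (at_right 0)"
proof (rule order_tendstoI)
  fix a :: ennreal assume "0 < a"
  then obtain b where b: "0 < b" "b < a" using dense by blast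
  then obtain \<epsilon> :: real where \<epsilon>: "0 < \<epsilon>" "ennreal \<epsilon> < a"
    by (cases b) auto
  have "integrable lborel (\<lambda>x. indicator (ball 0 (R + 1)) x *\<^sub>R u x)" using u by (simp add: loc_int_def)
  from L1_translation_cont[OF this \<epsilon>(1)] obtain d where d: "d > 0"
    "\<And>z. norm z < d \<Longrightarrow> (\<integral>\<^sup>+x. norm (indicator (ball 0 (R + 1)) (x + z) *\<^sub>R u (x + z) - indicator (ball 0 (R + 1)) x *\<^sub>R u x) \<partial>lborel) \<le> ennreal \<epsilon>"
    by auto
  have "(\<integral>\<^sup>+x\<in>ball 0 R. norm (moll e u x - u x) \<partial>lborel) < a" if "0 < e" "e < min d 1" for e
  proof -
    have "(\<integral>\<^sup>+x\<in>ball 0 R. norm (moll e u x - u x) \<partial>lborel) \<le> ennreal \<epsilon>"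
      by (rule moll_conv_bound[OF that(1) u _ d(2)]) (use that in auto)
    then show ?thesis using \<epsilon> by order
  qed
  then show "\<forall>\<^sub>F e in at_right 0. (\<integral>\<^sup>+x\<in>ball 0 R. norm (moll e u x - u x) \<partial>lborel) < a"
    using d(1) by (auto simp: eventually_at_right_field intro!: exI[of _ "min d 1"])
qed simp

section \<open>Weak gradients of Borel functions\<close>

definition wgrad :: "(real^'n::finite \<Rightarrow> real) \<Rightarrow> (real^'n \<Rightarrow> real^'n) \<Rightarrow> bool" where
  "wgrad u g \<longleftrightarrow> loc_int u \<and> loc_int g \<and>
     (\<forall>\<phi> i. test_fun \<phi> \<longrightarrow> (\<integral>x. u x * pd [i] \<phi> x \<partial>lborel) = - (\<integral>x. g x $ i * \<phi> x \<partial>lborel))"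

lemma has_derivative_continuous_on_UNIV:
  fixes f :: "'a::real_normed_vector \<Rightarrow> 'b::real_normed_vector"
  assumes "\<And>x. (f has_derivative f' x) (at x)" shows "continuous_on UNIV f"
  by (meson assms continuous_at_imp_continuous_on has_derivative_continuous)

lemma test_funE:
  fixes \<phi> :: "real^'n::finite \<Rightarrow> real"
  assumes "test_fun \<phi>"
  obtains R where "R > 0" "\<And>x. norm x \<ge> R \<Longrightarrow> \<phi> x = 0" "\<And>i x. norm x \<ge> R \<Longrightarrow> pd [i] \<phi> x = 0"
    "\<And>x. (\<phi> has_derivative frechet_derivative \<phi> (at x)) (at x)"
    "continuous_on UNIV \<phi>" "\<And>i. continuous_on UNIV (pd [i] \<phi>)"
proof -
  have d: "pd is \<phi> differentiable at x" for "is" x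
    using assms by (auto simp: test_fun_def smooth_fun_def)
  have 1: "(\<phi> has_derivative frechet_derivative \<phi> (at x)) (at x)" for x
    using d[of "[]" x] frechet_derivative_works by auto
  have 2: "continuous_on UNIV (pd is \<phi>)" for "is"
    using d by (meson continuous_at_imp_continuous_on differentiable_imp_continuous_within)
  obtain R where R: "R > 0" "closure {x. \<phi> x \<noteq> 0} \<subseteq> cball 0 R"
    using assms compact_imp_bounded unfolding test_fun_def by (metis bounded_subset_ballD subset_trans ball_subset_cball)
  have 3: "\<phi> x = 0" if "norm x > R" for x
    using R closure_subset[of "{x. \<phi> x \<noteq> 0}"] that by (auto simp: subset_iff not_le)
  have 4: "pd [i] \<phi> x = 0" if "norm x > R" for i x
  proof -
    have "((\<lambda>_. 0) has_derivative (\<lambda>_. 0)) (at x)" by simp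
    then have "(\<phi> has_derivative (\<lambda>_. 0)) (at x)"
      by (rule has_derivative_transform_within_open[where s="- cball 0 R"]) (use that 3 in auto)
    then show ?thesis by (simp flip: frechet_derivative_at)
  qed
  \<comment> \<open>Vanishing is known for \<open>norm x > R\<close>; the enlarged radius covers the
    boundary sphere as well.\<close>
  show ?thesis
    by (rule that[of "R + 1"]) (use R 1 2[of "[]"] 2 3 4 in \<open>auto simp del: pd.simps(2)\<close>)
qed

text \<open>Every difference quotient of \<open>F\<close> in the direction \<open>v\<close> has
  integral 0 by translation invariance. The mean value theorem bounds the quotients by
  \<open>B\<close> on a fixed ball, so dominated convergence passes to the derivative; this replaces
  integration in a single coordinate.\<close>

lemma integral_partial_eq_0:
  fixes F :: "real^'n::finite \<Rightarrow> real"
  assumes F: "\<And>x. (F has_derivative F' x) (at x)" and D: "continuous_on UNIV (\<lambda>x. F' x (axis i 1))"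
    and "\<And>x. norm x \<ge> R \<Longrightarrow> F x = 0" "\<And>x. norm x \<ge> R \<Longrightarrow> F' x (axis i 1) = 0"
  shows "(\<integral>x. F' x (axis i 1) \<partial>lborel) = 0"
proof -
  define v :: "real^'n" where "v = axis i 1"
  have v: "norm v = 1" by (simp add: v_def)
  have cF: "continuous_on UNIV F" by (rule has_derivative_continuous_on_UNIV[OF F])
  then have [measurable]: "F \<in> borel_measurable borel" by (rule borel_measurable_continuous_onI)
  have iF: "integrable lborel F" by (rule integrable_bounded_support[OF cF, of R]) (use assms in auto)
  obtain B where B: "\<And>x. norm (F' x v) \<le> B" "B > 0"
    using bounded_support_bounded[OF D assms(4)] unfolding v_def by metis
  define t where "t n = 1 / real (Suc n)" for n
  have t: "t n > 0" "t n \<le> 1" for n by (auto simp: t_def)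
  have t0: "t \<longlonglongrightarrow> 0" unfolding t_def using LIMSEQ_Suc[OF lim_1_over_n] by simp
  have line: "((\<lambda>s. F (x + s *\<^sub>R v)) has_real_derivative F' (x + s *\<^sub>R v) v) (at s)" for x s
  proof -
    have "((\<lambda>s. x + s *\<^sub>R v) has_derivative (\<lambda>h. h *\<^sub>R v)) (at s)" by (auto intro!: derivative_eq_intros)
    from has_derivative_compose[OF this F] 
    have "((\<lambda>s. F (x + s *\<^sub>R v)) has_derivative (\<lambda>h. F' (x + s *\<^sub>R v) (h *\<^sub>R v))) (at s)" .
    moreover have "F' y (h *\<^sub>R v) = F' y v * h" for y h
      using linear_scale[OF has_derivative_linear[OF F[of y]]] by (simp add: mult.commute)
    ultimately show ?thesis by (simp add: has_field_derivative_def mult.commute[of _ "F' _ _"])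
  qed
  have int: "integrable lborel (\<lambda>x. F (x + t n *\<^sub>R v))" for n
    by (rule integrable_bounded_support[of _ "R + 1"])
      (use t[of n] v in \<open>auto intro!: continuous_on_compose2[OF cF] continuous_intros assms(3) 
        order_trans[OF _ norm_diff_ineq]\<close>)
  have "(\<lambda>n. \<integral>x. (F (x + t n *\<^sub>R v) - F x) / t n \<partial>lborel) \<longlonglongrightarrow> (\<integral>x. F' x v \<partial>lborel)"
  proof (rule integral_dominated_convergence[where w="\<lambda>x. B * indicator (ball 0 (R + 2)) x"])
    show "(\<lambda>x. F' x v) \<in> borel_measurable lborel"
      using borel_measurable_continuous_onI[OF D] by (simp add: v_def)
    show "integrable lborel (\<lambda>x::real^'n. B * indicator (ball 0 (R + 2)) x)"
      by (intro integrable_mult_right integrable_real_indicator emeasure_lborel_ball_finite) simp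
    show "AE x in lborel. (\<lambda>n. (F (x + t n *\<^sub>R v) - F x) / t n) \<longlonglongrightarrow> F' x v"
    proof (rule AE_I2)
      fix x
      have "((\<lambda>s. (F (x + s *\<^sub>R v) - F (x + 0 *\<^sub>R v)) / (s - 0)) \<longlongrightarrow> F' x v) (at 0)"
        using line[of x 0] unfolding has_field_derivative_iff by simp
      then show "(\<lambda>n. (F (x + t n *\<^sub>R v) - F x) / t n) \<longlonglongrightarrow> F' x v"
        using t0 t by (auto simp: tendsto_at_iff_sequentially o_def dest!: spec[of _ t]) (metis less_irrefl)
    qed
    fix n
    show "AE x in lborel. norm ((F (x + t n *\<^sub>R v) - F x) / t n) \<le> B * indicator (ball 0 (R + 2)) x"
    proof (rule AE_I2)
      fix x
      show "norm ((F (x + t n *\<^sub>R v) - F x) / t n) \<le> B * indicator (ball 0 (R + 2)) x"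
      proof (cases "norm x < R + 2")
        case True
        obtain s where "F (x + t n *\<^sub>R v) - F (x + 0 *\<^sub>R v) = (t n - 0) * F' (x + s *\<^sub>R v) v"
          using MVT2[OF t(1) line] by metis
        then have "(F (x + t n *\<^sub>R v) - F x) / t n = F' (x + s *\<^sub>R v) v"
          using t(1)[of n] by simp
        then show ?thesis using True B(1) by simp
      next
        case False
        then have "norm (x + t n *\<^sub>R v) \<ge> R"
          using norm_diff_ineq[of x "t n *\<^sub>R v"] t[of n] v by simp
        then show ?thesis using assms(3) False by simp
      qed
    qed
  qed simp
  moreover have "(\<integral>x. (F (x + t n *\<^sub>R v) - F x) / t n \<partial>lborel) = 0" for n
    using int[of n] iF integral_translate[of F "t n *\<^sub>R v"] by simp
  ultimately have "(\<lambda>n::nat. 0) \<longlonglongrightarrow> (\<integral>x. F' x v \<partial>lborel)" by (simp only:)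
  then show ?thesis by (simp add: LIMSEQ_const_iff v_def)
qed

lemma C1_integration_by_parts:
  fixes f :: "real^'n::finite \<Rightarrow> real"
  assumes f: "\<And>x. (f has_derivative (\<lambda>w. G x \<bullet> w)) (at x)" and G: "continuous_on UNIV G"
    and \<phi>: "test_fun \<phi>"
  shows "(\<integral>x. f x * pd [i] \<phi> x \<partial>lborel) = - (\<integral>x. G x $ i * \<phi> x \<partial>lborel)"
proof -
  obtain R where R: "R > 0" "\<And>x. norm x \<ge> R \<Longrightarrow> \<phi> x = 0" "\<And>i x. norm x \<ge> R \<Longrightarrow> pd [i] \<phi> x = 0"
    "\<And>x. (\<phi> has_derivative frechet_derivative \<phi> (at x)) (at x)"
    "continuous_on UNIV \<phi>" "\<And>i. continuous_on UNIV (pd [i] \<phi>)"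
    using test_funE[OF \<phi>] by metis
  have cf: "continuous_on UNIV f" by (rule has_derivative_continuous_on_UNIV[OF f])
  have c1: "continuous_on UNIV (\<lambda>x. f x * pd [i] \<phi> x)"
    using R(6)[of i] by (intro continuous_intros cf)
  have c2: "continuous_on UNIV (\<lambda>x. G x $ i * \<phi> x)"
    by (intro continuous_intros G R)
  have "((\<lambda>x. f x * \<phi> x) has_derivative (\<lambda>w. f x * frechet_derivative \<phi> (at x) w + (G x \<bullet> w) * \<phi> x)) (at x)" for x
    by (rule has_derivative_mult[OF f R(4)])
  then have "(\<integral>x. f x * frechet_derivative \<phi> (at x) (axis i 1) + (G x \<bullet> axis i 1) * \<phi> x \<partial>lborel) = 0"
  proof (rule integral_partial_eq_0)
    show "continuous_on UNIV (\<lambda>x. f x * frechet_derivative \<phi> (at x) (axis i 1) + G x \<bullet> axis i 1 * \<phi> x)"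
      using continuous_on_add[OF c1 c2] by (simp add: inner_axis)
  qed (use R(2) R(3)[of _ i] in auto)
  moreover have "integrable lborel (\<lambda>x. f x * pd [i] \<phi> x)"
    using R by (intro integrable_bounded_support[OF c1, of R]) auto
  moreover have "integrable lborel (\<lambda>x. G x $ i * \<phi> x)"
    using R by (intro integrable_bounded_support[OF c2, of R]) auto
  ultimately show ?thesis by (simp add: inner_axis)
qed

lemma wgrad_const: "wgrad (\<lambda>x::real^'n::finite. c) (\<lambda>x. 0)"
  unfolding wgrad_def
proof (intro conjI allI impI)
  show "loc_int (\<lambda>x::real^'n. c)" unfolding loc_int_def
    by (auto intro!: integrable_mult_left integrable_real_indicator emeasure_lborel_ball_finite)
  show "loc_int (\<lambda>x::real^'n. 0::real^'n)" by (simp add: loc_int_def)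
  fix \<phi> :: "real^'n \<Rightarrow> real" and i assume "test_fun \<phi>"
  from C1_integration_by_parts[of "\<lambda>x. c" "\<lambda>x. 0" \<phi> i, OF _ _ this]
  show "(\<integral>x. c * pd [i] \<phi> x \<partial>lborel) = - (\<integral>x. (0::real^'n) $ i * \<phi> x \<partial>lborel)" by simp
qed

lemma loc_int_scaleR: "loc_int u \<Longrightarrow> loc_int (\<lambda>x. c *\<^sub>R u x)"
  unfolding loc_int_def by (subst scaleR_left_commute) (auto simp del: scaleR_scaleR)

lemma loc_int_add: "loc_int u \<Longrightarrow> loc_int v \<Longrightarrow> loc_int (\<lambda>x. u x + v x)"
  unfolding loc_int_def by (auto simp: scaleR_add_right)

lemma loc_int_bound:
  fixes u :: "real^'n::finite \<Rightarrow> 'b::euclidean_space" and v :: "real^'n::finite \<Rightarrow> 'c::euclidean_space"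
  assumes u: "loc_int u" and [measurable]: "v \<in> borel_measurable borel" and b: "\<And>x. norm (v x) \<le> norm (u x)"
  shows "loc_int v"
  unfolding loc_int_def
proof (intro conjI allI)
  fix R
  show "integrable lborel (\<lambda>x. indicator (ball 0 R) x *\<^sub>R v x)"
  proof (rule Bochner_Integration.integrable_bound)
    show "integrable lborel (\<lambda>x. indicator (ball 0 R) x *\<^sub>R u x)" using u by (simp add: loc_int_def)
    show "AE x in lborel. norm (indicator (ball 0 R) x *\<^sub>R v x) \<le> norm (indicator (ball 0 R) x *\<^sub>R u x)"
      by (rule AE_I2) (auto simp: indicator_def b)
  qed measurable
qed simp

lemma loc_int_component: 
  fixes g :: "real^'n::finite \<Rightarrow> real^'n"
  shows "loc_int g \<Longrightarrow> loc_int (\<lambda>x. g x $ i)"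
proof (rule loc_int_bound[of g])
  assume "loc_int g"
  then have "g \<in> borel_measurable borel" by (simp add: loc_int_def)
  then show "(\<lambda>x. g x $ i) \<in> borel_measurable borel" 
    by (rule measurable_compose) (simp add: borel_measurable_continuous_onI continuous_on_component)
  show "norm (g x $ i) \<le> norm (g x)" for x using component_le_norm_cart[of "g x" i] by simp
qed

lemma loc_int_integrable_test:
  fixes u :: "real^'n::finite \<Rightarrow> real"
  assumes u: "loc_int u" and "continuous_on UNIV K" "\<And>x. norm x \<ge> R \<Longrightarrow> K x = 0"
  shows "integrable lborel (\<lambda>x. u x * K x)"
proof -
  obtain B where "\<And>y. norm (K y) \<le> B" using bounded_support_bounded[OF assms(2,3)] by metis
  then have "integrable lborel (\<lambda>x. K x *\<^sub>R u x)"
    by (intro loc_int_integrable_mult[OF u _ assms(3)] borel_measurable_continuous_onI assms) auto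
  then show ?thesis by (simp add: mult.commute)
qed

lemma wgrad_add: 
  fixes u :: "real^'n::finite \<Rightarrow> real"
  assumes "wgrad u g" "wgrad v h" shows "wgrad (\<lambda>x. u x + v x) (\<lambda>x. g x + h x)"
  unfolding wgrad_def
proof (intro conjI allI impI)
  have l: "loc_int u" "loc_int g" "loc_int v" "loc_int h" using assms by (auto simp: wgrad_def)
  show "loc_int (\<lambda>x. u x + v x)" "loc_int (\<lambda>x. g x + h x)" by (intro loc_int_add l)+
  fix \<phi> :: "real^'n \<Rightarrow> real" and i assume \<phi>: "test_fun \<phi>"
  obtain R where R: "\<And>x. norm x \<ge> R \<Longrightarrow> \<phi> x = 0" "\<And>i x. norm x \<ge> R \<Longrightarrow> pd [i] \<phi> x = 0"
    "continuous_on UNIV \<phi>" "\<And>i. continuous_on UNIV (pd [i] \<phi>)"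
    using test_funE[OF \<phi>] by metis
  have "(\<integral>x. u x * pd [i] \<phi> x + v x * pd [i] \<phi> x \<partial>lborel) = (\<integral>x. u x * pd [i] \<phi> x \<partial>lborel) + (\<integral>x. v x * pd [i] \<phi> x \<partial>lborel)"
    by (intro Bochner_Integration.integral_add loc_int_integrable_test[OF _ R(4)[of i] R(2)] l)
  moreover have "(\<integral>x. g x $ i * \<phi> x + h x $ i * \<phi> x \<partial>lborel) = (\<integral>x. g x $ i * \<phi> x \<partial>lborel) + (\<integral>x. h x $ i * \<phi> x \<partial>lborel)"
    by (intro Bochner_Integration.integral_add loc_int_integrable_test[OF _ R(3) R(1)] loc_int_component l)
  ultimately show "(\<integral>x. (u x + v x) * pd [i] \<phi> x \<partial>lborel) = - (\<integral>x. (g x + h x) $ i * \<phi> x \<partial>lborel)"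
    using assms \<phi> by (simp add: distrib_right wgrad_def del: pd.simps)
qed

lemma wgrad_scaleR: 
  fixes u :: "real^'n::finite \<Rightarrow> real"
  assumes "wgrad u g" shows "wgrad (\<lambda>x. c * u x) (\<lambda>x. c *\<^sub>R g x)"
  using assms loc_int_scaleR[of u c] loc_int_scaleR[of g c]
  by (auto simp: wgrad_def mult.assoc simp del: pd.simps)

lemma wgrad_diff: 
  fixes u :: "real^'n::finite \<Rightarrow> real"
  assumes "wgrad u g" "wgrad v h" shows "wgrad (\<lambda>x. u x - v x) (\<lambda>x. g x - h x)"
  using wgrad_add[OF assms(1) wgrad_scaleR[OF assms(2), of "-1"]] by simp

lemma moll_component:
  fixes g :: "real^'n::finite \<Rightarrow> real^'n"
  assumes "e > 0" "loc_int g" shows "moll e g x $ i = (\<integral>y. g y $ i * eta e (x - y) \<partial>lborel)"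
  unfolding moll_def using integral_bounded_linear[OF bounded_linear_vec_nth[of i] moll_integrable[OF assms, of x]]
  by (simp add: mult.commute)

text \<open>The kernel is itself a test function in \<open>y\<close>, so the weak gradient identity
  moves the derivative from the kernel to \<open>u\<close>. The minus signs from
  \<open>eta_pd\<close> and from the identity cancel.\<close>

lemma moll_has_derivative:
  fixes u :: "real^'n::finite \<Rightarrow> real"
  assumes e: "e > 0" and u: "wgrad u g"
  shows "(moll e u has_derivative (\<lambda>w. moll e g x \<bullet> w)) (at x)"
proof -
  have l: "loc_int u" "loc_int g" using u by (auto simp: wgrad_def)
  have "(\<integral>y. u y *\<^sub>R eta' e (x - y) \<partial>lborel) = moll e g x"
    unfolding vec_eq_iff
  proof
    fix i
    have "(\<integral>y. u y *\<^sub>R eta' e (x - y) \<partial>lborel) $ i = (\<integral>y. u y * eta' e (x - y) $ i \<partial>lborel)"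
      using integral_bounded_linear[OF bounded_linear_vec_nth[of i] eta'_integrable[OF e l(1), of x]] by simp
    also have "\<dots> = - (\<integral>y. u y * pd [i] (\<lambda>y. eta e (x - y)) y \<partial>lborel)"
      unfolding eta_pd[OF e] by simp
    also have "\<dots> = (\<integral>y. g y $ i * eta e (x - y) \<partial>lborel)"
      using u eta_test_fun[OF e, of x] by (simp add: wgrad_def del: pd.simps)
    finally show "(\<integral>y. u y *\<^sub>R eta' e (x - y) \<partial>lborel) $ i = moll e g x $ i"
      by (simp add: moll_component[OF e l(2)])
  qed
  then show ?thesis using moll_has_derivative_aux[OF e l(1), of x] by simp
qed

lemma AE_ball_all:
  fixes P :: "'a::real_normed_vector \<Rightarrow> bool"
  assumes "\<And>R. AE x in M. x \<in> ball 0 R \<longrightarrow> P x" shows "AE x in M. P x"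
proof -
  have "AE x in M. \<forall>n::nat. x \<in> ball 0 (real n) \<longrightarrow> P x"
    unfolding AE_all_countable using assms by blast
  then show ?thesis
  proof (rule AE_mp, intro AE_I2 impI)
    fix x assume "\<forall>n::nat. x \<in> ball 0 (real n) \<longrightarrow> P x"
    moreover obtain n where "norm x < real n" using reals_Archimedean2 by blast
    ultimately show "P x" by (meson mem_ball_0)
  qed
qed

lemma moll_eq_0_imp_AE:
  fixes G :: "real^'n::finite \<Rightarrow> 'b::euclidean_space"
  assumes G: "loc_int G" and "\<And>e x. e > 0 \<Longrightarrow> moll e G x = 0"
  shows "AE x in lborel. G x = 0"
proof (rule AE_ball_all)
  fix R
  have [measurable]: "G \<in> borel_measurable borel" using G by (simp add: loc_int_def)
  have "((\<lambda>e::real. \<integral>\<^sup>+x\<in>ball 0 R. norm (G x) \<partial>lborel) \<longlongrightarrow> 0) (at_right 0)"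
    using moll_tendsto[OF G, of R]
    by (rule Lim_transform_eventually) (auto simp: eventually_at_right_field assms intro!: exI[of _ 1])
  then have "(\<integral>\<^sup>+x\<in>ball 0 R. norm (G x) \<partial>lborel) = 0"
    by (simp add: tendsto_const_iff)
  then have "AE x in lborel. ennreal (norm (G x)) * indicator (ball 0 R) x = 0"
    by (subst (asm) nn_integral_0_iff_AE) auto
  then show "AE x in lborel. x \<in> ball 0 R \<longrightarrow> G x = 0"
    by (rule AE_mp) (auto intro!: AE_I2 split: split_indicator)
qed

text \<open>Testing with the kernels shows that all mollifications of \<open>g - h\<close> vanish.
  Uniqueness is needed later because the definition of the De Giorgi class provides a weak gradient
  separately for each level and each pair of radii.\<close>

lemma wgrad_unique:
  fixes u :: "real^'n::finite \<Rightarrow> real"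
  assumes "wgrad u g" "wgrad u h" shows "AE x in lborel. g x = h x"
proof -
  have w: "wgrad (\<lambda>x. u x - u x) (\<lambda>x. g x - h x)" by (rule wgrad_diff[OF assms])
  then have l: "loc_int (\<lambda>x. g x - h x)" by (simp add: wgrad_def)
  have "AE x in lborel. g x - h x = 0"
  proof (rule moll_eq_0_imp_AE[OF l])
    fix e :: real and x :: "real^'n" assume e: "e > 0"
    show "moll e (\<lambda>x. g x - h x) x = 0" unfolding vec_eq_iff
      using w eta_test_fun[OF e, of x] by (auto simp: moll_component[OF e l] wgrad_def)
  qed
  then show ?thesis by simp
qed

section \<open>Chain rule for truncations\<close>

lemma ennreal_squeeze_0:
  fixes f h :: "nat \<Rightarrow> ennreal"
  assumes "h \<longlonglongrightarrow> c" "\<And>n. f n \<le> h n" "c = 0" shows "f \<longlonglongrightarrow> 0"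
  by (rule tendsto_sandwich[OF _ _ tendsto_const, of 0 f sequentially h]) (use assms in auto)

definition moll_seq :: "nat \<Rightarrow> real" where "moll_seq n = 1 / real (n + 2)"

lemma moll_seq: "moll_seq n > 0" "moll_seq n < 1" "filterlim moll_seq (at_right 0) sequentially"
proof -
  have "(\<lambda>n. inverse (real (n + 2))) \<longlonglongrightarrow> 0"
    using LIMSEQ_ignore_initial_segment[OF lim_inverse_n, of 2] by simp
  then show "filterlim moll_seq (at_right 0) sequentially"
    by (intro tendsto_imp_filterlim_at_right) (auto simp: moll_seq_def[abs_def] inverse_eq_divide)
qed (auto simp: moll_seq_def)

lemma loc_int_diff: "loc_int u \<Longrightarrow> loc_int v \<Longrightarrow> loc_int (\<lambda>x. u x - v x)"
  using loc_int_add[of u "\<lambda>x. (-1) *\<^sub>R v x"] loc_int_scaleR[of v "-1"] by simp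

lemma continuous_loc_int:
  fixes f :: "real^'n::finite \<Rightarrow> 'b::euclidean_space"
  assumes "continuous_on UNIV f" shows "loc_int f"
  unfolding loc_int_def
proof (intro conjI allI)
  show m: "f \<in> borel_measurable borel" using assms by (rule borel_measurable_continuous_onI)
  fix R
  have "integrable lborel (\<lambda>x. indicator (cball 0 R) x *\<^sub>R f x)"
    by (intro borel_integrable_compact compact_cball continuous_on_subset[OF assms]) simp
  then show "integrable lborel (\<lambda>x. indicator (ball 0 R) x *\<^sub>R f x)"
  proof (rule Bochner_Integration.integrable_bound)
    show "(\<lambda>x. indicator (ball 0 R) x *\<^sub>R f x) \<in> borel_measurable lborel" using m by simp
  qed (auto intro!: AE_I2 split: split_indicator)
qed

lemma moll_L1_seq:
  fixes u :: "real^'n::finite \<Rightarrow> 'b::euclidean_space"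
  assumes u: "loc_int u"
  shows "(\<lambda>n. \<integral>\<^sup>+x\<in>ball 0 R. norm (moll (moll_seq n) u x - u x) \<partial>lborel) \<longlonglongrightarrow> 0"
  by (rule filterlim_compose[OF moll_tendsto[OF u] moll_seq(3)])

lemma moll_AE_seq:
  fixes u :: "real^'n::finite \<Rightarrow> 'b::euclidean_space"
  assumes u: "loc_int u"
  obtains r :: "nat \<Rightarrow> nat" where "strict_mono r" "AE x in lborel. x \<in> ball 0 R \<longrightarrow> (\<lambda>n. moll (moll_seq (r n)) u x) \<longlonglongrightarrow> u x"
proof -
  define v where "v n x = indicator (ball 0 R) x *\<^sub>R (moll (moll_seq n) u x - u x)" for n x
  have l: "loc_int (\<lambda>x. moll (moll_seq n) u x - u x)" for n
    by (intro loc_int_diff u continuous_loc_int continuous_moll moll_seq)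
  have i: "integrable lborel (v n)" for n using l[of n] by (simp add: v_def[abs_def] loc_int_def)
  have "ennreal (\<integral>x. norm (v n x) \<partial>lborel) = (\<integral>\<^sup>+x\<in>ball 0 R. norm (moll (moll_seq n) u x - u x) \<partial>lborel)" for n
    by (subst nn_integral_eq_integral[symmetric, OF integrable_norm[OF i]])
      (auto simp: v_def intro!: nn_integral_cong split: split_indicator)
  then have "(\<lambda>n. ennreal (\<integral>x. norm (v n x) \<partial>lborel)) \<longlonglongrightarrow> ennreal 0" using moll_L1_seq[OF u, of R] by simp
  then have "(\<lambda>n. \<integral>x. norm (v n x) \<partial>lborel) \<longlonglongrightarrow> 0"
    by (rule tendsto_ennrealD) auto
  from tendsto_L1_AE_subseq[OF i this] obtain r where r: "strict_mono r" "AE x in lborel. (\<lambda>n. v (r n) x) \<longlonglongrightarrow> 0" by blast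
  have "AE x in lborel. x \<in> ball 0 R \<longrightarrow> (\<lambda>n. moll (moll_seq (r n)) u x) \<longlonglongrightarrow> u x"
    using r(2) by (rule AE_mp) (auto intro!: AE_I2 simp: v_def LIM_zero_cancel)
  then show ?thesis using r(1) that by blast
qed

text \<open>The classical chain rule holds for mollifications and survives the limit. The gradient
  term splits into \<open>\<psi>' (f n x) *\<^sub>R (G n x - g x)\<close>, small in
  \<open>L1\<close> since \<open>\<psi>'\<close> is bounded by 1, and
  \<open>(\<psi>' (f n x) - \<psi>' (u x)) *\<^sub>R g x\<close>, which needs convergence almost
  everywhere and domination by \<open>2 * norm (g x)\<close>.\<close>

lemma wgrad_chain:
  fixes u :: "real^'n::finite \<Rightarrow> real" and \<psi> \<psi>' :: "real \<Rightarrow> real"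
  assumes u: "wgrad u g"
    and \<psi>: "\<And>t. (\<psi> has_real_derivative \<psi>' t) (at t)" "continuous_on UNIV \<psi>'" "\<And>t. \<bar>\<psi>' t\<bar> \<le> 1"
  shows "wgrad (\<lambda>x. \<psi> (u x)) (\<lambda>x. \<psi>' (u x) *\<^sub>R g x)"
  unfolding wgrad_def
proof (intro conjI allI impI)
  have l: "loc_int u" "loc_int g" using u by (auto simp: wgrad_def)
  have [measurable]: "u \<in> borel_measurable borel" "g \<in> borel_measurable borel" using l by (auto simp: loc_int_def)
  have c\<psi>: "continuous_on UNIV \<psi>" using \<psi>(1) DERIV_isCont by (meson continuous_at_imp_continuous_on)
  have [measurable]: "\<psi> \<in> borel_measurable borel" "\<psi>' \<in> borel_measurable borel"
    using c\<psi> \<psi>(2) by (auto intro: borel_measurable_continuous_onI)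
  have lip: "\<bar>\<psi> s - \<psi> t\<bar> \<le> \<bar>s - t\<bar>" for s t
    using field_differentiable_bound[of UNIV \<psi> \<psi>' 1 s t] \<psi> by auto
  have "loc_int (\<lambda>x. \<psi> (u x) - \<psi> 0)"
    by (rule loc_int_bound[OF l(1)]) (use lip[of _ 0] in auto)
  from loc_int_add[OF this continuous_loc_int[OF continuous_on_const[of UNIV "\<psi> 0"]]]
  show 1: "loc_int (\<lambda>x. \<psi> (u x))" by simp
  show 2: "loc_int (\<lambda>x. \<psi>' (u x) *\<^sub>R g x)"
    by (rule loc_int_bound[OF l(2)]) (use \<psi>(3) in \<open>auto intro: mult_left_le_one_le\<close>)
  fix \<phi> :: "real^'n \<Rightarrow> real" and i assume \<phi>: "test_fun \<phi>"
  obtain R where R: "\<And>x. norm x \<ge> R \<Longrightarrow> \<phi> x = 0" "\<And>i x. norm x \<ge> R \<Longrightarrow> pd [i] \<phi> x = 0"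
    "continuous_on UNIV \<phi>" "\<And>i. continuous_on UNIV (pd [i] \<phi>)"
    using test_funE[OF \<phi>] by metis
  obtain B1 where B1: "\<And>x. norm (\<phi> x) \<le> B1" "B1 > 0" using bounded_support_bounded[OF R(3) R(1)] by metis
  obtain B2 where B2: "\<And>x. norm (pd [i] \<phi> x) \<le> B2" "B2 > 0" using bounded_support_bounded[OF R(4) R(2)] by metis
  have [measurable]: "\<phi> \<in> borel_measurable borel" "pd [i] \<phi> \<in> borel_measurable borel"
    by (intro borel_measurable_continuous_onI R)+
  \<comment> \<open>Convergence almost everywhere matters only on a ball outside which the test
    function vanishes, so a subsequence belonging to this one ball is enough.\<close>
  obtain r where r: "strict_mono r" "AE x in lborel. x \<in> ball 0 R \<longrightarrow> (\<lambda>n. moll (moll_seq (r n)) u x) \<longlonglongrightarrow> u x"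
    by (rule moll_AE_seq[OF l(1), of R])
  define f where "f n = moll (moll_seq (r n)) u" for n
  define G where "G n = moll (moll_seq (r n)) g" for n
  have cf: "continuous_on UNIV (f n)" and cG: "continuous_on UNIV (G n)" for n
    unfolding f_def G_def by (rule continuous_moll[OF moll_seq(1) l(1)], rule continuous_moll[OF moll_seq(1) l(2)])
  have [measurable]: "f n \<in> borel_measurable borel" "G n \<in> borel_measurable borel" for n
    by (rule borel_measurable_continuous_onI[OF cf], rule borel_measurable_continuous_onI[OF cG])
  have fL: "(\<lambda>n. \<integral>\<^sup>+x\<in>ball 0 R. norm (f n x - u x) \<partial>lborel) \<longlonglongrightarrow> 0"
    using LIMSEQ_subseq_LIMSEQ[OF moll_L1_seq[OF l(1)] r(1)] by (simp add: o_def f_def)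
  have GL: "(\<lambda>n. \<integral>\<^sup>+x\<in>ball 0 R. norm (G n x - g x) \<partial>lborel) \<longlonglongrightarrow> 0"
    using LIMSEQ_subseq_LIMSEQ[OF moll_L1_seq[OF l(2)] r(1)] by (simp add: o_def G_def)
  have chain: "((\<lambda>x. \<psi> (f n x)) has_derivative (\<lambda>w. (\<psi>' (f n x) *\<^sub>R G n x) \<bullet> w)) (at x)" for n x
    using has_derivative_compose[OF moll_has_derivative[OF moll_seq(1) u] has_field_derivative_imp_has_derivative[OF \<psi>(1)]]
    by (simp add: f_def G_def)
  have c2: "continuous_on UNIV (\<lambda>x. \<psi>' (f n x) *\<^sub>R G n x)" for n
    by (intro continuous_intros cG continuous_on_compose2[OF \<psi>(2) cf]) auto
  have c1: "continuous_on UNIV (\<lambda>x. \<psi> (f n x))" for n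
    by (rule has_derivative_continuous_on_UNIV[OF chain])
  have ibp: "(\<integral>x. \<psi> (f n x) * pd [i] \<phi> x \<partial>lborel) = - (\<integral>x. (\<psi>' (f n x) *\<^sub>R G n x) $ i * \<phi> x \<partial>lborel)" for n
    by (rule C1_integration_by_parts[OF chain c2 \<phi>])
  have L: "(\<lambda>n. \<integral>x. \<psi> (f n x) * pd [i] \<phi> x \<partial>lborel) \<longlonglongrightarrow> (\<integral>x. \<psi> (u x) * pd [i] \<phi> x \<partial>lborel)"
  proof (rule tendsto_L1_int)
    show "integrable lborel (\<lambda>x. \<psi> (f n x) * pd [i] \<phi> x)" for n
      by (rule loc_int_integrable_test[OF continuous_loc_int[OF c1] R(4) R(2)])
    show "integrable lborel (\<lambda>x. \<psi> (u x) * pd [i] \<phi> x)"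
      by (rule loc_int_integrable_test[OF 1 R(4) R(2)])
    have "(\<lambda>n. ennreal B2 * (\<integral>\<^sup>+x\<in>ball 0 R. norm (f n x - u x) \<partial>lborel)) \<longlonglongrightarrow> ennreal B2 * 0"
      by (intro ennreal_tendsto_cmult fL) simp
    moreover have "(\<integral>\<^sup>+x. norm (\<psi> (f n x) * pd [i] \<phi> x - \<psi> (u x) * pd [i] \<phi> x) \<partial>lborel) \<le> ennreal B2 * (\<integral>\<^sup>+x\<in>ball 0 R. norm (f n x - u x) \<partial>lborel)" for n
    proof -
      have "(\<integral>\<^sup>+x. norm (\<psi> (f n x) * pd [i] \<phi> x - \<psi> (u x) * pd [i] \<phi> x) \<partial>lborel) \<le> (\<integral>\<^sup>+x. ennreal B2 * (ennreal (norm (f n x - u x)) * indicator (ball 0 R) x) \<partial>lborel)"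
      proof (rule nn_integral_mono)
        fix x
        show "ennreal (norm (\<psi> (f n x) * pd [i] \<phi> x - \<psi> (u x) * pd [i] \<phi> x)) \<le> ennreal B2 * (ennreal (norm (f n x - u x)) * indicator (ball 0 R) x)"
        proof (cases "norm x < R")
          case True
          have "norm (\<psi> (f n x) * pd [i] \<phi> x - \<psi> (u x) * pd [i] \<phi> x) = \<bar>pd [i] \<phi> x\<bar> * \<bar>\<psi> (f n x) - \<psi> (u x)\<bar>"
            by (simp add: left_diff_distrib[symmetric] abs_mult del: pd.simps)
          also have "\<dots> \<le> B2 * norm (f n x - u x)"
            using B2(1)[of x] B2(2) lip[of "f n x" "u x"] by (intro mult_mono) auto
          finally show ?thesis using True B2(2) by (simp add: ennreal_mult[symmetric] del: pd.simps)
        next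
          case False
          then show ?thesis using R(2)[of x i] by (simp del: pd.simps)
        qed
      qed
      then show ?thesis by (subst (asm) nn_integral_cmult) auto
    qed
    ultimately show "(\<lambda>n. \<integral>\<^sup>+x. norm (\<psi> (f n x) * pd [i] \<phi> x - \<psi> (u x) * pd [i] \<phi> x) \<partial>lborel) \<longlonglongrightarrow> 0"
      by (rule ennreal_squeeze_0) simp
  qed
  let ?D = "\<lambda>n x. norm (\<psi>' (f n x) - \<psi>' (u x)) * norm (indicator (ball 0 R) x *\<^sub>R g x)" and ?E = "\<lambda>n x. (\<psi>' (f n x) *\<^sub>R G n x) $ i * \<phi> x - (\<psi>' (u x) *\<^sub>R g x) $ i * \<phi> x"
  have Rt: "(\<lambda>n. \<integral>x. (\<psi>' (f n x) *\<^sub>R G n x) $ i * \<phi> x \<partial>lborel) \<longlonglongrightarrow> (\<integral>x. (\<psi>' (u x) *\<^sub>R g x) $ i * \<phi> x \<partial>lborel)"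
  proof (rule tendsto_L1_int)
    show "integrable lborel (\<lambda>x. (\<psi>' (f n x) *\<^sub>R G n x) $ i * \<phi> x)" for n
      by (rule loc_int_integrable_test[OF loc_int_component[OF continuous_loc_int[OF c2]] R(3) R(1)])
    show "integrable lborel (\<lambda>x. (\<psi>' (u x) *\<^sub>R g x) $ i * \<phi> x)"
      by (rule loc_int_integrable_test[OF loc_int_component[OF 2] R(3) R(1)])
    have "(\<lambda>n. \<integral>\<^sup>+x. ?D n x \<partial>lborel) \<longlonglongrightarrow> (\<integral>\<^sup>+(x::real^'n). 0 \<partial>lborel)"
    proof (rule nn_integral_dominated_convergence[where w="\<lambda>x. 2 * norm (indicator (ball 0 R) x *\<^sub>R g x)"])
      have "integrable lborel (\<lambda>x. 2 * norm (indicator (ball 0 R) x *\<^sub>R g x))"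
        using l(2) by (intro integrable_mult_right integrable_norm) (simp add: loc_int_def)
      then show "(\<integral>\<^sup>+ x. ennreal (2 * norm (indicat_real (ball 0 R) x *\<^sub>R g x)) \<partial>lborel) < \<infinity>"
        by (subst nn_integral_eq_integral) auto
      show "AE x in lborel. ennreal (?D n x) \<le> ennreal (2 * norm (indicator (ball 0 R) x *\<^sub>R g x))" for n
      proof (intro AE_I2 ennreal_leI mult_right_mono)
        fix x show "norm (\<psi>' (f n x) - \<psi>' (u x)) \<le> 2"
          using \<psi>(3)[of "f n x"] \<psi>(3)[of "u x"] by simp
      qed simp
      show "AE x in lborel. (\<lambda>n. ennreal (?D n x)) \<longlonglongrightarrow> 0"
        using r(2)
      proof (rule AE_mp, intro AE_I2 impI)
        fix x assume *: "x \<in> ball 0 R \<longrightarrow> (\<lambda>n. moll (moll_seq (r n)) u x) \<longlonglongrightarrow> u x"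
        show "(\<lambda>n. ennreal (?D n x)) \<longlonglongrightarrow> 0"
        proof (cases "x \<in> ball 0 R")
          case True
          then have "(\<lambda>n. f n x) \<longlonglongrightarrow> u x" using * by (simp add: f_def)
          then have "(\<lambda>n. \<psi>' (f n x)) \<longlonglongrightarrow> \<psi>' (u x)"
            by (intro continuous_on_tendsto_compose[OF \<psi>(2)]) auto
          then have "(\<lambda>n. ?D n x) \<longlonglongrightarrow> norm (\<psi>' (u x) - \<psi>' (u x)) * norm (indicator (ball 0 R) x *\<^sub>R g x)"
            by (intro tendsto_intros)
          then show ?thesis using tendsto_ennrealI by fastforce
        qed simp
      qed
    qed auto
    then have D: "(\<lambda>n. \<integral>\<^sup>+x. ?D n x \<partial>lborel) \<longlonglongrightarrow> 0" by simp
    have "(\<lambda>n. ennreal B1 * ((\<integral>\<^sup>+x\<in>ball 0 R. norm (G n x - g x) \<partial>lborel) + (\<integral>\<^sup>+x. ?D n x \<partial>lborel))) \<longlonglongrightarrow> ennreal B1 * (0 + 0)"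
      by (intro ennreal_tendsto_cmult tendsto_add GL D) simp
    moreover have "(\<integral>\<^sup>+x. norm (?E n x) \<partial>lborel) \<le> 
      ennreal B1 * ((\<integral>\<^sup>+x\<in>ball 0 R. norm (G n x - g x) \<partial>lborel) + (\<integral>\<^sup>+x. ?D n x \<partial>lborel))" for n
    proof -
      have "(\<integral>\<^sup>+x. norm (?E n x) \<partial>lborel) \<le>
        (\<integral>\<^sup>+x. ennreal B1 * (ennreal (norm (G n x - g x)) * indicator (ball 0 R) x + ennreal (?D n x)) \<partial>lborel)"
      proof (rule nn_integral_mono)
        fix x
        show "ennreal (norm (?E n x)) \<le> ennreal B1 * (ennreal (norm (G n x - g x)) * indicator (ball 0 R) x + ennreal (?D n x))"
        proof (cases "norm x < R")
          case True
          have "norm (?E n x) = \<bar>\<phi> x\<bar> * \<bar>(\<psi>' (f n x) *\<^sub>R G n x - \<psi>' (u x) *\<^sub>R g x) $ i\<bar>"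
            by (simp add: left_diff_distrib[symmetric] abs_mult)
          also have "\<dots> \<le> B1 * norm (\<psi>' (f n x) *\<^sub>R G n x - \<psi>' (u x) *\<^sub>R g x)"
            using B1(1)[of x] B1(2) by (intro mult_mono component_le_norm_cart) auto
          also have "\<psi>' (f n x) *\<^sub>R G n x - \<psi>' (u x) *\<^sub>R g x = \<psi>' (f n x) *\<^sub>R (G n x - g x) + (\<psi>' (f n x) - \<psi>' (u x)) *\<^sub>R g x"
            by (simp add: algebra_simps)
          also have "B1 * norm \<dots> \<le> B1 * (\<bar>\<psi>' (f n x)\<bar> * norm (G n x - g x) + norm (\<psi>' (f n x) - \<psi>' (u x)) * norm (g x))"
            using B1(2) norm_triangle_ineq[of "\<psi>' (f n x) *\<^sub>R (G n x - g x)" "(\<psi>' (f n x) - \<psi>' (u x)) *\<^sub>R g x"] by (intro mult_left_mono) auto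
          also have "\<dots> \<le> B1 * (norm (G n x - g x) + norm (\<psi>' (f n x) - \<psi>' (u x)) * norm (g x))"
            using B1(2) \<psi>(3)[of "f n x"] by (intro mult_left_mono add_right_mono mult_left_le_one_le) auto
          finally show ?thesis using True B1(2) by (simp add: ennreal_mult[symmetric] ennreal_plus[symmetric] del: ennreal_plus)
        next
          case False
          then show ?thesis using R(1)[of x] by simp
        qed
      qed
      also have "\<dots> = ennreal B1 * (\<integral>\<^sup>+x. (ennreal (norm (G n x - g x)) * indicator (ball 0 R) x + ennreal (?D n x)) \<partial>lborel)"
        by (rule nn_integral_cmult) measurable
      also have "(\<integral>\<^sup>+x. (ennreal (norm (G n x - g x)) * indicator (ball 0 R) x + ennreal (?D n x)) \<partial>lborel)
        = (\<integral>\<^sup>+x\<in>ball 0 R. norm (G n x - g x) \<partial>lborel) + (\<integral>\<^sup>+x. ?D n x \<partial>lborel)"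
        by (rule nn_integral_add) measurable
      finally show ?thesis .
    qed
    ultimately show "(\<lambda>n. \<integral>\<^sup>+x. norm (?E n x) \<partial>lborel) \<longlonglongrightarrow> 0"
      by (rule ennreal_squeeze_0) simp
  qed
  have "(\<lambda>n. \<integral>x. \<psi> (f n x) * pd [i] \<phi> x \<partial>lborel) \<longlonglongrightarrow> - (\<integral>x. (\<psi>' (u x) *\<^sub>R g x) $ i * \<phi> x \<partial>lborel)"
    unfolding ibp by (rule tendsto_minus[OF Rt])
  with L show "(\<integral>x. \<psi> (u x) * pd [i] \<phi> x \<partial>lborel) = - (\<integral>x. (\<psi>' (u x) *\<^sub>R g x) $ i * \<phi> x \<partial>lborel)"
    by (rule LIMSEQ_unique)
qed


text \<open>A continuously differentiable approximation of \<open>max t 0\<close> that rounds off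
  the corner. It is identically 0 for \<open>t \<le> 0\<close>, so its derivative vanishes there,
  also at \<open>t = 0\<close>; hence the limit yields the gradient restricted to the strict set
  \<open>u x > 0\<close>.\<close>

definition ppart :: "nat \<Rightarrow> real \<Rightarrow> real" where
  "ppart m t = sqrt ((max t 0)\<^sup>2 + (moll_seq m)\<^sup>2) - moll_seq m"

definition ppart' :: "nat \<Rightarrow> real \<Rightarrow> real" where
  "ppart' m t = max t 0 / sqrt ((max t 0)\<^sup>2 + (moll_seq m)\<^sup>2)"

lemma max_squared_DERIV: "((\<lambda>t. (max t 0)\<^sup>2) has_real_derivative 2 * max t 0) (at (t::real))"
proof -
  consider "t > 0" | "t < 0" | "t = 0" by linarith
  then show ?thesis
  proof cases
    case 1
    have "((\<lambda>t. t\<^sup>2) has_real_derivative 2 * t) (at t)" by (auto intro!: derivative_eq_intros)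
    then have "((\<lambda>t. (max t 0)\<^sup>2) has_real_derivative 2 * t) (at t)"
      by (rule has_field_derivative_transform_within_open[where S="{0<..}"]) (use 1 in auto)
    then show ?thesis using 1 by simp
  next
    case 2
    have "((\<lambda>t. 0) has_real_derivative 0) (at t)" by simp
    then have "((\<lambda>t. (max t 0)\<^sup>2) has_real_derivative 0) (at t)"
      by (rule has_field_derivative_transform_within_open[where S="{..<0}"]) (use 2 in auto)
    then show ?thesis using 2 by simp
  next
    case 3
    have "(\<lambda>y::real. ((max y 0)\<^sup>2 - (max 0 0)\<^sup>2) / (y - 0)) = (\<lambda>y. max y 0)"
      by (auto simp: fun_eq_iff max_def power2_eq_square)
    moreover have "((\<lambda>y::real. max y 0) \<longlongrightarrow> max 0 0) (at 0)"
      by (intro tendsto_intros)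
    ultimately show ?thesis using 3 by (simp add: has_field_derivative_iff)
  qed
qed

lemma ppart_DERIV: "(ppart m has_real_derivative ppart' m t) (at t)"
proof -
  have pos: "(max t 0)\<^sup>2 + (moll_seq m)\<^sup>2 > 0"
    using moll_seq(1)[of m] by (intro add_nonneg_pos) auto
  have "((\<lambda>t. (max t 0)\<^sup>2 + (moll_seq m)\<^sup>2) has_real_derivative 2 * max t 0) (at t)"
    using DERIV_add[OF max_squared_DERIV DERIV_const] by simp
  from DERIV_chain2[OF DERIV_real_sqrt[OF pos] this]
  have "((\<lambda>t. sqrt ((max t 0)\<^sup>2 + (moll_seq m)\<^sup>2)) has_real_derivative ppart' m t) (at t)"
    by (simp add: ppart'_def field_simps)
  from DERIV_diff[OF this DERIV_const[of "moll_seq m"]] show ?thesis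
    by (simp add: ppart_def[abs_def])
qed

lemma sqrt_sum_squares_pos: "(b::real) > 0 \<Longrightarrow> sqrt (a\<^sup>2 + b\<^sup>2) > 0"
  by (simp add: add_nonneg_pos)

lemma ppart'_bound: "\<bar>ppart' m t\<bar> \<le> 1"
proof -
  define a where "a = max t 0"
  have "a \<ge> 0" by (simp add: a_def)
  moreover have "a \<le> sqrt (a\<^sup>2 + (moll_seq m)\<^sup>2)" by (rule real_le_rsqrt) simp
  ultimately show ?thesis 
    using sqrt_sum_squares_pos[OF moll_seq(1)[of m], of a] unfolding ppart'_def a_def[symmetric] by simp
qed

lemma continuous_ppart': "continuous_on UNIV (ppart' m)"
  using sqrt_sum_squares_pos[OF moll_seq(1)[of m]] unfolding ppart'_def[abs_def]
  by (intro continuous_intros) (metis less_irrefl)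

lemma moll_seq_0: "moll_seq \<longlonglongrightarrow> 0"
  using moll_seq(3) by (simp add: filterlim_at)

lemma ppart_tendsto: "(\<lambda>m. ppart m t) \<longlonglongrightarrow> max t 0"
proof -
  have "(\<lambda>m. sqrt ((max t 0)\<^sup>2 + (moll_seq m)\<^sup>2) - moll_seq m) \<longlonglongrightarrow> sqrt ((max t 0)\<^sup>2 + 0\<^sup>2) - 0"
    by (intro tendsto_intros moll_seq_0)
  then show ?thesis by (simp add: ppart_def)
qed

lemma ppart'_tendsto: "(\<lambda>m. ppart' m t) \<longlonglongrightarrow> (if t > 0 then 1 else 0)"
proof (cases "t > 0")
  case True
  then have "(\<lambda>m. t / sqrt (t\<^sup>2 + (moll_seq m)\<^sup>2)) \<longlonglongrightarrow> t / sqrt (t\<^sup>2 + 0\<^sup>2)"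
    by (intro tendsto_intros moll_seq_0) auto
  then show ?thesis using True by (simp add: ppart'_def)
qed (simp add: ppart'_def max_def)

lemma ppart_bound: "norm (ppart m t) \<le> norm t"
proof -
  define a b where "a = max t 0" and "b = moll_seq m"
  have ab: "a \<ge> 0" "b > 0" using moll_seq(1) by (auto simp: a_def b_def)
  have "b \<le> sqrt (a\<^sup>2 + b\<^sup>2)" by (rule real_le_rsqrt) simp
  moreover have "sqrt (a\<^sup>2 + b\<^sup>2) \<le> a + b"
    using ab by (intro real_le_lsqrt) (auto simp: power2_sum)
  moreover have "a \<le> \<bar>t\<bar>" by (simp add: a_def)
  ultimately show ?thesis unfolding ppart_def a_def[symmetric] b_def[symmetric] by simp
qed

text \<open>Both sides of the integration by parts for \<open>ppart m\<close> converge by dominated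
  convergence: \<open>ppart m\<close> is at most the absolute value of its argument and
  \<open>ppart' m\<close> is at most 1.\<close>

lemma wgrad_pos_part:
  fixes u :: "real^'n::finite \<Rightarrow> real"
  assumes u: "wgrad u g"
  shows "wgrad (\<lambda>x. max (u x) 0) (\<lambda>x. if u x > 0 then g x else 0)"
  unfolding wgrad_def
proof (intro conjI allI impI)
  have l: "loc_int u" "loc_int g" using u by (auto simp: wgrad_def)
  have [measurable]: "u \<in> borel_measurable borel" "g \<in> borel_measurable borel" using l by (auto simp: loc_int_def)
  show 1: "loc_int (\<lambda>x. max (u x) 0)" by (rule loc_int_bound[OF l(1)]) auto
  show 2: "loc_int (\<lambda>x. if u x > 0 then g x else 0)" by (rule loc_int_bound[OF l(2)]) auto
  fix \<phi> :: "real^'n \<Rightarrow> real" and i assume \<phi>: "test_fun \<phi>"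
  obtain R where R: "\<And>x. norm x \<ge> R \<Longrightarrow> \<phi> x = 0" "\<And>i x. norm x \<ge> R \<Longrightarrow> pd [i] \<phi> x = 0"
    "continuous_on UNIV \<phi>" "\<And>i. continuous_on UNIV (pd [i] \<phi>)"
    using test_funE[OF \<phi>] by metis
  have [measurable]: "\<phi> \<in> borel_measurable borel" "pd [i] \<phi> \<in> borel_measurable borel"
    by (intro borel_measurable_continuous_onI R)+
  have w: "wgrad (\<lambda>x. ppart m (u x)) (\<lambda>x. ppart' m (u x) *\<^sub>R g x)" for m
    by (rule wgrad_chain[OF u ppart_DERIV continuous_ppart' ppart'_bound])
  then have ibp: "(\<integral>x. ppart m (u x) * pd [i] \<phi> x \<partial>lborel) = - (\<integral>x. (ppart' m (u x) *\<^sub>R g x) $ i * \<phi> x \<partial>lborel)" for m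
    using \<phi> unfolding wgrad_def by blast
  have [measurable]: "ppart m \<in> borel_measurable borel" "ppart' m \<in> borel_measurable borel" for m
    by (intro borel_measurable_continuous_onI has_derivative_continuous_on_UNIV[OF has_field_derivative_imp_has_derivative[OF ppart_DERIV]] continuous_ppart')+
  have L: "(\<lambda>m. \<integral>x. ppart m (u x) * pd [i] \<phi> x \<partial>lborel) \<longlonglongrightarrow> (\<integral>x. max (u x) 0 * pd [i] \<phi> x \<partial>lborel)"
  proof (rule integral_dominated_convergence[where w="\<lambda>x. \<bar>u x * pd [i] \<phi> x\<bar>"])
    show "integrable lborel (\<lambda>x. \<bar>u x * pd [i] \<phi> x\<bar>)"
      by (rule integrable_abs[OF loc_int_integrable_test[OF l(1) R(4) R(2)]])
    show "AE x in lborel. (\<lambda>m. ppart m (u x) * pd [i] \<phi> x) \<longlonglongrightarrow> max (u x) 0 * pd [i] \<phi> x"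
      by (intro AE_I2 tendsto_mult ppart_tendsto tendsto_const)
    show "AE x in lborel. norm (ppart m (u x) * pd [i] \<phi> x) \<le> \<bar>u x * pd [i] \<phi> x\<bar>" for m
      using ppart_bound[of m] by (intro AE_I2) (auto simp: abs_mult intro!: mult_right_mono simp del: pd.simps)
  qed measurable
  have [measurable]: "(\<lambda>x. (ppart' m (u x) *\<^sub>R g x) $ i) \<in> borel_measurable borel" for m
    using w[of m] by (intro loc_int_measurable loc_int_component) (simp add: wgrad_def)
  have [measurable]: "(\<lambda>x. (if u x > 0 then g x else 0) $ i) \<in> borel_measurable borel"
    by (intro loc_int_measurable loc_int_component 2)
  have "(\<lambda>m. \<integral>x. (ppart' m (u x) *\<^sub>R g x) $ i * \<phi> x \<partial>lborel) \<longlonglongrightarrow> (\<integral>x. (if u x > 0 then g x else 0) $ i * \<phi> x \<partial>lborel)"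
  proof (rule integral_dominated_convergence[where w="\<lambda>x. \<bar>g x $ i * \<phi> x\<bar>"])
    show "integrable lborel (\<lambda>x. \<bar>g x $ i * \<phi> x\<bar>)"
      by (rule integrable_abs[OF loc_int_integrable_test[OF loc_int_component[OF l(2)] R(3) R(1)]])
    show "AE x in lborel. (\<lambda>m. (ppart' m (u x) *\<^sub>R g x) $ i * \<phi> x) \<longlonglongrightarrow> (if u x > 0 then g x else 0) $ i * \<phi> x"
    proof (rule AE_I2)
      fix x
      have "(\<lambda>m. (ppart' m (u x) *\<^sub>R g x) $ i * \<phi> x) \<longlonglongrightarrow> ((if u x > 0 then 1 else 0) *\<^sub>R g x) $ i * \<phi> x"
        by (intro tendsto_intros ppart'_tendsto)
      then show "(\<lambda>m. (ppart' m (u x) *\<^sub>R g x) $ i * \<phi> x) \<longlonglongrightarrow> (if u x > 0 then g x else 0) $ i * \<phi> x"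
        by (cases "u x > 0") auto
    qed
    show "AE x in lborel. norm ((ppart' m (u x) *\<^sub>R g x) $ i * \<phi> x) \<le> \<bar>g x $ i * \<phi> x\<bar>" for m
      using ppart'_bound[of m] by (intro AE_I2) (auto simp: abs_mult intro!: mult_right_mono mult_left_le_one_le)
  qed measurable
  then have "(\<lambda>m. \<integral>x. ppart m (u x) * pd [i] \<phi> x \<partial>lborel) \<longlonglongrightarrow> - (\<integral>x. (if u x > 0 then g x else 0) $ i * \<phi> x \<partial>lborel)"
    unfolding ibp by (rule tendsto_minus)
  with L show "(\<integral>x. max (u x) 0 * pd [i] \<phi> x \<partial>lborel) = - (\<integral>x. (if u x > 0 then g x else 0) $ i * \<phi> x \<partial>lborel)"
    by (rule LIMSEQ_unique)
qed

section \<open>Borel representatives of Lebesgue measurable data\<close>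

lemma loc_integrable_measurable:
  assumes "loc_integrable u" shows "u \<in> borel_measurable lebesgue"
proof (rule borel_measurable_LIMSEQ_metric)
  show "(\<lambda>x. indicator (cball 0 (real n)) x *\<^sub>R u x) \<in> borel_measurable lebesgue" for n
    using assms compact_cball unfolding loc_integrable_def set_integrable_def by blast
  show "(\<lambda>n. indicator (cball 0 (real n)) x *\<^sub>R u x) \<longlonglongrightarrow> u x" for x
  proof (rule tendsto_eventually)
    obtain n where "norm x \<le> real n" using real_arch_simple by blast
    then show "\<forall>\<^sub>F n in sequentially. indicator (cball 0 (real n)) x *\<^sub>R u x = u x"
      by (intro eventually_sequentiallyI[of n]) auto
  qed
qed

lemma AE_lebesgue_iff: "(AE x in lebesgue. P x) \<longleftrightarrow> (AE x in lborel. P x)"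
  by (rule AE_completion_iff)

lemma loc_integrable_loc_int:
  fixes u v :: "real^'n::finite \<Rightarrow> real"
  assumes u: "loc_integrable u" and v: "v \<in> borel_measurable borel" and ae: "AE x in lborel. v x = u x"
  shows "loc_int v"
  unfolding loc_int_def
proof (intro conjI allI v)
  fix R
  have "integrable lebesgue (\<lambda>x. indicator (cball 0 R) x *\<^sub>R u x)"
    using u compact_cball by (auto simp: loc_integrable_def set_integrable_def)
  then have "integrable lebesgue (\<lambda>x. indicator (ball 0 R) x *\<^sub>R v x)"
  proof (rule Bochner_Integration.integrable_bound)
    have "(\<lambda>x. indicator (ball 0 R) x *\<^sub>R v x) \<in> borel_measurable lborel" using v by simp
    then show "(\<lambda>x. indicator (ball 0 R) x *\<^sub>R v x) \<in> borel_measurable lebesgue" by (rule measurable_completion)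
    show "AE x in lebesgue. norm (indicator (ball 0 R) x *\<^sub>R v x) \<le> norm (indicator (cball 0 R) x *\<^sub>R u x)"
      unfolding AE_lebesgue_iff using ae by (rule AE_mp) (auto intro!: AE_I2 split: split_indicator)
  qed
  then show "integrable lborel (\<lambda>x. indicator (ball 0 R) x *\<^sub>R v x)"
    using v by (subst (asm) integrable_completion) auto
qed

text \<open>The representative \<open>v\<close> of \<open>u\<close> is prescribed by the caller and
  only that of the gradient is chosen, component by component. This makes it possible to treat all
  truncations of one fixed Borel representative.\<close>

lemma weak_grad_wgrad:
  fixes u v :: "real^'n::finite \<Rightarrow> real"
  assumes u: "weak_grad u g" and v: "v \<in> borel_measurable borel" and ae: "AE x in lborel. v x = u x"
  obtains h where "wgrad v h" "AE x in lborel. h x = g x"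
proof -
  have gm: "(\<lambda>x. g x $ i) \<in> borel_measurable lebesgue" for i
    using u by (intro loc_integrable_measurable) (auto simp: weak_grad_def)
  have "\<forall>i. \<exists>h. h \<in> borel_measurable lborel \<and> (AE x in lborel. g x $ i = h x)"
    using completion_ex_borel_measurable_real[OF gm] by blast
  then obtain H where H: "\<And>i. H i \<in> borel_measurable lborel" "\<And>i. AE x in lborel. g x $ i = H i x" by metis
  define h where "h x = (\<chi> i. H i x)" for x
  have hi: "h x $ i = H i x" for x i by (simp add: h_def)
  have hg: "AE x in lborel. h x = g x"
  proof -
    have "AE x in lborel. \<forall>i\<in>UNIV. g x $ i = H i x"
      by (rule AE_finite_allI) (use H in auto)
    then show ?thesis by (rule AE_mp) (auto intro!: AE_I2 simp: h_def vec_eq_iff)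
  qed
  have lv: "loc_int v" by (rule loc_integrable_loc_int[OF _ v ae]) (use u in \<open>simp add: weak_grad_def\<close>)
  have lh: "loc_int (\<lambda>x. h x $ i)" for i
  proof (rule loc_integrable_loc_int)
    show "loc_integrable (\<lambda>x. g x $ i)" using u by (simp add: weak_grad_def)
    show "(\<lambda>x. h x $ i) \<in> borel_measurable borel" using H(1)[of i] by (simp add: hi)
    show "AE x in lborel. h x $ i = g x $ i" using hg by (rule AE_mp) (auto intro!: AE_I2)
  qed
  have hsum: "h = (\<lambda>x. \<Sum>i\<in>UNIV. (h x $ i) *\<^sub>R axis i 1)"
    by (auto simp: fun_eq_iff vec_eq_iff axis_def if_distrib cong: if_cong)
  have lh': "loc_int h"
  proof -
    have "loc_int (\<lambda>x. (h x $ i) *\<^sub>R (axis i 1 :: real^'n))" for i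
    proof (rule loc_int_bound[OF lh[of i]])
      have "(\<lambda>x. h x $ i) \<in> borel_measurable borel" using lh[of i] by (simp add: loc_int_def)
      then show "(\<lambda>x. (h x $ i) *\<^sub>R (axis i 1 :: real^'n)) \<in> borel_measurable borel"
        by (intro borel_measurable_scaleR borel_measurable_const)
    qed simp
    moreover have "finite A \<Longrightarrow> (\<And>i. loc_int (f i)) \<Longrightarrow> loc_int (\<lambda>x. \<Sum>i\<in>A. f i x)" for A :: "'n set" and f :: "'n \<Rightarrow> real^'n \<Rightarrow> real^'n"
      by (induction A rule: finite_induct) (auto intro: loc_int_add simp: loc_int_def[of "\<lambda>x. 0"])
    ultimately show ?thesis by (subst hsum) auto
  qed
  have "wgrad v h"
    unfolding wgrad_def
  proof (intro conjI allI impI lv lh')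
    fix \<phi> :: "real^'n \<Rightarrow> real" and i assume \<phi>: "test_fun \<phi>"
    obtain R where R: "continuous_on UNIV \<phi>" "\<And>i. continuous_on UNIV (pd [i] \<phi>)"
      using test_funE[OF \<phi>] by metis
    have [measurable]: "\<phi> \<in> borel_measurable borel" "pd [i] \<phi> \<in> borel_measurable borel"
      by (intro borel_measurable_continuous_onI R)+
    have [measurable]: "v \<in> borel_measurable borel" "(\<lambda>x. h x $ i) \<in> borel_measurable borel"
      using v lh[of i] by (auto simp: loc_int_def)
    have um: "u \<in> borel_measurable lebesgue" using u by (intro loc_integrable_measurable) (simp add: weak_grad_def)
    have tm: "\<phi> \<in> borel_measurable lebesgue" "pd [i] \<phi> \<in> borel_measurable lebesgue"
      by (intro measurable_completion; simp del: pd.simps)+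
    have "(\<integral>x. v x * pd [i] \<phi> x \<partial>lborel) = (\<integral>x. v x * pd [i] \<phi> x \<partial>lebesgue)"
      by (rule integral_completion[symmetric]) measurable
    also have "\<dots> = (\<integral>x. u x * pd [i] \<phi> x \<partial>lebesgue)"
    proof (rule integral_cong_AE)
      show "(\<lambda>x. v x * pd [i] \<phi> x) \<in> borel_measurable lebesgue" by (rule measurable_completion) measurable
      show "(\<lambda>x. u x * pd [i] \<phi> x) \<in> borel_measurable lebesgue" by (intro borel_measurable_times um tm)
      show "AE x in lebesgue. v x * pd [i] \<phi> x = u x * pd [i] \<phi> x"
        unfolding AE_lebesgue_iff using ae by (rule AE_mp) (auto intro!: AE_I2)
    qed
    also have "\<dots> = - (\<integral>x. g x $ i * \<phi> x \<partial>lebesgue)"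
      using u \<phi> by (simp add: weak_grad_def del: pd.simps)
    also have "(\<integral>x. g x $ i * \<phi> x \<partial>lebesgue) = (\<integral>x. h x $ i * \<phi> x \<partial>lebesgue)"
    proof (rule integral_cong_AE)
      show "(\<lambda>x. h x $ i * \<phi> x) \<in> borel_measurable lebesgue" by (rule measurable_completion) measurable
      show "(\<lambda>x. g x $ i * \<phi> x) \<in> borel_measurable lebesgue" by (intro borel_measurable_times gm tm)
      show "AE x in lebesgue. g x $ i * \<phi> x = h x $ i * \<phi> x"
        unfolding AE_lebesgue_iff using hg by (rule AE_mp) (auto intro!: AE_I2)
    qed
    also have "\<dots> = (\<integral>x. h x $ i * \<phi> x \<partial>lborel)" by (rule integral_completion) measurable
    finally show "(\<integral>x. v x * pd [i] \<phi> x \<partial>lborel) = - (\<integral>x. h x $ i * \<phi> x \<partial>lborel)" .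
  qed
  then show ?thesis using hg that by blast
qed

section \<open>Translation estimate\<close>

text \<open>General curves are allowed because two kinds are needed: straight segments for
  translations, and reparametrised segments that end on the plane.\<close>

lemma C1_curve_bound:
  fixes f :: "real^'n::finite \<Rightarrow> real"
  assumes f: "\<And>x. (f has_derivative (\<lambda>w. G x \<bullet> w)) (at x)" and G: "continuous_on UNIV G"
    and c: "\<And>s. (c has_vector_derivative c' s) (at s)" and c': "continuous_on UNIV c'"
  shows "ennreal \<bar>f (c 1) - f (c 0)\<bar> \<le> (\<integral>\<^sup>+s\<in>{0..1}. ennreal (norm (G (c s)) * norm (c' s)) \<partial>lborel)"
proof -
  have cc: "continuous_on UNIV c"
    using c by (meson continuous_at_imp_continuous_on has_vector_derivative_continuous)
  have d: "((\<lambda>s. f (c s)) has_vector_derivative (G (c s) \<bullet> c' s)) (at s)" for s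
    using has_derivative_compose[OF c[of s, unfolded has_vector_derivative_def] f]
    by (simp add: has_vector_derivative_def)
  have cont: "continuous_on UNIV (\<lambda>s. G (c s) \<bullet> c' s)"
    by (intro continuous_intros continuous_on_compose2[OF G cc] c') auto
  have hb: "has_bochner_integral lborel (\<lambda>s. indicator {0..1} s *\<^sub>R (G (c s) \<bullet> c' s)) (f (c 1) - f (c 0))"
  proof (rule has_bochner_integral_FTC_Icc)
    show "((\<lambda>s. f (c s)) has_vector_derivative G (c s) \<bullet> c' s) (at s within {0..1})" for s
      using d by (rule has_vector_derivative_at_within)
    show "continuous_on {0..1} (\<lambda>s. G (c s) \<bullet> c' s)" using cont continuous_on_subset by blast
  qed simp
  have "ennreal (norm (f (c 1) - f (c 0))) \<le> (\<integral>\<^sup>+s. norm (indicator {0..1} s *\<^sub>R (G (c s) \<bullet> c' s)) \<partial>lborel)"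
    by (rule has_bochner_integral_norm_bound[OF hb])
  also have "\<dots> \<le> (\<integral>\<^sup>+s\<in>{0..1}. ennreal (norm (G (c s)) * norm (c' s)) \<partial>lborel)"
    by (intro nn_integral_mono) (auto split: split_indicator intro!: ennreal_leI Cauchy_Schwarz_ineq2)
  finally show ?thesis by simp
qed

lemma borel_measurable_moll:
  fixes u :: "real^'n::finite \<Rightarrow> 'b::euclidean_space"
  shows "e > 0 \<Longrightarrow> loc_int u \<Longrightarrow> moll e u \<in> borel_measurable borel"
  by (intro borel_measurable_continuous_onI continuous_moll)

text \<open>Segments from \<open>x\<close> to \<open>x + z\<close> stay in the ball enlarged by
  \<open>norm z\<close>. After exchanging the integrals, each parameter \<open>s\<close> contributes
  the same bound by translation invariance.\<close>

lemma C1_translation_bound: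
  fixes f :: "real^'n::finite \<Rightarrow> real"
  assumes f: "\<And>x. (f has_derivative (\<lambda>w. G x \<bullet> w)) (at x)" and G: "continuous_on UNIV G"
  shows "(\<integral>\<^sup>+x\<in>ball 0 \<rho>. ennreal \<bar>f (x + z) - f x\<bar> \<partial>lborel) \<le> ennreal (norm z) * (\<integral>\<^sup>+x\<in>ball 0 (\<rho> + norm z). norm (G x) \<partial>lborel)"
proof -
  have [measurable]: "G \<in> borel_measurable borel" using G by (rule borel_measurable_continuous_onI)
  have "(\<integral>\<^sup>+x\<in>ball 0 \<rho>. ennreal \<bar>f (x + z) - f x\<bar> \<partial>lborel) \<le> 
     (\<integral>\<^sup>+x. \<integral>\<^sup>+s. ennreal (norm (G (x + s *\<^sub>R z)) * norm z) * indicator {0..1} s * indicator (ball 0 \<rho>) x \<partial>lborel \<partial>lborel)"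
  proof (rule nn_integral_mono)
    fix x
    have "ennreal \<bar>f (x + 1 *\<^sub>R z) - f (x + 0 *\<^sub>R z)\<bar> \<le> (\<integral>\<^sup>+s\<in>{0..1}. ennreal (norm (G (x + s *\<^sub>R z)) * norm z) \<partial>lborel)"
      by (rule C1_curve_bound[OF f G]) (auto intro!: derivative_eq_intros)
    then show "ennreal \<bar>f (x + z) - f x\<bar> * indicator (ball 0 \<rho>) x \<le> (\<integral>\<^sup>+s. ennreal (norm (G (x + s *\<^sub>R z)) * norm z) * indicator {0..1} s * indicator (ball 0 \<rho>) x \<partial>lborel)"
      by (auto split: split_indicator)
  qed
  also have "\<dots> = (\<integral>\<^sup>+s. \<integral>\<^sup>+x. ennreal (norm (G (x + s *\<^sub>R z)) * norm z) * indicator {0..1} s * indicator (ball 0 \<rho>) x \<partial>lborel \<partial>lborel)"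
    by (rule tonelli_lborel) measurable
  also have "\<dots> \<le> (\<integral>\<^sup>+s. (ennreal (norm z) * (\<integral>\<^sup>+x\<in>ball 0 (\<rho> + norm z). norm (G x) \<partial>lborel)) * indicator {0..1} (s::real) \<partial>lborel)"
  proof (rule nn_integral_mono)
    fix s :: real
    show "(\<integral>\<^sup>+x. ennreal (norm (G (x + s *\<^sub>R z)) * norm z) * indicator {0..1} s * indicator (ball 0 \<rho>) x \<partial>lborel) \<le> 
      (ennreal (norm z) * (\<integral>\<^sup>+x\<in>ball 0 (\<rho> + norm z). norm (G x) \<partial>lborel)) * indicator {0..1} s"
    proof (cases "s \<in> {0..1}")
      case True
      have sub: "x + s *\<^sub>R z \<in> ball 0 (\<rho> + norm z)" if "x \<in> ball 0 \<rho>" for x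
      proof -
        have "norm (x + s *\<^sub>R z) \<le> norm x + s * norm z" using norm_triangle_ineq[of x "s *\<^sub>R z"] True by simp
        also have "\<dots> \<le> norm x + 1 * norm z" using True by (intro add_left_mono mult_right_mono) auto
        finally show ?thesis using that by simp
      qed
      have "(\<integral>\<^sup>+x. ennreal (norm (G (x + s *\<^sub>R z)) * norm z) * indicator {0..1} s * indicator (ball 0 \<rho>) x \<partial>lborel) \<le>
        (\<integral>\<^sup>+x. ennreal (norm z) * (ennreal (norm (G (x + s *\<^sub>R z))) * indicator (ball 0 (\<rho> + norm z)) (x + s *\<^sub>R z)) \<partial>lborel)"
        using True sub by (intro nn_integral_mono) (auto split: split_indicator simp: ennreal_mult mult.commute)
      also have "\<dots> = (\<integral>\<^sup>+x. ennreal (norm z) * (ennreal (norm (G x)) * indicator (ball 0 (\<rho> + norm z)) x) \<partial>lborel)"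
        by (rule nn_integral_translate) measurable
      also have "\<dots> = ennreal (norm z) * (\<integral>\<^sup>+x\<in>ball 0 (\<rho> + norm z). norm (G x) \<partial>lborel)"
        by (rule nn_integral_cmult) measurable
      finally show ?thesis using True by simp
    qed simp
  qed
  also have "\<dots> = ennreal (norm z) * (\<integral>\<^sup>+x\<in>ball 0 (\<rho> + norm z). norm (G x) \<partial>lborel)"
    by (subst nn_integral_cmult_indicator) auto
  finally show ?thesis .
qed

text \<open>The estimate for differentiable functions passes to the limit: mollification costs one
  \<open>L1\<close> error at \<open>x\<close> and one at \<open>x + z\<close>, both controlled on
  the enlarged ball, and one error for the gradient.\<close>

lemma translation_bound:
  fixes u :: "real^'n::finite \<Rightarrow> real"
  assumes u: "wgrad u g"
  shows "(\<integral>\<^sup>+x\<in>ball 0 \<rho>. ennreal \<bar>u (x + z) - u x\<bar> \<partial>lborel) \<le> ennreal (norm z) * (\<integral>\<^sup>+x\<in>ball 0 (\<rho> + norm z). norm (g x) \<partial>lborel)"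
proof -
  let ?B = "ball (0::real^'n) (\<rho> + norm z)"
  have l: "loc_int u" "loc_int g" using u by (auto simp: wgrad_def)
  have [measurable]: "u \<in> borel_measurable borel" "g \<in> borel_measurable borel" using l by (auto simp: loc_int_def)
  define f where "f n = moll (moll_seq n) u" for n
  define G where "G n = moll (moll_seq n) g" for n
  have [measurable]: "f n \<in> borel_measurable borel" "G n \<in> borel_measurable borel" for n
    unfolding f_def G_def by (intro borel_measurable_moll moll_seq l)+
  define If where "If n = (\<integral>\<^sup>+x\<in>?B. norm (f n x - u x) \<partial>lborel)" for n
  define IG where "IG n = (\<integral>\<^sup>+x\<in>?B. norm (G n x - g x) \<partial>lborel)" for n
  define Ig where "Ig = (\<integral>\<^sup>+x\<in>?B. norm (g x) \<partial>lborel)"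
  have lim: "If \<longlonglongrightarrow> 0" "IG \<longlonglongrightarrow> 0"
    unfolding If_def IG_def f_def G_def by (intro moll_L1_seq l)+
  have bd: "(\<integral>\<^sup>+x\<in>ball 0 \<rho>. ennreal \<bar>u (x + z) - u x\<bar> \<partial>lborel) \<le> If n + If n + ennreal (norm z) * (Ig + IG n)" for n
  proof -
    have "(\<integral>\<^sup>+x\<in>ball 0 \<rho>. ennreal \<bar>u (x + z) - u x\<bar> \<partial>lborel) \<le> 
      (\<integral>\<^sup>+x. (ennreal (norm (f n (x + z) - u (x + z))) * indicator ?B (x + z) + ennreal (norm (f n x - u x)) * indicator ?B x)
        + ennreal \<bar>f n (x + z) - f n x\<bar> * indicator (ball 0 \<rho>) x \<partial>lborel)"
    proof (rule nn_integral_mono)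
      fix x
      show "ennreal \<bar>u (x + z) - u x\<bar> * indicator (ball 0 \<rho>) x \<le> (ennreal (norm (f n (x + z) - u (x + z))) * indicator ?B (x + z) + ennreal (norm (f n x - u x)) * indicator ?B x)
        + ennreal \<bar>f n (x + z) - f n x\<bar> * indicator (ball 0 \<rho>) x"
      proof (cases "norm x < \<rho>")
        case True
        then have "norm (x + z) < \<rho> + norm z" "norm x < \<rho> + norm z"
          using norm_triangle_ineq[of x z] norm_ge_zero[of z] by linarith+
        moreover have "ennreal \<bar>u (x + z) - u x\<bar> \<le> ennreal (\<bar>f n (x + z) - u (x + z)\<bar> + \<bar>f n x - u x\<bar> + \<bar>f n (x + z) - f n x\<bar>)"
          by (intro ennreal_leI) linarith
        ultimately show ?thesis using True by (simp add: ennreal_plus)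
      qed simp
    qed
    also have "\<dots> = (\<integral>\<^sup>+x. ennreal (norm (f n (x + z) - u (x + z))) * indicator ?B (x + z) \<partial>lborel) + If n
       + (\<integral>\<^sup>+x\<in>ball 0 \<rho>. ennreal \<bar>f n (x + z) - f n x\<bar> \<partial>lborel)"
      unfolding If_def by (simp add: nn_integral_add)
    also have "(\<integral>\<^sup>+x. ennreal (norm (f n (x + z) - u (x + z))) * indicator ?B (x + z) \<partial>lborel) = If n"
      unfolding If_def by (rule nn_integral_translate) measurable
    also have "(\<integral>\<^sup>+x\<in>ball 0 \<rho>. ennreal \<bar>f n (x + z) - f n x\<bar> \<partial>lborel) \<le> ennreal (norm z) * (\<integral>\<^sup>+x\<in>?B. norm (G n x) \<partial>lborel)"
      unfolding f_def G_def
      by (rule C1_translation_bound[OF moll_has_derivative[OF moll_seq(1) u] continuous_moll[OF moll_seq(1) l(2)]])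
    also have "(\<integral>\<^sup>+x\<in>?B. norm (G n x) \<partial>lborel) \<le> (\<integral>\<^sup>+x. ennreal (norm (g x)) * indicator ?B x + ennreal (norm (G n x - g x)) * indicator ?B x \<partial>lborel)"
    proof (rule nn_integral_mono)
      fix x
      have "ennreal (norm (G n x)) \<le> ennreal (norm (g x) + norm (G n x - g x))"
        using norm_triangle_ineq[of "g x" "G n x - g x"] by (intro ennreal_leI) simp
      then show "ennreal (norm (G n x)) * indicator ?B x \<le> ennreal (norm (g x)) * indicator ?B x + ennreal (norm (G n x - g x)) * indicator ?B x"
        by (auto split: split_indicator)
    qed
    also have "\<dots> = Ig + IG n" unfolding Ig_def IG_def by (simp add: nn_integral_add)
    finally show ?thesis by (simp add: add_left_mono mult_left_mono)
  qed
  have "(\<lambda>n. If n + If n + ennreal (norm z) * (Ig + IG n)) \<longlonglongrightarrow> 0 + 0 + ennreal (norm z) * (Ig + 0)"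
    by (intro tendsto_add ennreal_tendsto_cmult lim tendsto_const) simp
  then have "(\<integral>\<^sup>+x\<in>ball 0 \<rho>. ennreal \<bar>u (x + z) - u x\<bar> \<partial>lborel) \<le> 0 + 0 + ennreal (norm z) * (Ig + 0)"
    by (rule LIMSEQ_le_const) (use bd in auto)
  then show ?thesis by (simp add: Ig_def)
qed

text \<open>At least half of all translates of a point by vectors of length below \<open>h\<close> hit the zero set of \<open>u\<close>,
  so averaging the translation estimate recovers \<open>u\<close> itself.\<close>

lemma small_support_bound:
  fixes u :: "real^'n::finite \<Rightarrow> real"
  assumes u: "wgrad u g" and h: "h > 0"
    and E: "2 * emeasure lborel {x\<in>ball 0 (\<rho> + h). u x \<noteq> 0} \<le> emeasure lborel (ball (0::real^'n) h)"
  shows "(\<integral>\<^sup>+x\<in>ball 0 \<rho>. ennreal \<bar>u x\<bar> \<partial>lborel) \<le> ennreal (2 * h) * (\<integral>\<^sup>+x\<in>ball 0 (\<rho> + h). norm (g x) \<partial>lborel)"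
proof -
  let ?I = "\<integral>\<^sup>+x\<in>ball 0 (\<rho> + h). norm (g x) \<partial>lborel"
  have l: "loc_int u" "loc_int g" using u by (auto simp: wgrad_def)
  have [measurable]: "u \<in> borel_measurable borel" "g \<in> borel_measurable borel" using l by (auto simp: loc_int_def)
  define V where "V = emeasure lborel (ball (0::real^'n) h)"
  have V: "V < \<infinity>" "V \<noteq> 0"
    unfolding V_def using h emeasure_lborel_ball_finite[of "0::real^'n" h] open_not_negligible[of "ball (0::real^'n) h"]
    by (auto simp: negligible_iff_null_sets null_sets_def)
  \<comment> \<open>Translating by a point of \<open>ball 0 \<rho>\<close> keeps the set inside
    \<open>ball 0 (\<rho> + h)\<close>, so the bound \<open>E\<close> holds around every such
    point.\<close>
  have E': "2 * emeasure lborel {z\<in>ball 0 h. u (x + z) \<noteq> 0} \<le> V" if x: "x \<in> ball 0 \<rho>" for x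
  proof -
    have "emeasure lborel {z\<in>ball 0 h. u (x + z) \<noteq> 0} = (\<integral>\<^sup>+z. indicator {z\<in>ball 0 h. u (x + z) \<noteq> 0} z \<partial>lborel)" by simp
    also have "\<dots> \<le> (\<integral>\<^sup>+z. indicator {x\<in>ball 0 (\<rho> + h). u x \<noteq> 0} (z + x) \<partial>lborel)"
    proof (rule nn_integral_mono)
      fix z show "indicator {z \<in> ball 0 h. u (x + z) \<noteq> 0} z \<le> (indicator {x \<in> ball 0 (\<rho> + h). u x \<noteq> 0} (z + x) :: ennreal)"
        using norm_triangle_ineq[of z x] x by (auto split: split_indicator simp: add.commute)
    qed
    also have "\<dots> = (\<integral>\<^sup>+z. indicator {x\<in>ball 0 (\<rho> + h). u x \<noteq> 0} z \<partial>lborel)"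
      by (rule nn_integral_translate) measurable
    also have "\<dots> = emeasure lborel {x\<in>ball 0 (\<rho> + h). u x \<noteq> 0}" by simp
    finally have "2 * emeasure lborel {z\<in>ball 0 h. u (x + z) \<noteq> 0} \<le> 2 * emeasure lborel {x\<in>ball 0 (\<rho> + h). u x \<noteq> 0}"
      by (intro mult_left_mono) auto
    with E show ?thesis by (simp add: V_def)
  qed
  have pt: "V * ennreal \<bar>u x\<bar> \<le> 2 * (\<integral>\<^sup>+z\<in>ball 0 h. ennreal \<bar>u (x + z) - u x\<bar> \<partial>lborel)" if x: "x \<in> ball 0 \<rho>" for x
  proof -
    define Z where "Z = {z\<in>ball 0 h. u (x + z) = 0}"
    have [measurable]: "Z \<in> sets borel" unfolding Z_def by measurable
    have "V \<le> emeasure lborel (Z \<union> {z\<in>ball 0 h. u (x + z) \<noteq> 0})"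
      unfolding V_def by (rule emeasure_mono) (auto simp: Z_def)
    also have "\<dots> \<le> emeasure lborel Z + emeasure lborel {z\<in>ball 0 h. u (x + z) \<noteq> 0}"
      by (rule emeasure_subadditive) auto
    finally have "2 * V \<le> 2 * (emeasure lborel Z + emeasure lborel {z\<in>ball 0 h. u (x + z) \<noteq> 0})"
      by (rule mult_left_mono) simp
    also have "\<dots> = 2 * emeasure lborel Z + 2 * emeasure lborel {z\<in>ball 0 h. u (x + z) \<noteq> 0}"
      by (rule distrib_left)
    also have "\<dots> \<le> 2 * emeasure lborel Z + V" using E'[OF x] by (rule add_left_mono)
    finally have "V + V \<le> 2 * emeasure lborel Z + V" by (simp add: mult_2)
    then have VZ: "V \<le> 2 * emeasure lborel Z" using V by auto
    have "V * ennreal \<bar>u x\<bar> \<le> 2 * emeasure lborel Z * ennreal \<bar>u x\<bar>" using VZ by (rule mult_right_mono) simp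
    also have "\<dots> = 2 * (\<integral>\<^sup>+z. ennreal \<bar>u x\<bar> * indicator Z z \<partial>lborel)"
      by (subst nn_integral_cmult_indicator) (simp_all add: mult_ac)
    also have "\<dots> \<le> 2 * (\<integral>\<^sup>+z\<in>ball 0 h. ennreal \<bar>u (x + z) - u x\<bar> \<partial>lborel)"
      by (intro mult_left_mono nn_integral_mono) (auto split: split_indicator simp: Z_def)
    finally show ?thesis .
  qed
  have "V * (\<integral>\<^sup>+x\<in>ball 0 \<rho>. ennreal \<bar>u x\<bar> \<partial>lborel) = (\<integral>\<^sup>+x. V * (ennreal \<bar>u x\<bar> * indicator (ball 0 \<rho>) x) \<partial>lborel)"
    by (rule nn_integral_cmult[symmetric]) measurable
  also have "\<dots> \<le> (\<integral>\<^sup>+x. 2 * (\<integral>\<^sup>+z. ennreal \<bar>u (x + z) - u x\<bar> * indicator (ball 0 h) z * indicator (ball 0 \<rho>) x \<partial>lborel) \<partial>lborel)"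
    using pt by (intro nn_integral_mono) (auto split: split_indicator)
  also have "\<dots> = 2 * (\<integral>\<^sup>+x. \<integral>\<^sup>+z. ennreal \<bar>u (x + z) - u x\<bar> * indicator (ball 0 h) z * indicator (ball 0 \<rho>) x \<partial>lborel \<partial>lborel)"
    by (rule nn_integral_cmult) measurable
  also have "(\<integral>\<^sup>+x. \<integral>\<^sup>+z. ennreal \<bar>u (x + z) - u x\<bar> * indicator (ball 0 h) z * indicator (ball 0 \<rho>) x \<partial>lborel \<partial>lborel)
     = (\<integral>\<^sup>+z. \<integral>\<^sup>+x. ennreal \<bar>u (x + z) - u x\<bar> * indicator (ball 0 h) z * indicator (ball 0 \<rho>) x \<partial>lborel \<partial>lborel)"
    by (rule tonelli_lborel) measurable
  also have "\<dots> \<le> (\<integral>\<^sup>+z. (ennreal h * ?I) * indicator (ball 0 h) (z::real^'n) \<partial>lborel)"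
  proof (rule nn_integral_mono)
    fix z :: "real^'n"
    show "(\<integral>\<^sup>+x. ennreal \<bar>u (x + z) - u x\<bar> * indicator (ball 0 h) z * indicator (ball 0 \<rho>) x \<partial>lborel)
       \<le> (ennreal h * ?I) * indicator (ball 0 h) z"
    proof (cases "norm z < h")
      case True
      have "(\<integral>\<^sup>+x\<in>ball 0 \<rho>. ennreal \<bar>u (x + z) - u x\<bar> \<partial>lborel) \<le> ennreal (norm z) * (\<integral>\<^sup>+x\<in>ball 0 (\<rho> + norm z). norm (g x) \<partial>lborel)"
        by (rule translation_bound[OF u])
      also have "\<dots> \<le> ennreal h * ?I"
        using True by (intro mult_mono ennreal_leI nn_integral_mono) (auto split: split_indicator)
      finally show ?thesis using True by simp
    qed simp
  qed
  also have "\<dots> = ennreal h * ?I * V"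
    unfolding V_def by (rule nn_integral_cmult_indicator) simp
  finally have "V * (\<integral>\<^sup>+x\<in>ball 0 \<rho>. ennreal \<bar>u x\<bar> \<partial>lborel) \<le> 2 * (ennreal h * ?I * V)"
    by (simp add: mult_left_mono)
  also have "\<dots> = V * (ennreal (2 * h) * ?I)"
    using h by (simp add: ennreal_mult mult_ac)
  finally show ?thesis using V by (subst (asm) ennreal_mult_le_mult_iff) auto
qed

section \<open>Shrinking towards a coordinate plane\<close>

text \<open>The coordinates in \<open>J\<close> are those transversal to the plane. At
  \<open>t = 0\<close> this is the projection onto the plane, while \<open>shrink (- J) 0\<close>
  keeps exactly the transversal part.\<close>

definition shrink :: "'n set \<Rightarrow> real \<Rightarrow> real^'n::finite \<Rightarrow> real^'n" where
  "shrink J t x = (\<chi> i. if i \<in> J then t * x $ i else x $ i)"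

lemma shrink_nth: "shrink J t x $ i = (if i \<in> J then t * x $ i else x $ i)"
  by (simp add: shrink_def)

lemma norm_shrink_le: "0 \<le> t \<Longrightarrow> t \<le> 1 \<Longrightarrow> norm (shrink J t x) \<le> norm x"
  unfolding norm_vec_def by (rule L2_set_mono) (auto simp: shrink_nth abs_mult mult_left_le_one_le)

lemma shrink_eq: "shrink J t x = x + (t - 1) *\<^sub>R shrink (- J) 0 x"
  by (simp add: vec_eq_iff shrink_nth algebra_simps)

lemma nn_integral_shrink:
  fixes F :: "real^'n::finite \<Rightarrow> ennreal"
  assumes t: "t > 0" and [measurable]: "F \<in> borel_measurable borel"
  shows "ennreal (t ^ card J) * (\<integral>\<^sup>+x. F (shrink J t x) \<partial>lborel) = (\<integral>\<^sup>+x. F x \<partial>lborel)"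
proof -
  \<comment> \<open>The affine change of variables for \<open>lborel\<close> takes stretching
    factors indexed by basis vectors, so \<open>J\<close> is transported along \<open>axis\<close>.
    The product of the factors is the determinant \<open>t ^ card J\<close>.\<close>
  define c :: "real^'n \<Rightarrow> real" where "c b = (if b \<in> (\<lambda>i. axis i 1) ` J then t else 1)" for b
  have ax: "axis i (1::real) = axis j 1 \<longleftrightarrow> i = j" for i j :: 'n by (simp add: axis_eq_axis)
  have Basis: "(Basis :: (real^'n) set) = range (\<lambda>i. axis i 1)"
    by (auto simp: Basis_vec_def)
  have inj: "inj_on (\<lambda>i::'n. axis i (1::real)) A" for A by (auto simp: inj_on_def ax)
  have c: "c (axis i 1) = (if i \<in> J then t else 1)" for i
    by (auto simp: c_def ax)
  have T: "0 + (\<Sum>j\<in>Basis. (c j * (x \<bullet> j)) *\<^sub>R j) = shrink J t x" for x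
  proof -
    have "(\<Sum>j\<in>Basis. (c j * (x \<bullet> j)) *\<^sub>R j) = (\<Sum>i\<in>UNIV. (c (axis i 1) * (x \<bullet> axis i 1)) *\<^sub>R axis i 1)"
      unfolding Basis sum.reindex[OF inj] o_def ..
    also have "\<dots> = (\<Sum>i\<in>UNIV. shrink J t x $ i *\<^sub>R axis i 1)"
      by (intro sum.cong) (auto simp: c inner_axis shrink_nth)
    also have "\<dots> = shrink J t x"
      by (auto simp: vec_eq_iff axis_def if_distrib cong: if_cong)
    finally show ?thesis by simp
  qed
  have D: "(\<Prod>j\<in>Basis. \<bar>c j\<bar>) = t ^ card J"
  proof -
    have "(\<Prod>j\<in>Basis. \<bar>c j\<bar>) = (\<Prod>i\<in>UNIV. if i \<in> J then t else 1)"
      unfolding Basis prod.reindex[OF inj] o_def using t by (intro prod.cong) (auto simp: c)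
    also have "\<dots> = t ^ card J" by (simp add: prod.If_cases)
    finally show ?thesis .
  qed
  have [measurable]: "shrink J t \<in> borel_measurable borel"
    unfolding T[abs_def, symmetric] by (intro borel_measurable_continuous_onI continuous_intros)
  have L: "lborel = density (distr lborel borel (shrink J t)) (\<lambda>_. ennreal (t ^ card J))"
  proof -
    have nz: "c j \<noteq> 0" for j using t by (simp add: c_def)
    show ?thesis using lborel_affine_euclidean[of c 0, OF nz] unfolding T D .
  qed
  have "(\<integral>\<^sup>+x. F x \<partial>lborel) = (\<integral>\<^sup>+x. F x \<partial>density (distr lborel borel (shrink J t)) (\<lambda>_. ennreal (t ^ card J)))"
    by (subst L) simp
  also have "\<dots> = (\<integral>\<^sup>+x. ennreal (t ^ card J) * F (shrink J t x) \<partial>lborel)"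
    by (subst nn_integral_density) (auto simp: nn_integral_distr)
  also have "\<dots> = ennreal (t ^ card J) * (\<integral>\<^sup>+x. F (shrink J t x) \<partial>lborel)"
    by (rule nn_integral_cmult) measurable
  finally show ?thesis ..
qed

text \<open>Stands in for Hoelder's inequality. Above the threshold the nonpositive exponent
  \<open>1 - q\<close> allows \<open>a\<close> to be replaced by \<open>\<tau>\<close>; leaving
  \<open>\<tau>\<close> free lets the two resulting terms be balanced later.\<close>

lemma le_add_powr:
  fixes a \<tau> q :: real
  assumes "a \<ge> 0" "\<tau> > 0" "q \<ge> 1"
  shows "a \<le> \<tau> + \<tau> powr (1 - q) * a powr q"
proof (cases "a \<le> \<tau>")
  case False
  then have "a = a powr (1 - q) * a powr q" using assms by (simp flip: powr_add)
  also have "\<dots> \<le> \<tau> powr (1 - q) * a powr q"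
    using False assms by (intro mult_right_mono powr_mono2') auto
  also have "\<dots> \<le> \<tau> + \<tau> powr (1 - q) * a powr q" using assms by simp
  finally show ?thesis .
qed (use assms in \<open>auto intro: add_increasing2\<close>)

lemma moll_nonpos:
  fixes W :: "real^'n::finite \<Rightarrow> real"
  assumes e: "e > 0" and ae: "AE y in lborel. y \<in> ball x e \<longrightarrow> W y \<le> 0"
  shows "moll e W x \<le> 0"
proof -
  have "(\<integral>y. - (eta e (x - y) *\<^sub>R W y) \<partial>lborel) \<ge> 0"
  proof (rule integral_nonneg_AE)
    show "AE y in lborel. 0 \<le> - (eta e (x - y) *\<^sub>R W y)"
      using ae
    proof (rule AE_mp, intro AE_I2 impI)
      fix y assume *: "y \<in> ball x e \<longrightarrow> W y \<le> 0"
      show "0 \<le> - (eta e (x - y) *\<^sub>R W y)"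
        using eta_eq_0[OF e, of "x - y"] eta_nonneg[OF e, of "x - y"] *
        by (cases "y \<in> ball x e") (auto simp: dist_norm mult_nonneg_nonpos)
    qed
  qed
  then show ?thesis by (simp add: moll_def)
qed

text \<open>Convolving \<open>a \<le> \<tau> + \<tau> powr (1 - q) * a powr q\<close> with the kernel bounds the mollified gradient
  linearly by the mollification of \<open>norm g powr q\<close>; this replaces Jensen's inequality.\<close>

lemma moll_norm_bound:
  fixes g :: "real^'n::finite \<Rightarrow> real^'n"
  assumes e: "e > 0" and g: "loc_int g" and "\<tau> > 0" "q \<ge> 1" "a \<ge> 0"
  shows "ennreal (a * norm (moll e g x)) \<le> ennreal \<tau> + ennreal (\<tau> powr (1 - q) * a powr q) * (\<integral>\<^sup>+y. ennreal (eta e (x - y)) * ennreal (norm (g y) powr q) \<partial>lborel)"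
proof -
  have [measurable]: "g \<in> borel_measurable borel" using g by (auto simp: loc_int_def)
  have I: "ennreal (norm (moll e g x)) \<le> (\<integral>\<^sup>+y. norm (eta e (x - y) *\<^sub>R g y) \<partial>lborel)"
    unfolding moll_def by (rule integral_norm_bound_ennreal[OF moll_integrable[OF e g]])
  have "ennreal (a * norm (moll e g x)) = ennreal a * ennreal (norm (moll e g x))"
    using \<open>a \<ge> 0\<close> by (simp add: ennreal_mult)
  also have "\<dots> \<le> ennreal a * (\<integral>\<^sup>+y. norm (eta e (x - y) *\<^sub>R g y) \<partial>lborel)"
    using I by (rule mult_left_mono) simp
  also have "\<dots> = (\<integral>\<^sup>+y. ennreal a * ennreal (norm (eta e (x - y) *\<^sub>R g y)) \<partial>lborel)"
    by (rule nn_integral_cmult[symmetric]) measurable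
  also have "\<dots> \<le> (\<integral>\<^sup>+y. eta e (x - y) * ennreal \<tau> + ennreal (\<tau> powr (1 - q) * a powr q) * (ennreal (eta e (x - y)) * ennreal (norm (g y) powr q)) \<partial>lborel)"
  proof (rule nn_integral_mono)
    fix y
    have eta: "eta e (x - y) \<ge> 0" by (rule eta_nonneg[OF e])
    have "a * norm (g y) \<le> \<tau> + \<tau> powr (1 - q) * (a * norm (g y)) powr q"
      using assms by (intro le_add_powr) auto
    also have "(a * norm (g y)) powr q = a powr q * norm (g y) powr q" using \<open>a \<ge> 0\<close> by (intro powr_mult)
    finally have "eta e (x - y) * (a * norm (g y)) \<le> eta e (x - y) * (\<tau> + \<tau> powr (1 - q) * (a powr q * norm (g y) powr q))"
      by (rule mult_left_mono[OF _ eta])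
    then have "ennreal (a * norm (eta e (x - y) *\<^sub>R g y)) \<le> ennreal (eta e (x - y) * \<tau> + \<tau> powr (1 - q) * a powr q * (eta e (x - y) * norm (g y) powr q))"
      using eta by (intro ennreal_leI) (simp add: algebra_simps)
    then show "ennreal a * ennreal (norm (eta e (x - y) *\<^sub>R g y)) \<le> eta e (x - y) * ennreal \<tau> + ennreal (\<tau> powr (1 - q) * a powr q) * (ennreal (eta e (x - y)) * ennreal (norm (g y) powr q))"
      using assms eta by (simp add: ennreal_mult ennreal_plus)
  qed
  also have "\<dots> = (\<integral>\<^sup>+y. eta e (x - y) * ennreal \<tau> \<partial>lborel) + ennreal (\<tau> powr (1 - q) * a powr q) * (\<integral>\<^sup>+y. ennreal (eta e (x - y)) * ennreal (norm (g y) powr q) \<partial>lborel)"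
    by (simp add: nn_integral_add nn_integral_cmult)
  also have "(\<integral>\<^sup>+y. eta e (x - y) * ennreal \<tau> \<partial>lborel) = ennreal \<tau>"
    using nn_integral_reflect[of "\<lambda>y. ennreal (eta e y)" x] nn_integral_eta[OF e, where 'n='n] by (simp add: nn_integral_multc)
  finally show ?thesis .
qed

text \<open>Convolution with a kernel of mass one supported within distance \<open>e\<close> does
  not increase the total mass, apart from enlarging the ball by \<open>e\<close>.\<close>

lemma moll_power_integral:
  fixes F :: "real^'n::finite \<Rightarrow> ennreal"
  assumes e: "e > 0" and [measurable]: "F \<in> borel_measurable borel"
  shows "(\<integral>\<^sup>+x\<in>ball 0 R. (\<integral>\<^sup>+y. ennreal (eta e (x - y)) * F y \<partial>lborel) \<partial>lborel) \<le> (\<integral>\<^sup>+y\<in>ball 0 (R + e). F y \<partial>lborel)"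
proof -
  have "(\<integral>\<^sup>+x\<in>ball 0 R. (\<integral>\<^sup>+y. ennreal (eta e (x - y)) * F y \<partial>lborel) \<partial>lborel) =
    (\<integral>\<^sup>+x. \<integral>\<^sup>+y. ennreal (eta e (x - y)) * F y * indicator (ball 0 R) x \<partial>lborel \<partial>lborel)"
    by (intro nn_integral_cong nn_integral_multc[symmetric]) measurable
  also have "\<dots> = (\<integral>\<^sup>+y. \<integral>\<^sup>+x. ennreal (eta e (x - y)) * F y * indicator (ball 0 R) x \<partial>lborel \<partial>lborel)"
    by (rule tonelli_lborel) measurable
  also have "\<dots> \<le> (\<integral>\<^sup>+y\<in>ball 0 (R + e). F y \<partial>lborel)"
  proof (rule nn_integral_mono)
    fix y
    have "(\<integral>\<^sup>+x. ennreal (eta e (x - y)) * F y * indicator (ball 0 R) x \<partial>lborel) \<le>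
      (\<integral>\<^sup>+x. ennreal (eta e (x - y)) * (F y * indicator (ball 0 (R + e)) y) \<partial>lborel)"
    proof (rule nn_integral_mono)
      fix x
      show "ennreal (eta e (x - y)) * F y * indicator (ball 0 R) x \<le> ennreal (eta e (x - y)) * (F y * indicator (ball 0 (R + e)) y)"
        using eta_shift_support[OF e, of x y] by (auto split: split_indicator)
    qed
    also have "\<dots> = (\<integral>\<^sup>+x. ennreal (eta e (x + - y)) \<partial>lborel) * (F y * indicator (ball 0 (R + e)) y)"
      by (simp add: nn_integral_multc)
    also have "(\<integral>\<^sup>+x. ennreal (eta e (x + - y)) \<partial>lborel) = 1"
      using nn_integral_translate[of "\<lambda>x. ennreal (eta e x)" "- y"] nn_integral_eta[OF e, where 'n='n] by simp
    finally show "(\<integral>\<^sup>+x. ennreal (eta e (x - y)) * F y * indicator (ball 0 R) x \<partial>lborel) \<le> F y * indicator (ball 0 (R + e)) y"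
      by simp
  qed
  finally show ?thesis .
qed

lemma continuous_shrink: "continuous_on UNIV (shrink J t :: real^'n::finite \<Rightarrow> real^'n)"
proof -
  have "continuous_on UNIV (\<lambda>x::real^'n. if i \<in> J then t * x $ i else x $ i)" for i
    by (cases "i \<in> J") (auto intro!: continuous_intros)
  then show ?thesis unfolding shrink_def[abs_def] by (intro continuous_on_vec_lambda)
qed

lemma shrink_measurable [measurable]: 
  "(\<lambda>(s, x). shrink J (s ^ m) x) \<in> borel_measurable (borel \<Otimes>\<^sub>M (borel :: (real^'n::finite) measure))"
proof -
  have "(\<lambda>(s, x). shrink J (s ^ m) x) = (\<lambda>p::real \<times> (real^'n). snd p + (fst p ^ m - 1) *\<^sub>R shrink (- J) 0 (snd p))"
    by (auto simp: shrink_eq[of J])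
  moreover have "continuous_on UNIV (\<lambda>p::real \<times> (real^'n). snd p + (fst p ^ m - 1) *\<^sub>R shrink (- J) 0 (snd p))"
    by (intro continuous_intros continuous_on_compose2[OF continuous_shrink]) auto
  ultimately show ?thesis by (simp add: borel_prod borel_measurable_continuous_onI)
qed

text \<open>The curve \<open>s \<mapsto> shrink J (s ^ m) x\<close> joins \<open>x\<close> to its projection on the plane. The Jacobian of \<open>shrink\<close>
  contributes \<open>s powr (- m * card J)\<close>, which the factor \<open>s powr ((m - 1) * q)\<close> coming from the speed
  compensates once \<open>m * (q - card J) \<ge> q\<close>; this is where \<open>q > card J\<close> enters.\<close>

lemma C1_plane_poincare:
  fixes f :: "real^'n::finite \<Rightarrow> real" and J :: "'n set" and \<Phi> :: "real^'n \<Rightarrow> ennreal"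
  assumes f: "\<And>x. (f has_derivative (\<lambda>w. G x \<bullet> w)) (at x)" and G: "continuous_on UNIV G"
    and [measurable]: "\<Phi> \<in> borel_measurable borel"
    and b: "\<And>a x. a \<ge> 0 \<Longrightarrow> ennreal (a * norm (G x)) \<le> ennreal \<tau> + ennreal (\<sigma> * a powr q) * \<Phi> x"
    and f0: "\<And>x. x \<in> ball 0 R \<Longrightarrow> \<forall>i\<in>J. x $ i = 0 \<Longrightarrow> f x \<le> 0"
    and pos: "R > 0" "\<tau> > 0" "\<sigma> \<ge> 0" "q > 0" and m: "m \<ge> 1" "real m * (q - real (card J)) \<ge> q"
  shows "(\<integral>\<^sup>+x\<in>ball 0 R. ennreal (f x) \<partial>lborel) \<le> 
    ennreal (real m * R) * (ennreal \<tau> * emeasure lborel (ball (0::real^'n) R) + ennreal \<sigma> * (\<integral>\<^sup>+x\<in>ball 0 R. \<Phi> x \<partial>lborel))"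
proof -
  let ?B = "ball (0::real^'n) R"
  \<comment> \<open>The curve has speed \<open>m * s ^ (m - 1) * norm y\<close>. The hypothesis
    \<open>b\<close> is applied with \<open>a = s ^ (m - 1)\<close>, and \<open>Q s\<close> is the
    power of \<open>a\<close> that it produces; the rest of the speed is bounded by
    \<open>m * R\<close>.\<close>
  define Q where "Q s = (s ^ (m - 1)) powr q" for s :: real
  have [measurable]: "Q \<in> borel_measurable borel" unfolding Q_def[abs_def] by measurable
  have sh[measurable]: "(\<lambda>x. shrink J (s ^ m) x) \<in> borel_measurable borel" for s
    using measurable_compose[OF measurable_Pair1' shrink_measurable[of J m], of s] by simp
  let ?F = "\<lambda>s x. ennreal (real m * R) * (ennreal \<tau> + ennreal \<sigma> * (ennreal (Q s) * \<Phi> (shrink J (s ^ m) x)))"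
  let ?rhs = "ennreal (real m * R) * (ennreal \<tau> * emeasure lborel ?B + ennreal \<sigma> * (\<integral>\<^sup>+x\<in>?B. \<Phi> x \<partial>lborel))"
  have 1: "ennreal (f x) \<le> (\<integral>\<^sup>+s\<in>{0..1}. ?F s x \<partial>lborel)"
    if x: "x \<in> ?B" for x
  proof -
    define y where "y = shrink (- J) 0 x"
    define c where "c s = shrink J (s ^ m) x" for s
    define c' where "c' s = (real m * s ^ (m - 1)) *\<^sub>R y" for s
    have c_eq: "c = (\<lambda>s. x + (s ^ m - 1) *\<^sub>R y)" unfolding c_def y_def shrink_eq[of J] by simp
    have ny: "norm y \<le> R" using norm_shrink_le[of 0 "- J" x] x by (simp add: y_def)
    have "ennreal \<bar>f (c 1) - f (c 0)\<bar> \<le> (\<integral>\<^sup>+s\<in>{0..1}. ennreal (norm (G (c s)) * norm (c' s)) \<partial>lborel)"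
    proof (rule C1_curve_bound[OF f G])
      show "(c has_vector_derivative c' s) (at s)" for s
        unfolding c_eq c'_def by (auto intro!: derivative_eq_intros)
      show "continuous_on UNIV c'" unfolding c'_def by (intro continuous_intros)
    qed
    moreover have "c 1 = x" by (simp add: c_def vec_eq_iff shrink_nth)
    moreover have "f (c 0) \<le> 0"
    proof (rule f0)
      have "norm (c 0) \<le> norm x" unfolding c_def using m(1) by (intro norm_shrink_le) (auto simp: power_0_left)
      then show "c 0 \<in> ?B" using x by simp
      show "\<forall>i\<in>J. c 0 $ i = 0" using m(1) by (simp add: c_def shrink_nth power_0_left)
    qed
    ultimately have "ennreal (f x) \<le> (\<integral>\<^sup>+s\<in>{0..1}. ennreal (norm (G (c s)) * norm (c' s)) \<partial>lborel)"
      by (smt (verit) ennreal_leI order_trans)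
    also have "\<dots> \<le> (\<integral>\<^sup>+s\<in>{0..1}. ennreal (real m * R) * (ennreal \<tau> + ennreal \<sigma> * (ennreal (Q s) * \<Phi> (c s))) \<partial>lborel)"
    proof (rule nn_integral_mono)
      fix s :: real
      show "ennreal (norm (G (c s)) * norm (c' s)) * indicator {0..1} s \<le> ennreal (real m * R) * (ennreal \<tau> + ennreal \<sigma> * (ennreal (Q s) * \<Phi> (c s))) * indicator {0..1} s"
      proof (cases "s \<in> {0..1}")
        case True
        then have "norm (G (c s)) * norm (c' s) = real m * norm y * (s ^ (m - 1) * norm (G (c s)))"
          by (simp add: c'_def)
        also have "\<dots> \<le> real m * R * (s ^ (m - 1) * norm (G (c s)))"
          using True ny by (intro mult_right_mono mult_left_mono) auto
        finally have "ennreal (norm (G (c s)) * norm (c' s)) \<le> ennreal (real m * R) * ennreal (s ^ (m - 1) * norm (G (c s)))"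
          using True pos by (subst ennreal_mult[symmetric]) (auto intro!: ennreal_leI)
        also have "\<dots> \<le> ennreal (real m * R) * (ennreal \<tau> + ennreal (\<sigma> * Q s) * \<Phi> (c s))"
          unfolding Q_def using True by (intro mult_left_mono b) auto
        also have "ennreal (\<sigma> * Q s) = ennreal \<sigma> * ennreal (Q s)"
          using pos by (intro ennreal_mult) (auto simp: Q_def)
        finally show ?thesis using True by (simp add: mult.assoc)
      qed simp
    qed
    finally show ?thesis by (simp add: c_def)
  qed
  have 2: "ennreal (Q s) * (\<integral>\<^sup>+x\<in>?B. \<Phi> (shrink J (s ^ m) x) \<partial>lborel) \<le> (\<integral>\<^sup>+x\<in>?B. \<Phi> x \<partial>lborel)" if s: "s \<in> {0..1}" for s
  proof (cases "s = 0")
    \<comment> \<open>The change of variables needs a positive factor, so \<open>s = 0\<close> is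
      separate. For \<open>m = 1\<close> the power \<open>0 ^ 0\<close> equals 1, but then the
      second condition on \<open>m\<close> forces \<open>J\<close> to be empty and
      \<open>shrink\<close> is the identity. For larger \<open>m\<close> the factor
      \<open>Q 0\<close> is 0.\<close>
    case True
    show ?thesis
    proof (cases "m = 1")
      case True
      with m(2) pos(4) have "real (card J) \<le> 0" by simp
      then have "J = {}" by simp
      then have "shrink J t x = x" for t x by (simp add: vec_eq_iff shrink_nth)
      then show ?thesis using \<open>m = 1\<close> by (simp add: Q_def)
    next
      case False
      then show ?thesis using m(1) \<open>s = 0\<close> by (simp add: Q_def power_0_left)
    qed
  next
    case False
    then have s0: "0 < s" "s \<le> 1" using s by auto
    define d where "d = card J"
    have "Q s = s powr (real (m - 1) * q)"
      using s0 by (simp add: Q_def powr_realpow[symmetric] powr_powr)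
    also have "\<dots> \<le> s powr (real (m * d))"
    proof (rule powr_mono')
      have "real (m - 1) * q = real m * q - q" using m(1) by (simp add: of_nat_diff algebra_simps)
      then show "real (m * d) \<le> real (m - 1) * q" using m(2) by (simp add: d_def algebra_simps)
    qed (use s0 in auto)
    also have "\<dots> = (s ^ m) ^ d" using powr_realpow[OF s0(1), of "m * d"] by (simp only: power_mult)
    finally have Q: "Q s \<le> (s ^ m) ^ d" .
    have "ennreal (Q s) * (\<integral>\<^sup>+x\<in>?B. \<Phi> (shrink J (s ^ m) x) \<partial>lborel) \<le> ennreal ((s ^ m) ^ d) * (\<integral>\<^sup>+x. \<Phi> (shrink J (s ^ m) x) * indicator ?B (shrink J (s ^ m) x) \<partial>lborel)"
    proof (rule mult_mono[OF ennreal_leI[OF Q] nn_integral_mono])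
      fix x
      have "norm (shrink J (s ^ m) x) \<le> norm x" using s0 by (intro norm_shrink_le) (auto simp: power_le_one)
      then show "\<Phi> (shrink J (s ^ m) x) * indicator ?B x \<le> \<Phi> (shrink J (s ^ m) x) * indicator ?B (shrink J (s ^ m) x)"
        by (auto split: split_indicator)
    qed auto
    also have "\<dots> = (\<integral>\<^sup>+x\<in>?B. \<Phi> x \<partial>lborel)"
      unfolding d_def by (rule nn_integral_shrink) (use s0 in auto)
    finally show ?thesis .
  qed
  have "(\<integral>\<^sup>+x\<in>?B. ennreal (f x) \<partial>lborel) \<le>
    (\<integral>\<^sup>+x. \<integral>\<^sup>+s. ?F s x * indicator {0..1} s * indicator ?B x \<partial>lborel \<partial>lborel)"
    using 1 by (intro nn_integral_mono) (auto split: split_indicator)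
  also have "\<dots> = (\<integral>\<^sup>+s. \<integral>\<^sup>+x. ?F s x * indicator {0..1} s * indicator ?B x \<partial>lborel \<partial>lborel)"
  proof (rule tonelli_lborel)
    have [measurable]: "(\<lambda>p. \<Phi> (shrink J (snd p ^ m) (fst p))) \<in> borel_measurable (borel \<Otimes>\<^sub>M borel)"
      using measurable_compose[OF measurable_compose[OF measurable_pair_swap' shrink_measurable[of J m]], of \<Phi>] by (simp add: case_prod_beta)
    show "(\<lambda>(x, s). ?F s x * indicator {0..1} s * indicator ?B x) \<in> borel_measurable (lborel \<Otimes>\<^sub>M lborel)"
      by (simp add: case_prod_beta)
  qed
  also have "\<dots> \<le> (\<integral>\<^sup>+s. (?rhs) * indicator {0..1} (s::real) \<partial>lborel)"
  proof (rule nn_integral_mono)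
    fix s :: real
    show "(\<integral>\<^sup>+x. ?F s x * indicator {0..1} s * indicator ?B x \<partial>lborel)
      \<le> (?rhs) * indicator {0..1} s"
    proof (cases "s \<in> {0..1}")
      case True
      have "(\<integral>\<^sup>+x. ?F s x * indicator {0..1} s * indicator ?B x \<partial>lborel)
        = (\<integral>\<^sup>+x. ennreal (real m * R) * (ennreal \<tau> * indicator ?B x + ennreal \<sigma> * (ennreal (Q s) * (\<Phi> (shrink J (s ^ m) x) * indicator ?B x))) \<partial>lborel)"
        using True by (intro nn_integral_cong) (auto split: split_indicator)
      also have "\<dots> = ennreal (real m * R) * (ennreal \<tau> * emeasure lborel ?B + ennreal \<sigma> * (ennreal (Q s) * (\<integral>\<^sup>+x\<in>?B. \<Phi> (shrink J (s ^ m) x) \<partial>lborel)))"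
        by (simp add: nn_integral_cmult nn_integral_add nn_integral_cmult_indicator)
      also have "\<dots> \<le> ?rhs"
        by (intro mult_left_mono add_left_mono 2 True) auto
      finally show ?thesis using True by simp
    qed simp
  qed
  also have "\<dots> = ?rhs"
    by (subst nn_integral_cmult_indicator) auto
  finally show ?thesis .
qed

text \<open>The part of the plane in \<open>cball 0 R\<close> is compact and hence has positive
  distance from the complement of \<open>U\<close>. At scales below this distance, mollification at
  a point of the plane averages \<open>W\<close> over \<open>U\<close> only, so a condition almost
  everywhere turns into a pointwise sign on the plane. Scales below \<open>R\<close> keep the
  gradient integral inside \<open>ball 0 (2 * R)\<close>.\<close>

lemma plane_poincare:
  fixes W :: "real^'n::finite \<Rightarrow> real" and J :: "'n set"
  assumes W: "wgrad W g" and U: "open U" "{x. \<forall>i\<in>J. x $ i = 0} \<subseteq> U" "AE x in lborel. x \<in> U \<longrightarrow> W x \<le> 0"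
    and pos: "R > 0" "\<tau> > 0" "q \<ge> 1" and m: "m \<ge> 1" "real m * (q - real (card J)) \<ge> q"
  shows "(\<integral>\<^sup>+x\<in>ball 0 R. ennreal (W x) \<partial>lborel) \<le> 
    ennreal (real m * R) * (ennreal \<tau> * emeasure lborel (ball (0::real^'n) R) + 
      ennreal (\<tau> powr (1 - q)) * (\<integral>\<^sup>+x\<in>ball 0 (2 * R). ennreal (norm (g x) powr q) \<partial>lborel))" (is "_ \<le> ?rhs")
proof -
  have l: "loc_int W" "loc_int g" using W by (auto simp: wgrad_def)
  have [measurable]: "W \<in> borel_measurable borel" "g \<in> borel_measurable borel" using l by (auto simp: loc_int_def)
  define K where "K = {x. \<forall>i\<in>J. x $ i = 0} \<inter> cball (0::real^'n) R"
  have "{x::real^'n. \<forall>i\<in>J. x $ i = 0} = (\<Inter>i\<in>J. {x. x $ i = 0})" by auto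
  moreover have "closed {x::real^'n. x $ i = 0}" for i
    by (intro closed_Collect_eq continuous_intros)
  ultimately have "closed {x::real^'n. \<forall>i\<in>J. x $ i = 0}" by auto
  then have "compact K" unfolding K_def by (simp add: closed_Int_compact)
  moreover have "closed (- U)" "K \<inter> - U = {}" using U by (auto simp: K_def)
  ultimately obtain \<delta> where \<delta>: "\<delta> > 0" "\<And>x y. x \<in> K \<Longrightarrow> y \<in> - U \<Longrightarrow> \<delta> \<le> dist x y"
    using separate_compact_closed by metis
  define If where "If n = (\<integral>\<^sup>+x\<in>ball 0 R. norm (moll (moll_seq n) W x - W x) \<partial>lborel)" for n
  have lim: "If \<longlonglongrightarrow> 0" unfolding If_def by (intro moll_L1_seq l)
  have "\<forall>\<^sub>F n in sequentially. moll_seq n < min \<delta> R"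
    using order_tendstoD(2)[OF moll_seq_0, of "min \<delta> R"] \<delta>(1) pos by simp
  then have bd: "\<forall>\<^sub>F n in sequentially. (\<integral>\<^sup>+x\<in>ball 0 R. ennreal (W x) \<partial>lborel) \<le> ?rhs + If n"
  proof eventually_elim
    case (elim n)
    define e where "e = moll_seq n"
    have e: "e > 0" "e < \<delta>" "e < R" using elim moll_seq(1)[of n] by (auto simp: e_def)
    have [measurable]: "moll e W \<in> borel_measurable borel" by (intro borel_measurable_moll e l)
    define \<Phi> where "\<Phi> x = (\<integral>\<^sup>+y. ennreal (eta e (x - y)) * ennreal (norm (g y) powr q) \<partial>lborel)" for x
    have [measurable]: "\<Phi> \<in> borel_measurable borel" unfolding \<Phi>_def[abs_def] by measurable
    have "(\<integral>\<^sup>+x\<in>ball 0 R. ennreal (moll e W x) \<partial>lborel) \<le> 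
      ennreal (real m * R) * (ennreal \<tau> * emeasure lborel (ball (0::real^'n) R) + ennreal (\<tau> powr (1 - q)) * (\<integral>\<^sup>+x\<in>ball 0 R. \<Phi> x \<partial>lborel))"
    proof (rule C1_plane_poincare[OF moll_has_derivative[OF e(1) W] continuous_moll[OF e(1) l(2)]])
      show "ennreal (a * norm (moll e g x)) \<le> ennreal \<tau> + ennreal (\<tau> powr (1 - q) * a powr q) * \<Phi> x" if "a \<ge> 0" for a x
        unfolding \<Phi>_def by (rule moll_norm_bound[OF e(1) l(2)]) (use pos that in auto)
      show "moll e W x \<le> 0" if x: "x \<in> ball 0 R" "\<forall>i\<in>J. x $ i = 0" for x
      proof (rule moll_nonpos[OF e(1)])
        have "x \<in> K" using x by (simp add: K_def)
        then have "y \<in> U" if "y \<in> ball x e" for y using \<delta>(2)[of x y] e(2) that by auto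
        then show "AE y in lborel. y \<in> ball x e \<longrightarrow> W y \<le> 0"
          using U(3) by (rule_tac AE_mp) (auto intro!: AE_I2)
      qed
    qed (use pos m in auto)
    also have "(\<integral>\<^sup>+x\<in>ball 0 R. \<Phi> x \<partial>lborel) \<le> (\<integral>\<^sup>+y\<in>ball 0 (R + e). ennreal (norm (g y) powr q) \<partial>lborel)"
      unfolding \<Phi>_def by (rule moll_power_integral[OF e(1)]) measurable
    also have "\<dots> \<le> (\<integral>\<^sup>+y\<in>ball 0 (2 * R). ennreal (norm (g y) powr q) \<partial>lborel)"
      using e by (intro nn_integral_mono) (auto split: split_indicator)
    finally have *: "(\<integral>\<^sup>+x\<in>ball 0 R. ennreal (moll e W x) \<partial>lborel) \<le> ?rhs"
      by (simp add: add_left_mono mult_left_mono)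
    have "(\<integral>\<^sup>+x\<in>ball 0 R. ennreal (W x) \<partial>lborel) \<le> (\<integral>\<^sup>+x. ennreal (moll e W x) * indicator (ball 0 R) x + ennreal (norm (moll e W x - W x)) * indicator (ball 0 R) x \<partial>lborel)"
    proof (rule nn_integral_mono)
      fix x
      have "ennreal (W x) \<le> ennreal (max 0 (moll e W x) + norm (moll e W x - W x))" by (intro ennreal_leI) auto
      also have "\<dots> = ennreal (moll e W x) + ennreal (norm (moll e W x - W x))" by (subst ennreal_plus) (auto simp: max_def ennreal_neg)
      finally show "ennreal (W x) * indicator (ball 0 R) x \<le> ennreal (moll e W x) * indicator (ball 0 R) x + ennreal (norm (moll e W x - W x)) * indicator (ball 0 R) x"
        by (auto split: split_indicator)
    qed
    also have "\<dots> = (\<integral>\<^sup>+x\<in>ball 0 R. ennreal (moll e W x) \<partial>lborel) + If n"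
      unfolding If_def e_def[symmetric] by (rule nn_integral_add) measurable
    also have "\<dots> \<le> ?rhs + If n" using * by (rule add_right_mono)
    finally show ?case .
  qed
  have "(\<lambda>n. ?rhs + If n) \<longlonglongrightarrow> ?rhs + 0" by (intro tendsto_add tendsto_const lim)
  from tendsto_lowerbound[OF this bd] show ?thesis by simp
qed

section \<open>De Giorgi classes\<close>

text \<open>One gradient serves all levels and radii. Nonnegative integrals keep the energy
  inequality meaningful without side conditions on integrability.\<close>

definition dg_pair :: "real \<Rightarrow> real \<Rightarrow> (real^'n::finite \<Rightarrow> real) \<Rightarrow> (real^'n \<Rightarrow> real^'n) \<Rightarrow> bool" where
  "dg_pair p \<gamma> u g \<longleftrightarrow> wgrad u g \<and> (\<forall>\<rho> \<sigma> k. 0 < \<rho> \<longrightarrow> 0 < \<sigma> \<longrightarrow> \<sigma> < 1 \<longrightarrow>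
     (\<integral>\<^sup>+x\<in>ball 0 (\<sigma> * \<rho>). ennreal (if u x > k then norm (g x) powr p else 0) \<partial>lborel)
      \<le> ennreal (\<gamma> / ((1 - \<sigma>) * \<rho>) powr p) * (\<integral>\<^sup>+x\<in>ball 0 \<rho>. ennreal (max (u x - k) 0 powr p) \<partial>lborel))"

text \<open>Under the bound \<open>u \<le> \<mu>\<close> the truncation never exceeds
  \<open>\<mu> - k\<close> and lives where \<open>u > k\<close>, so the right-hand side of the
  energy inequality reduces to the measure of that set.\<close>

lemma dg_energy:
  fixes u :: "real^'n::finite \<Rightarrow> real"
  assumes u: "dg_pair p \<gamma> u g" and ae: "AE x in lborel. x \<in> ball 0 \<rho> \<longrightarrow> u x \<le> \<mu>"
    and "k < \<mu>" "0 < \<rho>1" "\<rho>1 < \<rho>" "p > 1" "\<gamma> > 0"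
  shows "(\<integral>\<^sup>+x\<in>ball 0 \<rho>1. ennreal (if u x > k then norm (g x) powr p else 0) \<partial>lborel)
     \<le> ennreal (\<gamma> * ((\<mu> - k) / (\<rho> - \<rho>1)) powr p) * emeasure lborel {x\<in>ball 0 \<rho>. u x > k}"
proof -
  have [measurable]: "u \<in> borel_measurable borel" using u by (simp add: dg_pair_def wgrad_def loc_int_def)
  define \<sigma> where "\<sigma> = \<rho>1 / \<rho>"
  have \<sigma>: "0 < \<sigma>" "\<sigma> < 1" "\<sigma> * \<rho> = \<rho>1" "(1 - \<sigma>) * \<rho> = \<rho> - \<rho>1"
    using assms by (auto simp: \<sigma>_def field_simps)
  have "0 < \<rho>" using assms by simp
  from u[unfolded dg_pair_def, THEN conjunct2, rule_format, OF this \<sigma>(1,2), of k]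
  have "(\<integral>\<^sup>+x\<in>ball 0 \<rho>1. ennreal (if u x > k then norm (g x) powr p else 0) \<partial>lborel)
      \<le> ennreal (\<gamma> / (\<rho> - \<rho>1) powr p) * (\<integral>\<^sup>+x\<in>ball 0 \<rho>. ennreal (max (u x - k) 0 powr p) \<partial>lborel)"
    by (simp only: \<sigma>)
  also have "(\<integral>\<^sup>+x\<in>ball 0 \<rho>. ennreal (max (u x - k) 0 powr p) \<partial>lborel) \<le> (\<integral>\<^sup>+x. ennreal ((\<mu> - k) powr p) * indicator {x\<in>ball 0 \<rho>. u x > k} x \<partial>lborel)"
  proof (rule nn_integral_mono_AE, use ae in \<open>rule AE_mp\<close>, intro AE_I2 impI)
    fix x assume *: "x \<in> ball 0 \<rho> \<longrightarrow> u x \<le> \<mu>"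
    show "ennreal (max (u x - k) 0 powr p) * indicator (ball 0 \<rho>) x \<le> ennreal ((\<mu> - k) powr p) * indicator {x\<in>ball 0 \<rho>. u x > k} x"
    proof (cases "x \<in> ball 0 \<rho> \<and> u x > k")
      case True
      have "max (u x - k) 0 powr p \<le> (\<mu> - k) powr p"
        using True * assms by (intro powr_mono2) auto
      then show ?thesis using True by (auto intro!: ennreal_leI)
    next
      case False
      then show ?thesis by (auto split: split_indicator)
    qed
  qed
  also have "\<dots> = ennreal ((\<mu> - k) powr p) * emeasure lborel {x\<in>ball 0 \<rho>. u x > k}"
    by (rule nn_integral_cmult_indicator) measurable
  finally have "(\<integral>\<^sup>+x\<in>ball 0 \<rho>1. ennreal (if u x > k then norm (g x) powr p else 0) \<partial>lborel)
      \<le> ennreal (\<gamma> / (\<rho> - \<rho>1) powr p) * (ennreal ((\<mu> - k) powr p) * emeasure lborel {x\<in>ball 0 \<rho>. u x > k})"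
    by (simp add: mult_left_mono)
  also have "\<dots> = ennreal (\<gamma> / (\<rho> - \<rho>1) powr p * (\<mu> - k) powr p) * emeasure lborel {x\<in>ball 0 \<rho>. u x > k}"
    using assms by (subst ennreal_mult) (auto simp: mult.assoc)
  also have "\<gamma> / (\<rho> - \<rho>1) powr p * (\<mu> - k) powr p = \<gamma> * ((\<mu> - k) / (\<rho> - \<rho>1)) powr p"
    using assms by (simp add: powr_divide)
  finally show ?thesis .
qed

lemma wgrad_truncate:
  fixes u :: "real^'n::finite \<Rightarrow> real"
  assumes u: "wgrad u g"
  shows "wgrad (\<lambda>x. max (u x - k) 0) (\<lambda>x. if u x > k then g x else 0)"
  using wgrad_pos_part[OF wgrad_diff[OF u wgrad_const[of k]]] by (simp cong: if_cong)

section \<open>De Giorgi iteration over shrinking balls\<close>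

lemma emeasure_ball_vec:
  "r \<ge> 0 \<Longrightarrow> emeasure lborel (ball (c::real^'n::finite) r) = ennreal (unit_ball_vol (real CARD('n)) * r ^ CARD('n))"
  by (simp add: emeasure_ball)

text \<open>The truncation at \<open>k\<close> is at least \<open>l - k\<close> on the smaller level
  set, so its integral controls the measure. Its support is small, which bounds that integral by
  \<open>2 * h\<close> times the integral of the gradient, and the energy inequality bounds the
  gradient. The gain is the factor \<open>h\<close>, which may be far smaller than
  \<open>r2 - r1\<close>.\<close>

lemma dg_level_step:
  fixes u :: "real^'n::finite \<Rightarrow> real"
  assumes u: "dg_pair p \<gamma> u g" and p: "p > 1" "\<gamma> > 0" and r: "0 < r1" "r1 < r2"
    and kl: "k < l" "l < \<mu>" and ae: "AE x in lborel. x \<in> ball 0 r2 \<longrightarrow> u x \<le> \<mu>"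
    and h: "h > 0" "h \<le> (r2 - r1) / 2"
    and small: "2 * emeasure lborel {x\<in>ball 0 r2. u x > k} \<le> emeasure lborel (ball (0::real^'n) h)"
  shows "ennreal (l - k) * emeasure lborel {x\<in>ball 0 r1. u x > l} \<le> 
     ennreal (4 * h * (1 + \<gamma>) * (\<mu> - k) / (r2 - r1)) * emeasure lborel {x\<in>ball 0 r2. u x > k}"
proof -
  have w: "wgrad u g" using u by (simp add: dg_pair_def)
  have [measurable]: "u \<in> borel_measurable borel" "g \<in> borel_measurable borel" using w by (auto simp: wgrad_def loc_int_def)
  define A where "A = {x\<in>ball 0 r2. u x > k}"
  have [measurable]: "A \<in> sets borel" unfolding A_def by measurable
  \<comment> \<open>\<open>T\<close> is the natural size of a gradient for the height
    \<open>\<mu> - k\<close> over half the gap of the radii; the other half leaves room for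
    translations of length up to \<open>h\<close>. At this threshold both parts of the split
    gradient become multiples of \<open>T\<close>.\<close>
  define T where "T = (\<mu> - k) / ((r2 - r1) / 2)"
  have T: "T > 0" using kl r by (simp add: T_def)
  have mid: "r1 + h < r2" "r2 - (r1 + h) \<ge> (r2 - r1) / 2" using h r by (auto simp: field_simps)
  have "ennreal (l - k) * emeasure lborel {x\<in>ball 0 r1. u x > l} = (\<integral>\<^sup>+x. ennreal (l - k) * indicator {x\<in>ball 0 r1. u x > l} x \<partial>lborel)"
    by (rule nn_integral_cmult_indicator[symmetric]) measurable
  also have "\<dots> \<le> (\<integral>\<^sup>+x\<in>ball 0 r1. ennreal \<bar>max (u x - k) 0\<bar> \<partial>lborel)"
    using kl by (intro nn_integral_mono) (auto split: split_indicator intro!: ennreal_leI)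
  also have "\<dots> \<le> ennreal (2 * h) * (\<integral>\<^sup>+x\<in>ball 0 (r1 + h). ennreal (norm (if u x > k then g x else 0)) \<partial>lborel)"
  proof (rule small_support_bound[OF wgrad_truncate[OF w] h(1)])
    have "emeasure lborel {x \<in> ball 0 (r1 + h). max (u x - k) 0 \<noteq> 0} \<le> emeasure lborel A"
      using mid by (intro emeasure_mono) (auto simp: A_def)
    then have "2 * emeasure lborel {x \<in> ball 0 (r1 + h). max (u x - k) 0 \<noteq> 0} \<le> 2 * emeasure lborel A"
      by (rule mult_left_mono) simp
    then show "2 * emeasure lborel {x \<in> ball 0 (r1 + h). max (u x - k) 0 \<noteq> 0} \<le> emeasure lborel (ball (0::real^'n) h)"
      using small unfolding A_def by order
  qed
  also have "(\<integral>\<^sup>+x\<in>ball 0 (r1 + h). ennreal (norm (if u x > k then g x else 0)) \<partial>lborel) \<le>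
    (\<integral>\<^sup>+x. ennreal T * indicator A x + ennreal (T powr (1 - p)) * (ennreal (if u x > k then norm (g x) powr p else 0) * indicator (ball 0 (r1 + h)) x) \<partial>lborel)"
  proof (rule nn_integral_mono)
    fix x
    show "ennreal (norm (if u x > k then g x else 0)) * indicator (ball 0 (r1 + h)) x \<le> 
      ennreal T * indicator A x + ennreal (T powr (1 - p)) * (ennreal (if u x > k then norm (g x) powr p else 0) * indicator (ball 0 (r1 + h)) x)"
    proof (cases "norm x < r1 + h \<and> u x > k")
      case True
      then have "x \<in> A" using mid by (auto simp: A_def)
      moreover have "ennreal (norm (g x)) \<le> ennreal (T + T powr (1 - p) * norm (g x) powr p)"
        using T p by (intro ennreal_leI le_add_powr) auto
      ultimately show ?thesis using True T by (simp add: ennreal_plus ennreal_mult)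
    next
      case False
      then show ?thesis by (auto split: split_indicator)
    qed
  qed
  also have "\<dots> = ennreal T * emeasure lborel A + ennreal (T powr (1 - p)) * (\<integral>\<^sup>+x\<in>ball 0 (r1 + h). ennreal (if u x > k then norm (g x) powr p else 0) \<partial>lborel)"
    by (simp add: nn_integral_add nn_integral_cmult nn_integral_cmult_indicator)
  also have "(\<integral>\<^sup>+x\<in>ball 0 (r1 + h). ennreal (if u x > k then norm (g x) powr p else 0) \<partial>lborel) \<le>
    ennreal (\<gamma> * ((\<mu> - k) / (r2 - (r1 + h))) powr p) * emeasure lborel A"
    unfolding A_def using r h kl mid p by (intro dg_energy[OF u ae]) auto
  also have "ennreal (\<gamma> * ((\<mu> - k) / (r2 - (r1 + h))) powr p) \<le> ennreal (\<gamma> * T powr p)"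
  proof (intro ennreal_leI mult_left_mono powr_mono2)
    show "(\<mu> - k) / (r2 - (r1 + h)) \<le> T" unfolding T_def using mid r kl by (intro divide_left_mono) (auto intro!: mult_pos_pos)
  qed (use mid kl p in auto)
  finally have "ennreal (l - k) * emeasure lborel {x\<in>ball 0 r1. u x > l} \<le>
     ennreal (2 * h) * (ennreal T * emeasure lborel A + ennreal (T powr (1 - p)) * (ennreal (\<gamma> * T powr p) * emeasure lborel A))"
    by (simp add: add_left_mono mult_left_mono mult_right_mono)
  also have "\<dots> = ennreal (2 * h * (T + T powr (1 - p) * (\<gamma> * T powr p))) * emeasure lborel A"
    using h T p by (simp add: ennreal_mult ennreal_plus distrib_right distrib_left mult.assoc)
  also have "T powr (1 - p) * (\<gamma> * T powr p) = \<gamma> * T"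
    using T by (simp add: mult.left_commute flip: powr_add)
  also have "2 * h * (T + \<gamma> * T) = 2 * h * (1 + \<gamma>) * T" by (simp add: algebra_simps)
  also have "\<dots> = 4 * h * (1 + \<gamma>) * (\<mu> - k) / (r2 - r1)" by (simp add: T_def)
  finally show ?thesis by (simp add: A_def)
qed

text \<open>The radius \<open>h j\<close> shrinks like \<open>(1/4) ^ j\<close> in order to cancel
  two gaps, of levels and of radii, that each shrink like \<open>(1/2) ^ j\<close>. The measure
  therefore drops by the same factor \<open>32 * (1 + \<gamma>) * t\<close> in every step, and
  \<open>t\<close> makes this factor \<open>(1/4) ^ CARD('n)\<close>, the volume ratio of
  consecutive balls of radius \<open>h j\<close>. Thus the smallness condition reproduces
  itself.\<close>

lemma de_giorgi_iteration:
  fixes u :: "real^'n::finite \<Rightarrow> real"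
  assumes u: "dg_pair p \<gamma> u g" and p: "p > 1" "\<gamma> > 0" and r: "0 < r" and K: "K < \<mu>"
    and ae: "AE x in lborel. x \<in> ball 0 (2 * r) \<longrightarrow> u x \<le> \<mu>"
    and t: "t = 1 / (4 ^ CARD('n) * (32 * (1 + \<gamma>)))"
    and small: "2 * emeasure lborel {x\<in>ball 0 (2 * r). u x > K} \<le> emeasure lborel (ball (0::real^'n) (t * r))"
  shows "AE x in lborel. x \<in> ball 0 r \<longrightarrow> u x \<le> (K + \<mu>) / 2"
proof -
  let ?N = "CARD('n)"
  let ?\<omega> = "unit_ball_vol (real ?N)"
  have [measurable]: "u \<in> borel_measurable borel" using u by (simp add: dg_pair_def wgrad_def loc_int_def)
  define H where "H = \<mu> - K"
  define k where "k j = K + H / 2 * (1 - (1/2)^j)" for j :: nat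
  define \<rho> where "\<rho> j = r * (1 + (1/2)^j)" for j :: nat
  define h where "h j = t * r * (1/4)^j" for j :: nat
  define A where "A j = {x\<in>ball 0 (\<rho> j). u x > k j}" for j
  have H: "H > 0" using K by (simp add: H_def)
  have t0: "t > 0" using p t by simp
  have t1: "32 * (1 + \<gamma>) * t = (1/4) ^ ?N"
  proof -
    define c where "c = 32 * (1 + \<gamma>)"
    have "c > 0" using p by (simp add: c_def)
    then show ?thesis unfolding t c_def[symmetric] by (simp add: power_one_over)
  qed
  \<comment> \<open>Guarantees that \<open>h j\<close> is at most half the gap between consecutive
    radii, as \<open>dg_level_step\<close> requires.\<close>
  have "t \<le> 1 / 4"
  proof -
    have "32 * t \<le> 32 * (1 + \<gamma>) * t" using t0 p by simp
    also have "\<dots> \<le> 1" unfolding t1 by (simp add: power_le_one)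
    finally show ?thesis by simp
  qed
  have \<omega>: "?\<omega> > 0" by simp
  have hN: "emeasure lborel (ball (0::real^'n) (h j)) = ennreal (?\<omega> * h j ^ ?N)" for j
    using t0 r by (intro emeasure_ball_vec) (simp add: h_def)
  have step: "emeasure lborel (A (Suc j)) \<le> ennreal ((1/4) ^ ?N) * emeasure lborel (A j)"
    if IH: "2 * emeasure lborel (A j) \<le> emeasure lborel (ball (0::real^'n) (h j))" for j
  proof -
    have kk: "k (Suc j) - k j = H * (1/2)^j / 4" by (simp add: k_def field_simps)
    have \<rho>\<rho>: "\<rho> j - \<rho> (Suc j) = r * (1/2)^j / 2" by (simp add: \<rho>_def field_simps)
    have "ennreal (k (Suc j) - k j) * emeasure lborel {x\<in>ball 0 (\<rho> (Suc j)). u x > k (Suc j)} \<le> 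
     ennreal (4 * h j * (1 + \<gamma>) * (\<mu> - k j) / (\<rho> j - \<rho> (Suc j))) * emeasure lborel {x\<in>ball 0 (\<rho> j). u x > k j}"
    proof (rule dg_level_step[OF u p])
      show "0 < \<rho> (Suc j)" using r by (simp add: \<rho>_def add_pos_pos)
      show "\<rho> (Suc j) < \<rho> j" using \<rho>\<rho> r by (smt (verit) zero_less_power divide_pos_pos mult_pos_pos)
      show "k j < k (Suc j)" using kk H by (smt (verit) zero_less_power divide_pos_pos mult_pos_pos)
      have "k (Suc j) < K + H / 2 * 1" unfolding k_def using H by (intro add_strict_left_mono mult_strict_left_mono) auto
      then show "k (Suc j) < \<mu>" using H by (simp add: H_def field_simps)
      have "\<rho> j \<le> 2 * r" using r by (simp add: \<rho>_def power_le_one)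
      then show "AE x in lborel. x \<in> ball 0 (\<rho> j) \<longrightarrow> u x \<le> \<mu>"
        using ae by (rule_tac AE_mp) (auto intro!: AE_I2)
      show "h j > 0" using t0 r by (simp add: h_def)
      have "t * (1/4)^j \<le> 1/4 * (1/2)^j" using \<open>t \<le> 1/4\<close> t0 by (intro mult_mono power_mono) auto
      then have "r * (t * (1/4)^j) \<le> r * (1/4 * (1/2)^j)" using r by (intro mult_left_mono) auto
      then show "h j \<le> (\<rho> j - \<rho> (Suc j)) / 2" unfolding \<rho>\<rho> by (simp add: h_def mult.commute mult.left_commute)
      show "2 * emeasure lborel {x \<in> ball 0 (\<rho> j). k j < u x} \<le> emeasure lborel (ball (0::real^'n) (h j))"
        using IH by (simp add: A_def)
    qed
    also have "\<dots> \<le> ennreal (4 * h j * (1 + \<gamma>) * H / (\<rho> j - \<rho> (Suc j))) * emeasure lborel (A j)"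
      unfolding A_def
    proof (intro mult_right_mono ennreal_leI divide_right_mono mult_left_mono)
      show "\<mu> - k j \<le> H" using H by (simp add: k_def H_def power_le_one)
      show "0 \<le> \<rho> j - \<rho> (Suc j)" unfolding \<rho>\<rho> using r by simp
      show "0 \<le> 4 * h j * (1 + \<gamma>)" using t0 r p by (simp add: h_def)
    qed simp
    finally have "ennreal (H * (1/2)^j / 4) * emeasure lborel (A (Suc j)) \<le> ennreal (4 * h j * (1 + \<gamma>) * H / (r * (1/2)^j / 2)) * emeasure lborel (A j)"
      unfolding kk \<rho>\<rho> by (simp add: A_def)
    also have "4 * h j * (1 + \<gamma>) * H / (r * (1/2)^j / 2) = (H * (1/2)^j / 4) * (32 * (1 + \<gamma>) * t)"
    proof -
      have "(1/4::real)^j = (1/2)^j * (1/2)^j" by (simp flip: power_mult_distrib)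
      then show ?thesis using r by (simp add: h_def field_simps)
    qed
    also have "ennreal \<dots> = ennreal (H * (1/2)^j / 4) * ennreal ((1/4) ^ ?N)"
      unfolding t1 using H by (intro ennreal_mult) auto
    finally have "ennreal (H * (1/2)^j / 4) * emeasure lborel (A (Suc j)) \<le> ennreal (H * (1/2)^j / 4) * (ennreal ((1/4) ^ ?N) * emeasure lborel (A j))"
      by (simp add: mult.assoc)
    then show ?thesis using H by (subst (asm) ennreal_mult_le_mult_iff) auto
  qed
  have main: "2 * emeasure lborel (A j) \<le> emeasure lborel (ball (0::real^'n) (h j))" for j
  proof (induction j)
    case 0
    then show ?case using small by (simp add: A_def \<rho>_def k_def h_def mult.commute)
  next
    case (Suc j)
    have "2 * emeasure lborel (A (Suc j)) \<le> 2 * (ennreal ((1/4) ^ ?N) * emeasure lborel (A j))"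
      by (intro mult_left_mono step Suc) simp
    also have "\<dots> = ennreal ((1/4) ^ ?N) * (2 * emeasure lborel (A j))" by (simp add: mult_ac)
    also have "\<dots> \<le> ennreal ((1/4) ^ ?N) * emeasure lborel (ball (0::real^'n) (h j))"
      by (intro mult_left_mono Suc) simp
    also have "\<dots> = ennreal ((1/4) ^ ?N * (?\<omega> * h j ^ ?N))"
      unfolding hN using t0 r by (intro ennreal_mult[symmetric]) (auto simp: h_def)
    also have "(1/4) ^ ?N * (?\<omega> * h j ^ ?N) = ?\<omega> * ((1/4) * h j) ^ ?N"
      unfolding power_mult_distrib by (simp only: mult_ac)
    also have "(1/4) * h j = h (Suc j)" by (simp add: h_def)
    finally show ?case by (simp add: hN)
  qed
  \<comment> \<open>The limiting set lies in every \<open>A j\<close>, because levels increase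
    towards the midpoint of \<open>K\<close> and \<open>\<mu>\<close> and radii decrease towards
    \<open>r\<close>. Its measure is below the volumes of balls whose radii tend to 0.\<close>
  define E where "E = {x\<in>ball 0 r. u x > (K + \<mu>) / 2}"
  have [measurable]: "E \<in> sets borel" unfolding E_def by measurable
  have "emeasure lborel E \<le> ennreal (?\<omega> * h j ^ ?N)" for j
  proof -
    have "E \<subseteq> A j"
    proof
      fix x assume x: "x \<in> E"
      have "k j \<le> K + H / 2 * 1" unfolding k_def using H by (intro add_left_mono mult_left_mono) auto
      also have "\<dots> = (K + \<mu>) / 2" by (simp add: H_def field_simps)
      finally have "k j < u x" using x by (simp add: E_def)
      moreover have "r \<le> \<rho> j" using r by (simp add: \<rho>_def)
      ultimately show "x \<in> A j" using x by (simp add: A_def E_def)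
    qed
    moreover have "A j \<in> sets lborel" unfolding A_def by measurable
    ultimately have "emeasure lborel E \<le> emeasure lborel (A j)" by (intro emeasure_mono)
    also have "\<dots> \<le> 2 * emeasure lborel (A j)" by (simp add: mult_2)
    finally show ?thesis using main[of j] by (simp add: hN)
  qed
  moreover have "(\<lambda>j. ennreal (?\<omega> * h j ^ ?N)) \<longlonglongrightarrow> ennreal (?\<omega> * (t * r * 0) ^ ?N)"
    unfolding h_def by (intro tendsto_ennrealI tendsto_intros LIMSEQ_realpow_zero) auto
  ultimately have "emeasure lborel E \<le> ennreal (?\<omega> * (t * r * 0) ^ ?N)"
    by (intro LIMSEQ_le_const) auto
  then have "E \<in> null_sets lborel" by (simp add: null_sets_def power_0_left)
  then have "AE x in lborel. x \<notin> E" by (rule AE_not_in)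
  then show ?thesis by (rule AE_mp) (auto intro!: AE_I2 simp: E_def)
qed

text \<open>For functions vanishing up to capacity zero on \<open>H\<close>, \<open>\<psi>\<close> is a sum of two capacity potentials: outside the set where
  \<open>\<psi> \<ge> 1\<close> the function is small near \<open>H\<close> by quasi-continuity.\<close>

definition cap_vanish :: "real \<Rightarrow> real \<Rightarrow> (real^'n::finite) set \<Rightarrow> (real^'n \<Rightarrow> real) \<Rightarrow> bool" where
  "cap_vanish q R H u \<longleftrightarrow> (\<forall>\<epsilon>::real>0. \<exists>\<psi> h. wgrad \<psi> h \<and> (\<forall>x. \<psi> x \<ge> 0) \<and>
     emeasure lborel {x\<in>ball 0 R. \<psi> x > 1/4} \<le> ennreal \<epsilon> \<and>
     (\<integral>\<^sup>+x\<in>ball 0 R. ennreal (norm (h x) powr q) \<partial>lborel) \<le> ennreal \<epsilon> \<and>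
     (\<forall>\<delta>>0. \<exists>U. open U \<and> H \<subseteq> U \<and> (AE x in lborel. x \<in> U \<longrightarrow> \<psi> x \<ge> 1 \<or> u x < \<delta>)))"

section \<open>Small measure of high level sets\<close>

lemma powr_le_add_powr:
  fixes a T p q :: real
  assumes "a \<ge> 0" "T > 0" "q \<ge> 0" "q \<le> p"
  shows "a powr q \<le> T powr q + T powr (q - p) * a powr p"
proof (cases "a \<le> T")
  case True
  then have "a powr q \<le> T powr q" using assms by (intro powr_mono2) auto
  then show ?thesis using assms by (simp add: add_increasing2)
next
  case False
  then have "a powr q = a powr (q - p) * a powr p" using assms by (simp flip: powr_add)
  also have "\<dots> \<le> T powr (q - p) * a powr p"
    using False assms by (intro mult_right_mono powr_mono2') auto
  also have "\<dots> \<le> T powr q + T powr (q - p) * a powr p" using assms by simp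
  finally show ?thesis .
qed

lemma add_powr_le:
  fixes a b q :: real
  assumes "a \<ge> 0" "b \<ge> 0" "q \<ge> 0"
  shows "(a + b) powr q \<le> 2 powr q * (a powr q + b powr q)"
proof -
  have "(a + b) powr q \<le> (2 * max a b) powr q" using assms by (intro powr_mono2) auto
  also have "\<dots> = 2 powr q * max a b powr q" using assms by (intro powr_mult)
  also have "max a b powr q \<le> a powr q + b powr q" by (auto simp: max_def)
  finally show ?thesis by (simp add: mult_left_mono)
qed

text \<open>The parameters keep the costs apart: \<open>\<tau>\<close> charges the volume of the
  ball, while \<open>T\<close> distributes the remainder between the strip of values and the energy.
  The factor 1/2 on the left is the height of the truncation that survives the correction by the
  potential.\<close>

lemma level_set_poincare:
  fixes u :: "real^'n::finite \<Rightarrow> real" and J :: "'n set"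
  assumes u: "wgrad u g" and cap: "cap_vanish q (2 * R) {x. \<forall>i\<in>J. x $ i = 0} u"
    and kl: "0 \<le> k" "k < l" and pos: "R > 0" "\<tau> > 0" "T > 0" "1 \<le> q" "q \<le> p"
    and m: "m \<ge> 1" "real m * (q - real (card J)) \<ge> q"
  shows "ennreal ((l - k) / 2) * emeasure lborel {x\<in>ball 0 R. u x > l} \<le> 
    ennreal (real m * R) * (ennreal \<tau> * emeasure lborel (ball (0::real^'n) R) + ennreal (\<tau> powr (1 - q) * 2 powr q) *
      (ennreal (T powr q) * emeasure lborel {x\<in>ball 0 (2 * R). k < u x \<and> u x \<le> l} +
       ennreal (T powr (q - p)) * (\<integral>\<^sup>+x\<in>ball 0 (2 * R). ennreal (if u x > k then norm (g x) powr p else 0) \<partial>lborel)))"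
    (is "?lhs \<le> ennreal (real m * R) * (ennreal \<tau> * ?V + ennreal ?C * ?E)")
proof (rule ennreal_le_epsilon)
  fix e :: real assume e: "e > 0"
  define L where "L = l - k"
  have L: "L > 0" using kl by (simp add: L_def)
  \<comment> \<open>\<open>c\<close> collects everything that multiplies \<open>\<epsilon>\<close>:
    the set where \<open>\<psi>\<close> exceeds 1/4, and the gradient of \<open>L * \<psi>\<close>.
    With \<open>\<epsilon> = e / c\<close> the total error is exactly \<open>e\<close>.\<close>
  define c where "c = L / 2 + real m * R * (?C * L powr q)"
  have c: "c > 0" using L pos by (auto simp: c_def intro!: add_pos_nonneg mult_nonneg_nonneg)
  define \<epsilon> where "\<epsilon> = e / c"
  have \<epsilon>: "\<epsilon> > 0" using e c by (simp add: \<epsilon>_def)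
  obtain \<psi> h where \<psi>: "wgrad \<psi> h" "\<And>x. \<psi> x \<ge> 0" "emeasure lborel {x\<in>ball 0 (2 * R). \<psi> x > 1/4} \<le> ennreal \<epsilon>"
     "(\<integral>\<^sup>+x\<in>ball 0 (2 * R). ennreal (norm (h x) powr q) \<partial>lborel) \<le> ennreal \<epsilon>"
     "\<And>\<delta>. \<delta> > 0 \<Longrightarrow> \<exists>U. open U \<and> {x. \<forall>i\<in>J. x $ i = 0} \<subseteq> U \<and> (AE x in lborel. x \<in> U \<longrightarrow> \<psi> x \<ge> 1 \<or> u x < \<delta>)"
    using cap[unfolded cap_vanish_def, rule_format, OF \<epsilon>] by blast
  have [measurable]: "u \<in> borel_measurable borel" "g \<in> borel_measurable borel" "\<psi> \<in> borel_measurable borel" "h \<in> borel_measurable borel"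
    using u \<psi>(1) by (auto simp: wgrad_def loc_int_def)
  define gj where "gj x = (if u x > k then g x else 0) - (if u x > l then g x else 0)" for x
  \<comment> \<open>The constants leave room on both sides. Near the plane, either
    \<open>\<psi> \<ge> 1\<close> and \<open>L * \<psi>\<close> outweighs the truncation, or
    \<open>u < L / 4\<close> and the constant \<open>L / 4\<close> does. Where \<open>u > l\<close>
    and \<open>\<psi> \<le> 1/4\<close>, the two subtractions cost at most \<open>L / 2\<close>, so
    \<open>W \<ge> L / 2\<close> remains.\<close>
  define W where "W x = max (u x - k) 0 - max (u x - l) 0 - L / 4 - L * \<psi> x" for x
  define G where "G x = gj x - L *\<^sub>R h x" for x
  have [measurable]: "gj \<in> borel_measurable borel" unfolding gj_def[abs_def] by measurable
  have W: "wgrad W G"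
    using wgrad_diff[OF wgrad_diff[OF wgrad_diff[OF wgrad_truncate[OF u, of k] wgrad_truncate[OF u, of l]] wgrad_const[of "L/4"]] wgrad_scaleR[OF \<psi>(1), of L]]
    unfolding W_def[abs_def] G_def[abs_def] gj_def[abs_def] by simp
  obtain U where U: "open U" "{x. \<forall>i\<in>J. x $ i = 0} \<subseteq> U" "AE x in lborel. x \<in> U \<longrightarrow> \<psi> x \<ge> 1 \<or> u x < L / 4"
    using \<psi>(5)[of "L/4"] L by auto
  have "AE x in lborel. x \<in> U \<longrightarrow> W x \<le> 0"
    using U(3)
  proof (rule AE_mp, intro AE_I2 impI)
    fix x assume "x \<in> U \<longrightarrow> \<psi> x \<ge> 1 \<or> u x < L / 4" "x \<in> U"
    then consider "\<psi> x \<ge> 1" | "u x < L / 4" by blast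
    then show "W x \<le> 0"
    proof cases
      case 1
      then have "L * \<psi> x \<ge> L * 1" using L by (intro mult_left_mono) auto
      moreover have "max (u x - k) 0 - max (u x - l) 0 \<le> L" using kl by (auto simp: L_def max_def)
      ultimately show ?thesis unfolding W_def using L by linarith
    next
      case 2
      moreover have "L * \<psi> x \<ge> 0" using L \<psi>(2)[of x] by simp
      moreover have "max (u x - l) 0 \<ge> 0" "max (u x - k) 0 \<le> max (u x) 0" using kl by auto
      ultimately show ?thesis unfolding W_def using L by linarith
    qed
  qed
  from plane_poincare[OF W U(1,2) this pos(1,2,4) m]
  have P: "(\<integral>\<^sup>+x\<in>ball 0 R. ennreal (W x) \<partial>lborel) \<le> ennreal (real m * R) * (ennreal \<tau> * ?V + 
      ennreal (\<tau> powr (1 - q)) * (\<integral>\<^sup>+x\<in>ball 0 (2 * R). ennreal (norm (G x) powr q) \<partial>lborel))" .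
  \<comment> \<open>The two truncated gradients cancel above \<open>l\<close>, so only the strip
    contributes. There the exponent drops from \<open>p\<close> to \<open>q\<close> at the threshold
    \<open>T\<close>: small values are paid by the indicator of the strip, large ones by the energy
    above \<open>k\<close>.\<close>
  have gj: "norm (gj x) powr q \<le> T powr q * indicator {x. k < u x \<and> u x \<le> l} x + T powr (q - p) * (if u x > k then norm (g x) powr p else 0)" for x
  proof (cases "k < u x \<and> u x \<le> l")
    case True
    then show ?thesis using powr_le_add_powr[of "norm (g x)" T q p] pos by (auto simp: gj_def)
  next
    case False
    then have "gj x = 0" using kl by (auto simp: gj_def)
    then show ?thesis by simp
  qed
  have "(\<integral>\<^sup>+x\<in>ball 0 (2 * R). ennreal (norm (G x) powr q) \<partial>lborel) \<le> 
    (\<integral>\<^sup>+x. ennreal (2 powr q) * ((ennreal (T powr q) * indicator {x\<in>ball 0 (2 * R). k < u x \<and> u x \<le> l} x +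
       ennreal (T powr (q - p)) * (ennreal (if u x > k then norm (g x) powr p else 0) * indicator (ball 0 (2 * R)) x))
      + ennreal (L powr q) * (ennreal (norm (h x) powr q) * indicator (ball 0 (2 * R)) x)) \<partial>lborel)"
  proof (rule nn_integral_mono)
    fix x
    have "norm (G x) powr q \<le> (norm (gj x) + norm (L *\<^sub>R h x)) powr q"
      unfolding G_def using pos by (intro powr_mono2 norm_triangle_ineq4) auto
    also have "\<dots> \<le> 2 powr q * (norm (gj x) powr q + norm (L *\<^sub>R h x) powr q)"
      using pos by (intro add_powr_le) auto
    also have "norm (L *\<^sub>R h x) powr q = L powr q * norm (h x) powr q" using L by (simp add: powr_mult)
    also have "2 powr q * (norm (gj x) powr q + L powr q * norm (h x) powr q) \<le> 2 powr q * ((T powr q * indicator {x. k < u x \<and> u x \<le> l} x + T powr (q - p) * (if u x > k then norm (g x) powr p else 0)) + L powr q * norm (h x) powr q)"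
      by (intro mult_left_mono add_right_mono gj) simp
    finally have "ennreal (norm (G x) powr q) \<le> ennreal (2 powr q * ((T powr q * indicator {x. k < u x \<and> u x \<le> l} x + T powr (q - p) * (if u x > k then norm (g x) powr p else 0)) + L powr q * norm (h x) powr q))"
      by (rule ennreal_leI)
    also have "\<dots> = ennreal (2 powr q) * ((ennreal (T powr q) * indicator {x. k < u x \<and> u x \<le> l} x +
       ennreal (T powr (q - p)) * ennreal (if u x > k then norm (g x) powr p else 0))
      + ennreal (L powr q) * ennreal (norm (h x) powr q))"
      by (simp add: ennreal_mult ennreal_plus indicator_def)
    finally show "ennreal (norm (G x) powr q) * indicator (ball 0 (2 * R)) x \<le> ennreal (2 powr q) * ((ennreal (T powr q) * indicator {x\<in>ball 0 (2 * R). k < u x \<and> u x \<le> l} x +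
       ennreal (T powr (q - p)) * (ennreal (if u x > k then norm (g x) powr p else 0) * indicator (ball 0 (2 * R)) x))
      + ennreal (L powr q) * (ennreal (norm (h x) powr q) * indicator (ball 0 (2 * R)) x))"
      by (cases "x \<in> ball 0 (2 * R)") (auto simp: indicator_def)
  qed
  also have "\<dots> = ennreal (2 powr q) * (?E + ennreal (L powr q) * (\<integral>\<^sup>+x\<in>ball 0 (2 * R). ennreal (norm (h x) powr q) \<partial>lborel))"
    by (simp add: nn_integral_add nn_integral_cmult nn_integral_cmult_indicator)
  also have "\<dots> \<le> ennreal (2 powr q) * (?E + ennreal (L powr q) * ennreal \<epsilon>)"
    by (intro mult_left_mono add_left_mono \<psi>) auto
  finally have "ennreal (\<tau> powr (1 - q)) * (\<integral>\<^sup>+x\<in>ball 0 (2 * R). ennreal (norm (G x) powr q) \<partial>lborel) \<le> ennreal (\<tau> powr (1 - q)) * (ennreal (2 powr q) * (?E + ennreal (L powr q) * ennreal \<epsilon>))"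
    by (rule mult_left_mono) simp
  also have "\<dots> = ennreal ?C * ?E + ennreal (?C * L powr q * \<epsilon>)"
    using \<epsilon> by (simp add: ennreal_mult distrib_left mult.assoc)
  finally have I: "(\<integral>\<^sup>+x\<in>ball 0 R. ennreal (W x) \<partial>lborel) \<le> ennreal (real m * R) * (ennreal \<tau> * ?V + (ennreal ?C * ?E + ennreal (?C * L powr q * \<epsilon>)))"
    by (intro order_trans[OF P] mult_left_mono add_left_mono) auto
  have "?lhs = (\<integral>\<^sup>+x. ennreal ((l - k) / 2) * indicator {x\<in>ball 0 R. u x > l} x \<partial>lborel)"
    by (rule nn_integral_cmult_indicator[symmetric]) measurable
  also have "\<dots> \<le> (\<integral>\<^sup>+x. ennreal (W x) * indicator (ball 0 R) x + ennreal (L / 2) * indicator {x\<in>ball 0 (2 * R). \<psi> x > 1/4} x \<partial>lborel)"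
  proof (rule nn_integral_mono)
    fix x
    show "ennreal ((l - k) / 2) * indicator {x\<in>ball 0 R. u x > l} x \<le> ennreal (W x) * indicator (ball 0 R) x + ennreal (L / 2) * indicator {x\<in>ball 0 (2 * R). \<psi> x > 1/4} x"
    proof (cases "x \<in> ball 0 R \<and> u x > l")
      case True
      show ?thesis
      proof (cases "\<psi> x > 1/4")
        case True
        then show ?thesis using \<open>x \<in> ball 0 R \<and> u x > l\<close> pos(1) by (auto simp: L_def indicator_def)
      next
        case False
        then have "L * \<psi> x \<le> L * (1/4)" using L by (intro mult_left_mono) auto
        moreover have "max (u x - k) 0 - max (u x - l) 0 = L" using True kl by (simp add: L_def)
        ultimately have "L / 2 \<le> W x" unfolding W_def by linarith
        then have "ennreal ((l - k) / 2) \<le> ennreal (W x)" by (intro ennreal_leI) (simp add: L_def)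
        then show ?thesis using True by (simp add: add_increasing2)
      qed
    next
      case False
      then show ?thesis by (auto split: split_indicator)
    qed
  qed
  also have "\<dots> = (\<integral>\<^sup>+x\<in>ball 0 R. ennreal (W x) \<partial>lborel) + ennreal (L / 2) * emeasure lborel {x\<in>ball 0 (2 * R). \<psi> x > 1/4}"
  proof -
    have "W \<in> borel_measurable borel" using W by (simp add: wgrad_def loc_int_def)
    then show ?thesis by (subst nn_integral_add) (auto simp: nn_integral_cmult_indicator)
  qed
  also have "\<dots> \<le> ennreal (real m * R) * (ennreal \<tau> * ?V + (ennreal ?C * ?E + ennreal (?C * L powr q * \<epsilon>))) + ennreal (L / 2) * ennreal \<epsilon>"
    by (intro add_mono I mult_left_mono \<psi>) auto
  also have "\<dots> = ennreal (real m * R) * (ennreal \<tau> * ?V + ennreal ?C * ?E) + ennreal (real m * R * (?C * L powr q * \<epsilon>) + L / 2 * \<epsilon>)"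
  proof -
    have gen: "ennreal a * (X + (Y + ennreal b)) + ennreal b' * ennreal \<epsilon> = ennreal a * (X + Y) + ennreal (a * b + b' * \<epsilon>)"
      if "a \<ge> 0" "b \<ge> 0" "b' \<ge> 0" for a b b' X Y
    proof -
      have "ennreal (a * b + b' * \<epsilon>) = ennreal a * ennreal b + ennreal b' * ennreal \<epsilon>"
        using that \<epsilon> by (simp add: ennreal_mult ennreal_plus)
      then show ?thesis by (simp only: distrib_left add.assoc)
    qed
    show ?thesis by (rule gen) (use pos L \<epsilon> in auto)
  qed
  also have "real m * R * (?C * L powr q * \<epsilon>) + L / 2 * \<epsilon> = c * \<epsilon>" by (simp add: c_def algebra_simps)
  also have "c * \<epsilon> = e" using c by (simp add: \<epsilon>_def)
  finally show "?lhs \<le> ennreal (real m * R) * (ennreal \<tau> * ?V + ennreal ?C * ?E) + ennreal e" .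
qed


text \<open>Averaging over the first \<open>n\<close> dyadic levels provides a strip with at most a
  fraction \<open>1 / n\<close> of the ball, and the level set at \<open>n\<close> is contained in
  the one just above that strip. The radii are \<open>R\<close> for the level set,
  \<open>2 * R\<close> for the Poincare inequality and \<open>4 * R\<close> for the energy
  inequality.\<close>

lemma level_set_shrink:
  fixes u :: "real^'n::finite \<Rightarrow> real" and J :: "'n set"
  defines "N \<equiv> CARD('n)"
  defines "\<omega> \<equiv> unit_ball_vol (real N)"
  assumes u: "dg_pair p \<gamma> u g" and cap: "cap_vanish q (2 * R) {x. \<forall>i\<in>J. x $ i = 0} u"
    and p: "p > 1" "\<gamma> > 0" "1 \<le> q" "q \<le> p" and R: "R > 0" and \<mu>: "\<mu> > 0"
    and ae: "AE x in lborel. x \<in> ball 0 (4 * R) \<longrightarrow> u x \<le> \<mu>"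
    and m: "m \<ge> 1" "real m * (q - real (card J)) \<ge> q"
    and c: "\<kappa> > 0" "\<theta> > 0" "n \<ge> 1"
  shows "measure lborel {x\<in>ball 0 R. u x > \<mu> * (1 - (1/2)^n)} \<le>
    2 * real m * (\<kappa> * \<omega> + \<kappa> powr (1 - q) * 2 powr q * (\<theta> powr q * (\<omega> * 2 ^ N / real n) + \<theta> powr (q - p) * (\<gamma> * \<omega> * 4 ^ N))) * R ^ N"
proof -
  have w: "wgrad u g" using u by (simp add: dg_pair_def)
  have [measurable]: "u \<in> borel_measurable borel" "g \<in> borel_measurable borel" using w by (auto simp: wgrad_def loc_int_def)
  have \<omega>: "\<omega> > 0" by (simp add: \<omega>_def)
  define k where "k j = \<mu> * (1 - (1/2)^j)" for j :: nat
  define a where "a r j = measure lborel {x\<in>ball 0 r. u x > k j}" for r j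
  have fin: "emeasure lborel {x\<in>ball (0::real^'n) r. P x} < \<infinity>" if "{x\<in>ball 0 r. P x} \<in> sets borel" for r P
    by (rule le_less_trans[OF emeasure_mono emeasure_lborel_ball_finite[of "0::real^'n" r]]) auto
  have em: "emeasure lborel {x\<in>ball 0 r. u x > k j} = ennreal (a r j)" for r j
    unfolding a_def using fin[of r "\<lambda>x. u x > k j"] by (intro emeasure_eq_ennreal_measure) auto
  have vol: "measure lborel (ball (0::real^'n) r) = \<omega> * r ^ N" if "r \<ge> 0" for r
    using emeasure_ball_vec[OF that, of "0::real^'n"] that by (simp add: measure_def \<omega>_def N_def)
  have a_le: "a r j \<le> \<omega> * r ^ N" if "r \<ge> 0" for r j
    unfolding a_def vol[OF that, symmetric] using emeasure_lborel_ball_finite[of "0::real^'n" r] 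
    by (intro measure_mono_fmeasurable) (auto simp: fmeasurable_def)
  have k_mono: "k i \<le> k j" if "i \<le> j" for i j
    unfolding k_def using \<mu> that by (intro mult_left_mono) (auto simp: power_decreasing)
  have a_mono: "a R j \<le> a R i" if "i \<le> j" for i j
  proof -
    have "{x\<in>ball 0 R. u x > k i} \<in> fmeasurable lborel" using fin[of R "\<lambda>x. u x > k i"] by (simp add: fmeasurable_def)
    moreover have "{x\<in>ball 0 R. u x > k j} \<subseteq> {x\<in>ball 0 R. u x > k i}" using k_mono[OF that] by auto
    ultimately show ?thesis unfolding a_def by (intro measure_mono_fmeasurable) auto
  qed
  \<comment> \<open>\<open>D\<close> is the average share of \<open>n\<close> disjoint strips in the
    ball of radius \<open>2 * R\<close>. If every strip exceeded it, the telescoping sum would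
    exceed the volume of the ball.\<close>
  define D where "D = \<omega> * 2 ^ N * R ^ N / real n"
  have "\<exists>j<n. a (2 * R) j - a (2 * R) (Suc j) \<le> D"
  proof (rule ccontr)
    assume "\<not> ?thesis"
    then have "(\<Sum>j<n. D) < (\<Sum>j<n. a (2 * R) j - a (2 * R) (Suc j))"
      using c(3) by (intro sum_strict_mono) (auto simp: not_le lessThan_empty_iff)
    also have "\<dots> = a (2 * R) 0 - a (2 * R) n" by (rule sum_lessThan_telescope')
    also have "\<dots> \<le> \<omega> * (2 * R) ^ N" using a_le[of "2 * R" 0] R measure_nonneg[of lborel "{x\<in>ball 0 (2 * R). u x > k n}"]
      unfolding a_def by linarith
    finally show False using c(3) by (simp add: D_def power_mult_distrib)
  qed
  then obtain j where j: "j < n" "a (2 * R) j - a (2 * R) (Suc j) \<le> D" by blast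
  define L where "L = k (Suc j) - k j"
  \<comment> \<open>For dyadic levels the distance from \<open>k j\<close> to \<open>\<mu>\<close>
    is twice the height of the strip, so the energy inequality between the radii
    \<open>2 * R\<close> and \<open>4 * R\<close> produces exactly \<open>L / R\<close>.\<close>
  have L: "L > 0" "\<mu> - k j = 2 * L" using \<mu> by (auto simp: L_def k_def field_simps)
  \<comment> \<open>Gradients are measured in units of \<open>L / R\<close>. With
    \<open>\<tau> = \<kappa> * e\<close> and \<open>T = \<theta> * e\<close> all powers of
    \<open>e\<close> combine into a single factor \<open>e\<close>, and \<open>R * e = L\<close>
    cancels against the left side; this makes the final bound independent of \<open>\<mu>\<close>
    and leaves only \<open>R ^ N\<close>.\<close>
  define e where "e = L / R"
  have e: "e > 0" using L R by (simp add: e_def)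
  have kj: "0 \<le> k j" "k j < k (Suc j)" "k j < \<mu>" using L \<mu> by (auto simp: k_def power_le_one L_def)
  define Q where "Q = \<kappa> powr (1 - q) * 2 powr q"
  define E where "E = \<theta> powr q * D + \<theta> powr (q - p) * (\<gamma> * \<omega> * 4 ^ N * R ^ N)"
  have nn: "D \<ge> 0" "Q \<ge> 0" "E \<ge> 0" using \<omega> R p by (auto simp: D_def Q_def E_def)
  have "{x\<in>ball 0 (2 * R). k j < u x \<and> u x \<le> k (Suc j)} = {x\<in>ball 0 (2 * R). u x > k j} - {x\<in>ball 0 (2 * R). u x > k (Suc j)}"
    by auto
  moreover have "emeasure lborel ({x\<in>ball 0 (2 * R). u x > k j} - {x\<in>ball 0 (2 * R). u x > k (Suc j)}) = 
      emeasure lborel {x\<in>ball 0 (2 * R). u x > k j} - emeasure lborel {x\<in>ball 0 (2 * R). u x > k (Suc j)}"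
  proof (rule emeasure_Diff)
    show "emeasure lborel {x\<in>ball 0 (2 * R). u x > k (Suc j)} \<noteq> \<infinity>" unfolding em by simp
  qed (use k_mono[of j "Suc j"] in auto)
  ultimately have S: "emeasure lborel {x\<in>ball 0 (2 * R). k j < u x \<and> u x \<le> k (Suc j)} = ennreal (a (2 * R) j - a (2 * R) (Suc j))"
    unfolding em by (simp add: ennreal_minus a_def)
  have en: "(\<integral>\<^sup>+x\<in>ball 0 (2 * R). ennreal (if u x > k j then norm (g x) powr p else 0) \<partial>lborel) \<le> ennreal (\<gamma> * e powr p * (\<omega> * (4 * R) ^ N))"
  proof -
    have "(\<integral>\<^sup>+x\<in>ball 0 (2 * R). ennreal (if u x > k j then norm (g x) powr p else 0) \<partial>lborel) \<le> 
      ennreal (\<gamma> * ((\<mu> - k j) / (4 * R - 2 * R)) powr p) * emeasure lborel {x\<in>ball 0 (4 * R). u x > k j}"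
      by (rule dg_energy[OF u ae]) (use R p kj in auto)
    also have "(\<mu> - k j) / (4 * R - 2 * R) = e" using L(2) by (simp add: e_def)
    also have "ennreal (\<gamma> * e powr p) * emeasure lborel {x\<in>ball 0 (4 * R). u x > k j} \<le> ennreal (\<gamma> * e powr p) * ennreal (\<omega> * (4 * R) ^ N)"
      unfolding em using R by (intro mult_left_mono ennreal_leI a_le) auto
    also have "\<dots> = ennreal (\<gamma> * e powr p * (\<omega> * (4 * R) ^ N))"
      using p by (intro ennreal_mult[symmetric]) (use \<omega> R in auto)
    finally show ?thesis .
  qed
  have "ennreal ((k (Suc j) - k j) / 2) * emeasure lborel {x\<in>ball 0 R. u x > k (Suc j)} \<le>
    ennreal (real m * R) * (ennreal (\<kappa> * e) * emeasure lborel (ball (0::real^'n) R) + ennreal ((\<kappa> * e) powr (1 - q) * 2 powr q) *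
      (ennreal ((\<theta> * e) powr q) * emeasure lborel {x\<in>ball 0 (2 * R). k j < u x \<and> u x \<le> k (Suc j)} +
       ennreal ((\<theta> * e) powr (q - p)) * (\<integral>\<^sup>+x\<in>ball 0 (2 * R). ennreal (if u x > k j then norm (g x) powr p else 0) \<partial>lborel)))"
    by (rule level_set_poincare[OF w cap kj(1,2) R _ _ p(3,4) m]) (use c e in auto)
  also have "\<dots> \<le> ennreal (real m * R) * (ennreal (\<kappa> * e) * ennreal (\<omega> * R ^ N) + ennreal ((\<kappa> * e) powr (1 - q) * 2 powr q) *
      (ennreal ((\<theta> * e) powr q) * ennreal D +
       ennreal ((\<theta> * e) powr (q - p)) * ennreal (\<gamma> * e powr p * (\<omega> * (4 * R) ^ N))))"
    unfolding S using emeasure_ball_vec[of R "0::real^'n"] R j(2)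
    by (intro mult_left_mono add_mono en ennreal_leI) (auto simp: \<omega>_def N_def)
  also have "\<dots> = ennreal (real m * R * (\<kappa> * e * (\<omega> * R ^ N) + (\<kappa> * e) powr (1 - q) * 2 powr q * ((\<theta> * e) powr q * D + (\<theta> * e) powr (q - p) * (\<gamma> * e powr p * (\<omega> * (4 * R) ^ N)))))"
    using c e \<omega> R p nn by (simp add: ennreal_mult ennreal_plus)
  also have "real m * R * (\<kappa> * e * (\<omega> * R ^ N) + (\<kappa> * e) powr (1 - q) * 2 powr q * ((\<theta> * e) powr q * D + (\<theta> * e) powr (q - p) * (\<gamma> * e powr p * (\<omega> * (4 * R) ^ N))))
     = real m * L * (\<kappa> * \<omega> * R ^ N + Q * E)"
  proof -
    have f1: "(\<theta> * e) powr q * D + (\<theta> * e) powr (q - p) * (\<gamma> * e powr p * (\<omega> * (4 * R) ^ N)) = e powr q * E"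
    proof -
      have "e powr p * e powr (q - p) = e powr q" using e by (simp flip: powr_add)
      then have "(\<theta> * e) powr (q - p) * (\<gamma> * e powr p * (\<omega> * (4 * R) ^ N)) = e powr q * (\<theta> powr (q - p) * (\<gamma> * \<omega> * 4 ^ N * R ^ N))"
        using c e by (simp add: powr_mult power_mult_distrib mult.assoc mult.left_commute)
      then show ?thesis using c e by (simp add: E_def powr_mult algebra_simps)
    qed
    have f2: "(\<kappa> * e) powr (1 - q) * 2 powr q * (e powr q * E) = e * (Q * E)"
    proof -
      have "e powr q * e powr (1 - q) = e" using e by (simp flip: powr_add)
      then show ?thesis using c e by (simp add: Q_def powr_mult mult.assoc mult.left_commute)
    qed
    have f3: "L = R * e" using R by (simp add: e_def)
    show ?thesis unfolding f1 f2 unfolding f3 by (simp add: algebra_simps)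
  qed
  finally have "ennreal (L / 2 * a R (Suc j)) \<le> ennreal (real m * L * (\<kappa> * \<omega> * R ^ N + Q * E))"
    using L(1) unfolding em L_def[symmetric] by (subst ennreal_mult) (auto simp: a_def)
  then have "L / 2 * a R (Suc j) \<le> real m * L * (\<kappa> * \<omega> * R ^ N + Q * E)"
    using L c \<omega> R nn by (subst (asm) ennreal_le_iff) auto
  then have "L * a R (Suc j) \<le> L * (2 * real m * (\<kappa> * \<omega> * R ^ N + Q * E))" by (simp add: algebra_simps)
  then have "a R (Suc j) \<le> 2 * real m * (\<kappa> * \<omega> * R ^ N + Q * E)" using L(1) by simp
  moreover have "a R n \<le> a R (Suc j)" using j(1) by (intro a_mono) auto
  moreover have "\<kappa> * \<omega> * R ^ N + Q * E = (\<kappa> * \<omega> + \<kappa> powr (1 - q) * 2 powr q * (\<theta> powr q * (\<omega> * 2 ^ N / real n) + \<theta> powr (q - p) * (\<gamma> * \<omega> * 4 ^ N))) * R ^ N"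
    by (simp add: Q_def E_def D_def algebra_simps)
  ultimately show ?thesis by (simp add: a_def k_def mult.assoc)
qed

text \<open>The three terms are made at most \<open>\<nu> / 3\<close> one after the other:
  \<open>\<kappa>\<close> handles the volume, \<open>\<theta>\<close> the energy and
  \<open>n\<close> the strip. The order matters, as the earlier constants enter the later terms. The
  energy term can be made small because \<open>q < p\<close> gives \<open>\<theta>\<close> a
  negative exponent there.\<close>

lemma shrink_constants:
  fixes \<nu> q p \<gamma> \<omega> m :: real
  assumes "\<nu> > 0" "q < p" "\<gamma> > 0" "\<omega> > 0" "m > 0"
  obtains \<kappa> \<theta> :: real and n :: nat where "\<kappa> > 0" "\<theta> > 0" "n \<ge> 1"
    "2 * m * (\<kappa> * \<omega> + \<kappa> powr (1 - q) * 2 powr q * (\<theta> powr q * (\<omega> * 2 ^ N / real n) + \<theta> powr (q - p) * (\<gamma> * \<omega> * 4 ^ N))) \<le> \<nu>"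
proof -
  define \<kappa> where "\<kappa> = \<nu> / (6 * m * \<omega>)"
  have \<kappa>: "\<kappa> > 0" using assms by (simp add: \<kappa>_def)
  define Q where "Q = 2 * m * (\<kappa> powr (1 - q) * 2 powr q)"
  have Q: "Q > 0" using assms \<kappa> by (simp add: Q_def)
  define C where "C = Q * (\<gamma> * \<omega> * 4 ^ N)"
  have C: "C > 0" using assms Q by (simp add: C_def)
  define \<theta> where "\<theta> = (\<nu> / (3 * C)) powr (1 / (q - p))"
  have \<theta>: "\<theta> > 0" using assms C by (simp add: \<theta>_def)
  have \<theta>2: "\<theta> powr (q - p) = \<nu> / (3 * C)" using assms C by (simp add: \<theta>_def powr_powr)
  define B where "B = Q * (\<theta> powr q * (\<omega> * 2 ^ N))"
  have B: "B > 0" using Q \<theta> assms by (simp add: B_def)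
  obtain n where n: "3 * B / \<nu> \<le> real n" using real_arch_simple by blast
  then have "0 < real n" using B assms(1) by (smt (verit) divide_pos_pos mult_pos_pos)
  then have n1: "n \<ge> 1" by simp
  let ?c = "2 * m * (\<kappa> * \<omega> + \<kappa> powr (1 - q) * 2 powr q * (\<theta> powr q * (\<omega> * 2 ^ N / real n) + \<theta> powr (q - p) * (\<gamma> * \<omega> * 4 ^ N)))"
  have "B / real n \<le> \<nu> / 3" using n assms(1) \<open>0 < real n\<close> by (simp add: field_simps)
  moreover have "2 * m * (\<kappa> * \<omega>) = \<nu> / 3" using assms by (simp add: \<kappa>_def)
  moreover have "C * \<theta> powr (q - p) = \<nu> / 3" using C by (simp add: \<theta>2)
  moreover have "?c
    = 2 * m * (\<kappa> * \<omega>) + B / real n + C * \<theta> powr (q - p)"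
    by (simp add: B_def C_def Q_def algebra_simps add_divide_distrib)
  ultimately have "?c \<le> \<nu>"
    by linarith
  then show ?thesis using that[OF \<kappa> \<theta> n1] by blast
qed

text \<open>The level set is made small with \<open>R = 2 * r\<close>, for which the energy
  inequality reaches out to \<open>8 * r\<close>; the iteration then passes from
  \<open>2 * r\<close> to \<open>r\<close>. All constants are fixed before \<open>u\<close>,
  \<open>r\<close> and \<open>\<mu>\<close>, so \<open>\<eta>\<close> depends only on the
  data.\<close>

lemma dg_decay:
  fixes J :: "'n::finite set"
  assumes p: "p > 1" "\<gamma> > 0" "1 \<le> q" "q < p" "real (card J) < q"
  obtains \<eta> :: real where "0 < \<eta>" "\<eta> < 1"
    "\<And>(u :: real^'n \<Rightarrow> real) g r \<mu>. dg_pair p \<gamma> u g \<Longrightarrow> (\<And>R. cap_vanish q R {x. \<forall>i\<in>J. x $ i = 0} u) \<Longrightarrow> r > 0 \<Longrightarrow> \<mu> > 0 \<Longrightarrow>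
      AE x in lborel. x \<in> ball 0 (8 * r) \<longrightarrow> u x \<le> \<mu> \<Longrightarrow> AE x in lborel. x \<in> ball 0 r \<longrightarrow> u x \<le> \<eta> * \<mu>"
proof -
  let ?N = "CARD('n)"
  define \<omega> where "\<omega> = unit_ball_vol (real ?N)"
  have \<omega>: "\<omega> > 0" by (simp add: \<omega>_def)
  obtain m where m0: "q / (q - real (card J)) \<le> real m" using real_arch_simple by blast
  then have m2: "real m * (q - real (card J)) \<ge> q" using p by (simp add: field_simps)
  have "0 < q / (q - real (card J))" using p by simp
  with m0 have m1: "m \<ge> 1" by linarith
  define t where "t = 1 / (4 ^ ?N * (32 * (1 + \<gamma>)))"
  have t: "t > 0" using p by (simp add: t_def)
  \<comment> \<open>Chosen so that \<open>\<nu> * (2 * r) ^ CARD('n)\<close> is half the volume of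
    the ball of radius \<open>t * r\<close>, which is the smallness that the iteration
    demands.\<close>
  define \<nu> where "\<nu> = \<omega> * t ^ ?N / (2 * 2 ^ ?N)"
  have \<nu>: "\<nu> > 0" using \<omega> t by (simp add: \<nu>_def)
  have "real m > 0" using m1 by simp
  from shrink_constants[OF \<nu> p(4,2) \<omega> this, of ?N] obtain \<kappa> \<theta> :: real and n :: nat where c: "\<kappa> > 0" "\<theta> > 0" "n \<ge> 1"
    "2 * real m * (\<kappa> * \<omega> + \<kappa> powr (1 - q) * 2 powr q * (\<theta> powr q * (\<omega> * 2 ^ ?N / real n) + \<theta> powr (q - p) * (\<gamma> * \<omega> * 4 ^ ?N))) \<le> \<nu>"
    by blast
  \<comment> \<open>The starting level is \<open>\<mu> * (1 - (1/2) ^ n)\<close>. The iteration ends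
    midway between it and \<open>\<mu>\<close>, which halves the gap once more and explains the
    successor.\<close>
  define \<eta> :: real where "\<eta> = 1 - (1/2) ^ Suc n"
  have "(1/2::real) ^ Suc n < 1" by (rule power_Suc_less_one) auto
  then have \<eta>: "0 < \<eta>" "\<eta> < 1" by (auto simp: \<eta>_def)
  show ?thesis
  proof (rule that[OF \<eta>])
    fix u :: "real^'n \<Rightarrow> real" and g r \<mu>
    assume u: "dg_pair p \<gamma> u g" and cap: "\<And>R. cap_vanish q R {x. \<forall>i\<in>J. x $ i = 0} u" and r: "r > 0" and \<mu>: "\<mu> > 0"
      and ae: "AE x in lborel. x \<in> ball 0 (8 * r) \<longrightarrow> u x \<le> \<mu>"
    have [measurable]: "u \<in> borel_measurable borel" using u by (simp add: dg_pair_def wgrad_def loc_int_def)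
    define K where "K = \<mu> * (1 - (1/2)^n)"
    have K: "K < \<mu>" using \<mu> by (simp add: K_def)
    have "measure lborel {x\<in>ball 0 (2 * r). u x > K} \<le> 
      2 * real m * (\<kappa> * \<omega> + \<kappa> powr (1 - q) * 2 powr q * (\<theta> powr q * (\<omega> * 2 ^ ?N / real n) + \<theta> powr (q - p) * (\<gamma> * \<omega> * 4 ^ ?N))) * (2 * r) ^ ?N"
      unfolding K_def \<omega>_def
      by (rule level_set_shrink[OF u cap p(1,2,3) less_imp_le[OF p(4)] _ \<mu> _ m1 m2 c(1-3)]) (use r ae in auto)
    also have "\<dots> \<le> \<nu> * (2 * r) ^ ?N" using r by (intro mult_right_mono c) auto
    finally have A: "measure lborel {x\<in>ball 0 (2 * r). u x > K} \<le> \<omega> * (t * r) ^ ?N / 2"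
      by (simp add: \<nu>_def power_mult_distrib mult.assoc)
    have "AE x in lborel. x \<in> ball 0 r \<longrightarrow> u x \<le> (K + \<mu>) / 2"
    proof (rule de_giorgi_iteration[OF u p(1,2) r K _ t_def])
      show "AE x in lborel. x \<in> ball 0 (2 * r) \<longrightarrow> u x \<le> \<mu>"
        using ae r by (rule_tac AE_mp) (auto intro!: AE_I2)
      have "emeasure lborel {x\<in>ball 0 (2 * r). u x > K} \<le> emeasure lborel (ball (0::real^'n) (2 * r))"
        by (intro emeasure_mono) auto
      also have "\<dots> < \<infinity>" by (rule emeasure_lborel_ball_finite)
      finally have "emeasure lborel {x\<in>ball 0 (2 * r). u x > K} = ennreal (measure lborel {x\<in>ball 0 (2 * r). u x > K})"
        by (intro emeasure_eq_ennreal_measure) auto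
      also have "2 * \<dots> = ennreal (2 * measure lborel {x\<in>ball 0 (2 * r). u x > K})" by (simp add: ennreal_mult)
      also have "\<dots> \<le> ennreal (\<omega> * (t * r) ^ ?N)" using A by (intro ennreal_leI) simp
      also have "\<dots> = emeasure lborel (ball (0::real^'n) (t * r))"
        using t r by (simp add: emeasure_ball_vec \<omega>_def)
      finally show "2 * emeasure lborel {x\<in>ball 0 (2 * r). u x > K} \<le> emeasure lborel (ball (0::real^'n) (t * r))" .
    qed
    moreover have "(K + \<mu>) / 2 = \<eta> * \<mu>" by (simp add: K_def \<eta>_def field_simps)
    ultimately show "AE x in lborel. x \<in> ball 0 r \<longrightarrow> u x \<le> \<eta> * \<mu>" by simp
  qed
qed

section \<open>Capacity\<close>

lemma nn_integral_lebesgue_lborel_cong: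
  assumes "AE x in lborel. f x = g x"
  shows "(\<integral>\<^sup>+x. f x \<partial>lebesgue) = (\<integral>\<^sup>+x. g x \<partial>lborel)"
  unfolding nn_integral_completion by (rule nn_integral_cong_AE[OF assms])

text \<open>A value below the bound is attained by some admissible function. Its positive part still
  has the lower bound 1 on \<open>U\<close>, and neither its size nor its gradient grows, so both
  integrals stay below \<open>\<epsilon>\<close>.\<close>

lemma p_cap_potential:
  fixes E :: "(real^'n::finite) set"
  assumes "p_cap p E < ennreal \<epsilon>" "p > 0"
  obtains \<phi> h U where "wgrad \<phi> h" "\<And>x. \<phi> x \<ge> 0" 
    "(\<integral>\<^sup>+x. ennreal (\<phi> x powr p) \<partial>lborel) \<le> ennreal \<epsilon>" "(\<integral>\<^sup>+x. ennreal (norm (h x) powr p) \<partial>lborel) \<le> ennreal \<epsilon>"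
    "open U" "E \<subseteq> U" "AE x in lborel. x \<in> U \<longrightarrow> \<phi> x \<ge> 1"
proof -
  obtain \<phi> g U where *: "(\<integral>\<^sup>+ x. ennreal (\<bar>\<phi> x\<bar> powr p + norm (g x) powr p) \<partial>lebesgue) < ennreal \<epsilon>"
      "weak_grad \<phi> g" "Lp p \<phi>" "open U" "E \<subseteq> U" "AE x in lebesgue. x \<in> U \<longrightarrow> \<phi> x \<ge> 1"
    using assms(1) unfolding p_cap_def Inf_less_iff by blast
  have "\<phi> \<in> borel_measurable lebesgue" using *(3) by (simp add: Lp_def)
  then obtain \<phi>' where \<phi>': "\<phi>' \<in> borel_measurable lborel" "AE x in lborel. \<phi> x = \<phi>' x"
    using completion_ex_borel_measurable_real by blast
  have \<phi>'ae: "AE x in lborel. \<phi>' x = \<phi> x" using \<phi>'(2) by (rule AE_mp) (auto intro!: AE_I2)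
  obtain h where h: "wgrad \<phi>' h" "AE x in lborel. h x = g x"
    by (rule weak_grad_wgrad[OF *(2) _ \<phi>'ae]) (use \<phi>'(1) in auto)
  define \<psi> where "\<psi> x = max (\<phi>' x) 0" for x
  define k where "k x = (if \<phi>' x > 0 then h x else 0)" for x
  have w: "wgrad \<psi> k" unfolding \<psi>_def[abs_def] k_def[abs_def] by (rule wgrad_pos_part[OF h(1)])
  have "(\<integral>\<^sup>+ x. ennreal (\<bar>\<phi> x\<bar> powr p + norm (g x) powr p) \<partial>lebesgue) = (\<integral>\<^sup>+ x. ennreal (\<bar>\<phi>' x\<bar> powr p + norm (h x) powr p) \<partial>lborel)"
    by (rule nn_integral_lebesgue_lborel_cong, use \<phi>'(2) in \<open>rule AE_mp\<close>, use h(2) in \<open>rule AE_mp\<close>) auto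
  then have e: "(\<integral>\<^sup>+ x. ennreal (\<bar>\<phi>' x\<bar> powr p + norm (h x) powr p) \<partial>lborel) \<le> ennreal \<epsilon>" using *(1) by simp
  have le: "\<psi> x powr p \<le> \<bar>\<phi>' x\<bar> powr p" "norm (k x) powr p \<le> norm (h x) powr p" for x
    using assms(2) by (auto simp: \<psi>_def k_def max_def)
  have "\<psi> x powr p \<le> \<bar>\<phi>' x\<bar> powr p + norm (h x) powr p" "norm (k x) powr p \<le> \<bar>\<phi>' x\<bar> powr p + norm (h x) powr p" for x
    using le[of x] by (auto intro: add_increasing add_increasing2)
  then have "(\<integral>\<^sup>+x. ennreal (\<psi> x powr p) \<partial>lborel) \<le> ennreal \<epsilon>" "(\<integral>\<^sup>+x. ennreal (norm (k x) powr p) \<partial>lborel) \<le> ennreal \<epsilon>"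
    by (auto intro!: order_trans[OF nn_integral_mono e] ennreal_leI)
  moreover have "AE x in lborel. x \<in> U \<longrightarrow> \<psi> x \<ge> 1"
    using *(6)[unfolded AE_lebesgue_iff] by (rule AE_mp, use \<phi>'(2) in \<open>rule AE_mp\<close>) (auto intro!: AE_I2 simp: \<psi>_def)
  ultimately show ?thesis using that[OF w _ _ _ *(4,5)] by (simp add: \<psi>_def)
qed

text \<open>One potential covers the open exceptional set \<open>G\<close> of quasi-continuity, the
  other the points of \<open>H\<close> where the representative is nonzero. At any remaining point
  of \<open>H\<close> the representative is 0 and continuous relative to the complement of
  \<open>G\<close>, hence below \<open>\<delta>\<close> nearby outside \<open>G\<close>. Only the
  neighbourhood depends on \<open>\<delta>\<close>, not the potentials.\<close>

lemma vanishes_on_cap_vanish: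
  fixes u u' :: "real^'n::finite \<Rightarrow> real"
  assumes u: "vanishes_on p u H" and ae: "AE x in lborel. u x = u' x" and q: "1 \<le> q" "q < p"
  shows "cap_vanish q R H u'"
  unfolding cap_vanish_def
proof (intro allI impI)
  fix \<epsilon> :: real assume \<epsilon>: "\<epsilon> > 0"
  have p: "p > 0" using q by simp
  obtain v where v: "AE x in lebesgue. v x = u x" "quasi_continuous p v" "p_cap p {x \<in> H. v x \<noteq> 0} = 0"
    using u unfolding vanishes_on_def by blast
  define V where "V = measure lborel (ball (0::real^'n) R)"
  have V: "emeasure lborel (ball (0::real^'n) R) = ennreal V" 
    unfolding V_def using emeasure_lborel_ball_finite[of "0::real^'n" R] by (intro emeasure_eq_ennreal_measure) auto
  have V0: "V \<ge> 0" by (simp add: V_def)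
  \<comment> \<open>The gradient bound is known at exponent \<open>p\<close> but wanted at
    \<open>q\<close>. The threshold \<open>t\<close> makes the constant part of the splitting cost
    at most \<open>\<epsilon> / 2\<close> on the ball; \<open>V + 1\<close> covers the case of an
    empty ball.\<close>
  define t where "t = (\<epsilon> / (2 * (V + 1))) powr (1 / q)"
  have t: "t > 0" using \<epsilon> V0 by (simp add: t_def add_nonneg_pos)
  have "t powr q = \<epsilon> / (2 * (V + 1))" using \<epsilon> V0 q by (simp add: t_def powr_powr add_nonneg_pos)
  then have "t powr q * (V + 1) = \<epsilon> / 2" using V0 by (simp add: field_simps)
  moreover have "t powr q * V \<le> t powr q * (V + 1)" by (intro mult_left_mono) auto
  ultimately have tq: "t powr q * V \<le> \<epsilon> / 2" by simp
  \<comment> \<open>\<open>c\<close> dominates both uses of the potentials: the factor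
    \<open>4 powr p\<close> from Chebyshev's inequality at height 1/4, and the factor
    \<open>t powr (q - p)\<close> from lowering the exponent.\<close>
  define c where "c = 2 * 2 powr p * (4 powr p + t powr (q - p))"
  have c: "c > 0" unfolding c_def using t by (intro mult_pos_pos add_pos_pos) auto
  define e where "e = \<epsilon> / (2 * c)"
  have e: "e > 0" using \<epsilon> c by (simp add: e_def)
  have ec: "c * e = \<epsilon> / 2" using c by (simp add: e_def)
  obtain G where G: "open G" "p_cap p G < ennreal e" "continuous_on (- G) v"
    using v(2) e unfolding quasi_continuous_def by blast
  from p_cap_potential[OF G(2) p]
  obtain \<phi>1 h1 U1 where 1: "wgrad \<phi>1 h1" "\<And>x. \<phi>1 x \<ge> 0" 
    "(\<integral>\<^sup>+x. ennreal (\<phi>1 x powr p) \<partial>lborel) \<le> ennreal e" "(\<integral>\<^sup>+x. ennreal (norm (h1 x) powr p) \<partial>lborel) \<le> ennreal e"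
    "open U1" "G \<subseteq> U1" "AE x in lborel. x \<in> U1 \<longrightarrow> \<phi>1 x \<ge> 1"
    by blast
  have "p_cap p {x \<in> H. v x \<noteq> 0} < ennreal e" using v(3) e by simp
  from p_cap_potential[OF this p]
  obtain \<phi>2 h2 U2 where 2: "wgrad \<phi>2 h2" "\<And>x. \<phi>2 x \<ge> 0" 
    "(\<integral>\<^sup>+x. ennreal (\<phi>2 x powr p) \<partial>lborel) \<le> ennreal e" "(\<integral>\<^sup>+x. ennreal (norm (h2 x) powr p) \<partial>lborel) \<le> ennreal e"
    "open U2" "{x \<in> H. v x \<noteq> 0} \<subseteq> U2" "AE x in lborel. x \<in> U2 \<longrightarrow> \<phi>2 x \<ge> 1"
    by blast
  define \<psi> where "\<psi> x = \<phi>1 x + \<phi>2 x" for x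
  define h where "h x = h1 x + h2 x" for x
  have w: "wgrad \<psi> h" unfolding \<psi>_def[abs_def] h_def[abs_def] by (rule wgrad_add[OF 1(1) 2(1)])
  have [measurable]: "\<psi> \<in> borel_measurable borel" "h \<in> borel_measurable borel" "\<phi>1 \<in> borel_measurable borel" "\<phi>2 \<in> borel_measurable borel"
      "h1 \<in> borel_measurable borel" "h2 \<in> borel_measurable borel"
    using w 1(1) 2(1) by (auto simp: wgrad_def loc_int_def)
  have sum_le: "(\<integral>\<^sup>+x. ennreal (c x powr p) \<partial>lborel) \<le> ennreal (2 * 2 powr p * e)"
    if "\<And>x. 0 \<le> c x" "\<And>x. c x \<le> a x + b x" "\<And>x. 0 \<le> a x" "\<And>x. 0 \<le> b x"
      "(\<integral>\<^sup>+x. ennreal (a x powr p) \<partial>lborel) \<le> ennreal e" "(\<integral>\<^sup>+x. ennreal (b x powr p) \<partial>lborel) \<le> ennreal e"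
      "a \<in> borel_measurable borel" "b \<in> borel_measurable borel" for a b c :: "real^'n \<Rightarrow> real"
  proof -
    have [measurable]: "a \<in> borel_measurable borel" "b \<in> borel_measurable borel" using that by auto
    have "(\<integral>\<^sup>+x. ennreal (c x powr p) \<partial>lborel) \<le> (\<integral>\<^sup>+x. ennreal (2 powr p) * (ennreal (a x powr p) + ennreal (b x powr p)) \<partial>lborel)"
    proof (rule nn_integral_mono)
      fix x
      have "c x powr p \<le> (a x + b x) powr p" using that(1-4)[of x] p by (intro powr_mono2) auto
      also have "\<dots> \<le> 2 powr p * (a x powr p + b x powr p)" using that(3,4)[of x] p by (intro add_powr_le) auto
      finally have "ennreal (c x powr p) \<le> ennreal (2 powr p * (a x powr p + b x powr p))" by (rule ennreal_leI)
      then show "ennreal (c x powr p) \<le> ennreal (2 powr p) * (ennreal (a x powr p) + ennreal (b x powr p))"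
        by (simp add: ennreal_mult ennreal_plus)
    qed
    also have "\<dots> = ennreal (2 powr p) * ((\<integral>\<^sup>+x. ennreal (a x powr p) \<partial>lborel) + (\<integral>\<^sup>+x. ennreal (b x powr p) \<partial>lborel))"
      by (simp add: nn_integral_cmult nn_integral_add)
    also have "\<dots> \<le> ennreal (2 powr p) * (ennreal e + ennreal e)" by (intro mult_left_mono add_mono that) auto
    also have "\<dots> = ennreal (2 * 2 powr p * e)" using e by (simp add: ennreal_mult[symmetric] ennreal_plus[symmetric] del: ennreal_plus)
    finally show ?thesis .
  qed
  have \<psi>p: "(\<integral>\<^sup>+x. ennreal (\<psi> x powr p) \<partial>lborel) \<le> ennreal (2 * 2 powr p * e)"
    by (rule sum_le[of \<psi> \<phi>1 \<phi>2]) (use 1 2 in \<open>auto simp: \<psi>_def\<close>)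
  have hp: "(\<integral>\<^sup>+x. ennreal (norm (h x) powr p) \<partial>lborel) \<le> ennreal (2 * 2 powr p * e)"
    by (rule sum_le[of "\<lambda>x. norm (h x)" "\<lambda>x. norm (h1 x)" "\<lambda>x. norm (h2 x)"]) (use 1 2 in \<open>auto simp: h_def norm_triangle_ineq\<close>)
  have A: "emeasure lborel {x\<in>ball 0 R. \<psi> x > 1/4} \<le> ennreal \<epsilon>"
  proof -
    have "emeasure lborel {x\<in>ball 0 R. \<psi> x > 1/4} = (\<integral>\<^sup>+x. indicator {x\<in>ball 0 R. \<psi> x > 1/4} x \<partial>lborel)" by simp
    also have "\<dots> \<le> (\<integral>\<^sup>+x. ennreal (4 powr p) * ennreal (\<psi> x powr p) \<partial>lborel)"
    proof (rule nn_integral_mono)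
      fix x
      show "indicator {x\<in>ball 0 R. \<psi> x > 1/4} x \<le> ennreal (4 powr p) * ennreal (\<psi> x powr p)"
      proof (cases "\<psi> x > 1/4")
        case True
        then have "1 \<le> (4 * \<psi> x) powr p" using p by (intro ge_one_powr_ge_zero) auto
        also have "\<dots> = 4 powr p * \<psi> x powr p" using True by (intro powr_mult)
        finally have "ennreal 1 \<le> ennreal (4 powr p * \<psi> x powr p)" by (rule ennreal_leI)
        then show ?thesis by (auto simp: ennreal_mult indicator_def)
      qed simp
    qed
    also have "\<dots> = ennreal (4 powr p) * (\<integral>\<^sup>+x. ennreal (\<psi> x powr p) \<partial>lborel)" by (rule nn_integral_cmult) measurable
    also have "\<dots> \<le> ennreal (4 powr p) * ennreal (2 * 2 powr p * e)" by (intro mult_left_mono \<psi>p) auto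
    also have "\<dots> = ennreal (4 powr p * (2 * 2 powr p * e))" using e by (intro ennreal_mult[symmetric]) auto
    also have "\<dots> \<le> ennreal (c * e)" using e by (intro ennreal_leI) (simp add: c_def algebra_simps)
    also have "\<dots> \<le> ennreal \<epsilon>" unfolding ec using \<epsilon> by (intro ennreal_leI) simp
    finally show ?thesis .
  qed
  have B: "(\<integral>\<^sup>+x\<in>ball 0 R. ennreal (norm (h x) powr q) \<partial>lborel) \<le> ennreal \<epsilon>"
  proof -
    have "(\<integral>\<^sup>+x\<in>ball 0 R. ennreal (norm (h x) powr q) \<partial>lborel) \<le> (\<integral>\<^sup>+x. ennreal (t powr q) * indicator (ball 0 R) x + ennreal (t powr (q - p)) * ennreal (norm (h x) powr p) \<partial>lborel)"
    proof (rule nn_integral_mono)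
      fix x
      have "norm (h x) powr q \<le> t powr q + t powr (q - p) * norm (h x) powr p" using q t by (intro powr_le_add_powr) auto
      then have "ennreal (norm (h x) powr q) \<le> ennreal (t powr q + t powr (q - p) * norm (h x) powr p)" by (rule ennreal_leI)
      also have "\<dots> = ennreal (t powr q) + ennreal (t powr (q - p)) * ennreal (norm (h x) powr p)" by (simp add: ennreal_mult ennreal_plus)
      finally show "ennreal (norm (h x) powr q) * indicator (ball 0 R) x \<le> ennreal (t powr q) * indicator (ball 0 R) x + ennreal (t powr (q - p)) * ennreal (norm (h x) powr p)"
        by (auto split: split_indicator)
    qed
    also have "\<dots> = ennreal (t powr q) * ennreal V + ennreal (t powr (q - p)) * (\<integral>\<^sup>+x. ennreal (norm (h x) powr p) \<partial>lborel)"
      by (simp add: nn_integral_add nn_integral_cmult nn_integral_cmult_indicator V)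
    also have "\<dots> \<le> ennreal (t powr q) * ennreal V + ennreal (t powr (q - p)) * ennreal (2 * 2 powr p * e)"
      by (intro add_left_mono mult_left_mono hp) auto
    also have "\<dots> = ennreal (t powr q * V + t powr (q - p) * (2 * 2 powr p * e))"
      using e V0 by (simp add: ennreal_mult ennreal_plus)
    also have "\<dots> \<le> ennreal \<epsilon>"
    proof (rule ennreal_leI)
      have "t powr (q - p) * (2 * 2 powr p * e) \<le> c * e" using e by (simp add: c_def algebra_simps)
      then show "t powr q * V + t powr (q - p) * (2 * 2 powr p * e) \<le> \<epsilon>" using tq ec by simp
    qed
    finally show ?thesis .
  qed
  have C: "\<exists>U. open U \<and> H \<subseteq> U \<and> (AE x in lborel. x \<in> U \<longrightarrow> \<psi> x \<ge> 1 \<or> u' x < \<delta>)" if \<delta>: "\<delta> > 0" for \<delta>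
  proof -
    \<comment> \<open>Taking all balls on which \<open>v\<close> stays below \<open>\<delta>\<close>
      outside \<open>G\<close> gives an open set without selecting one ball for each point of
      \<open>H\<close>.\<close>
    define B where "B = {ball y r | y r. \<forall>z\<in>ball y r - G. v z < \<delta>}"
    define U where "U = U1 \<union> U2 \<union> \<Union>B"
    have "open U" unfolding U_def B_def using 1(5) 2(5) by auto
    moreover have "H \<subseteq> U"
    proof
      fix x assume x: "x \<in> H"
      show "x \<in> U"
      proof (cases "x \<in> U1 \<or> x \<in> U2")
        case False
        then have xG: "x \<in> - G" and vx: "v x = 0" using 1(6) 2(6) x by auto
        from G(3) xG \<delta> obtain d where d: "d > 0" "\<forall>z\<in>-G. dist z x < d \<longrightarrow> dist (v z) (v x) < \<delta>"
          unfolding continuous_on_iff by blast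
        then have "\<forall>z\<in>ball x d - G. v z < \<delta>" using vx by (auto simp: dist_commute dist_real_def abs_less_iff)
        then have "ball x d \<in> B" by (auto simp: B_def)
        moreover have "x \<in> ball x d" using d(1) by simp
        ultimately show ?thesis unfolding U_def by blast
      qed (auto simp: U_def)
    qed
    moreover have "AE x in lborel. x \<in> U \<longrightarrow> \<psi> x \<ge> 1 \<or> u' x < \<delta>"
      using 1(7)
    proof (rule AE_mp, use 2(7) in \<open>rule AE_mp\<close>, use v(1)[unfolded AE_lebesgue_iff] in \<open>rule AE_mp\<close>, use ae in \<open>rule AE_mp\<close>, intro AE_I2 impI)
      fix x assume *: "u x = u' x" "v x = u x" "x \<in> U2 \<longrightarrow> 1 \<le> \<phi>2 x" "x \<in> U1 \<longrightarrow> 1 \<le> \<phi>1 x" "x \<in> U"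
      show "1 \<le> \<psi> x \<or> u' x < \<delta>"
      proof (cases "x \<in> U1 \<or> x \<in> U2")
        case True
        then show ?thesis using * 1(2)[of x] 2(2)[of x] by (auto simp: \<psi>_def)
      next
        case False
        then obtain y r where "x \<in> ball y r" "\<forall>z\<in>ball y r - G. v z < \<delta>" using \<open>x \<in> U\<close> by (auto simp: U_def B_def)
        moreover have "x \<notin> G" using False 1(6) by auto
        ultimately have "v x < \<delta>" by blast
        then show ?thesis using * by simp
      qed
    qed
    ultimately show ?thesis by blast
  qed
  show "\<exists>\<psi> h. wgrad \<psi> h \<and> (\<forall>x. \<psi> x \<ge> 0) \<and>
     emeasure lborel {x\<in>ball 0 R. \<psi> x > 1/4} \<le> ennreal \<epsilon> \<and>
     (\<integral>\<^sup>+x\<in>ball 0 R. ennreal (norm (h x) powr q) \<partial>lborel) \<le> ennreal \<epsilon> \<and>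
     (\<forall>\<delta>>0. \<exists>U. open U \<and> H \<subseteq> U \<and> (AE x in lborel. x \<in> U \<longrightarrow> \<psi> x \<ge> 1 \<or> u' x < \<delta>))"
    using w 1(2) 2(2) A B C by (intro exI[of _ \<psi>] exI[of _ h]) (auto simp: \<psi>_def)
qed

section \<open>From the De Giorgi class to Borel functions and nonnegative integrals\<close>

lemma weak_grad_measurable:
  fixes g :: "real^'n::finite \<Rightarrow> real^'n"
  assumes "weak_grad u g" shows "g \<in> borel_measurable lebesgue"
proof -
  have "(\<lambda>x. g x $ i) \<in> borel_measurable lebesgue" for i
    using assms by (intro loc_integrable_measurable) (auto simp: weak_grad_def)
  then show ?thesis
    by (subst borel_measurable_euclidean_space) (auto simp: Basis_vec_def inner_axis)
qed

text \<open>Without integrability the Bochner integral has the default value 0, so this direction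
  still holds.\<close>

lemma ennreal_integral_le_nn_integral:
  fixes f :: "'a \<Rightarrow> real"
  assumes "\<And>x. f x \<ge> 0" shows "ennreal (\<integral>x. f x \<partial>M) \<le> (\<integral>\<^sup>+x. ennreal (f x) \<partial>M)"
proof (cases "integrable M f")
  case True
  then show ?thesis using assms by (subst nn_integral_eq_integral) auto
qed (simp add: not_integrable_integral_eq)

text \<open>For an equality the default value 0 would be harmful, so the integrable majorant
  \<open>P\<close> secures integrability of \<open>F\<close>. In the application \<open>P\<close> is
  the \<open>p\<close>-th power of the norm of the full gradient of \<open>u\<close>.\<close>

lemma set_integral_lebesgue_lborel:
  fixes F E P :: "real^'n::finite \<Rightarrow> real"
  assumes F: "F \<in> borel_measurable lebesgue" and E: "\<And>x. E x \<ge> 0" and ae: "AE x in lborel. E x = F x"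
    and P: "set_integrable lebesgue (ball 0 r) P" "AE x in lborel. E x \<le> P x"
  shows "ennreal (LINT y:ball 0 r|lebesgue. F y) = (\<integral>\<^sup>+x\<in>ball 0 r. ennreal (E x) \<partial>lborel)"
proof -
  have int: "integrable lebesgue (\<lambda>x. indicator (ball 0 r) x *\<^sub>R F x)"
  proof (rule Bochner_Integration.integrable_bound)
    show "integrable lebesgue (\<lambda>x. indicator (ball 0 r) x *\<^sub>R P x)" using P(1) by (simp add: set_integrable_def)
    show "(\<lambda>x. indicator (ball 0 r) x *\<^sub>R F x) \<in> borel_measurable lebesgue"
      by (intro borel_measurable_scaleR borel_measurable_indicator F) auto
    show "AE x in lebesgue. norm (indicator (ball 0 r) x *\<^sub>R F x) \<le> norm (indicator (ball 0 r) x *\<^sub>R P x)"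
      unfolding AE_lebesgue_iff using ae
    proof (rule AE_mp, use P(2) in \<open>rule AE_mp\<close>, intro AE_I2 impI)
      fix x assume "E x \<le> P x" "E x = F x"
      then show "norm (indicator (ball 0 r) x *\<^sub>R F x) \<le> norm (indicator (ball 0 r) x *\<^sub>R P x)"
        using E[of x] by (auto simp: indicator_def)
    qed
  qed
  have "AE x in lebesgue. 0 \<le> indicator (ball 0 r) x *\<^sub>R F x"
    unfolding AE_lebesgue_iff using ae
  proof (rule AE_mp, intro AE_I2 impI)
    fix x assume "E x = F x"
    then show "0 \<le> indicator (ball 0 r) x *\<^sub>R F x" using E[of x] by (auto simp: indicator_def)
  qed
  then have "ennreal (LINT y:ball 0 r|lebesgue. F y) = (\<integral>\<^sup>+x. ennreal (indicator (ball 0 r) x *\<^sub>R F x) \<partial>lebesgue)"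
    unfolding set_lebesgue_integral_def by (rule nn_integral_eq_integral[OF int, symmetric])
  also have "\<dots> = (\<integral>\<^sup>+x\<in>ball 0 r. ennreal (E x) \<partial>lborel)"
    by (rule nn_integral_lebesgue_lborel_cong, use ae in \<open>rule AE_mp\<close>) (auto intro!: AE_I2 simp: indicator_def)
  finally show ?thesis .
qed

text \<open>The weak gradients that \<open>DG_plus\<close> supplies for the various levels and radii
  are identified, by uniqueness, with truncations of a single \<open>g\<close>. On the left of the
  energy inequality integrability comes from the local \<open>Lp\<close> bound on the gradient; on
  the right an inequality suffices.\<close>

lemma DG_plus_dg_pair:
  fixes u :: "real^'n::finite \<Rightarrow> real"
  assumes u: "DG_plus p \<gamma> u" and p: "p > 1" "\<gamma> > 0"
  obtains u' g where "dg_pair p \<gamma> u' g" "AE x in lborel. u x = u' x"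
proof -
  obtain g0 where g0: "weak_grad u g0" "Lp_loc p g0"
    using u by (auto simp: DG_plus_def W1p_loc_def)
  have "u \<in> borel_measurable lebesgue" using g0(1) by (intro loc_integrable_measurable) (simp add: weak_grad_def)
  then obtain u' where u': "u' \<in> borel_measurable lborel" "AE x in lborel. u x = u' x"
    using completion_ex_borel_measurable_real by blast
  have [measurable]: "u' \<in> borel_measurable borel" using u'(1) by simp
  have u'ae: "AE x in lborel. u' x = u x" using u'(2) by (rule AE_mp) (auto intro!: AE_I2)
  obtain g where g: "wgrad u' g" "AE x in lborel. g x = g0 x"
    by (rule weak_grad_wgrad[OF g0(1) _ u'ae]) (use u'(1) in auto)
  have [measurable]: "g \<in> borel_measurable borel" using g(1) by (simp add: wgrad_def loc_int_def)
  have "(\<integral>\<^sup>+x\<in>ball 0 (\<sigma> * \<rho>). ennreal (if u' x > k then norm (g x) powr p else 0) \<partial>lborel)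
      \<le> ennreal (\<gamma> / ((1 - \<sigma>) * \<rho>) powr p) * (\<integral>\<^sup>+x\<in>ball 0 \<rho>. ennreal (max (u' x - k) 0 powr p) \<partial>lborel)"
    if \<rho>: "0 < \<rho>" and \<sigma>: "0 < \<sigma>" "\<sigma> < 1" for \<rho> \<sigma> k
  proof -
    define C where "C = \<gamma> / ((1 - \<sigma>) * \<rho>) powr p"
    have C: "C \<ge> 0" using p by (simp add: C_def)
    obtain g' where g': "weak_grad (\<lambda>x. max (u x - k) 0) g'"
      "(LINT y:ball 0 (\<sigma> * \<rho>)|lebesgue. norm (g' y) powr p) \<le> C * (LINT y:ball 0 \<rho>|lebesgue. \<bar>max (u y - k) 0\<bar> powr p)"
      using u \<rho> \<sigma> unfolding DG_plus_def C_def by blast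
    have "AE x in lborel. max (u' x - k) 0 = max (u x - k) 0" using u'ae by (rule AE_mp) (auto intro!: AE_I2)
    then obtain h where h: "wgrad (\<lambda>x. max (u' x - k) 0) h" "AE x in lborel. h x = g' x"
      by (rule weak_grad_wgrad[OF g'(1), rotated]) auto
    have hg: "AE x in lborel. h x = (if u' x > k then g x else 0)"
      by (rule wgrad_unique[OF h(1) wgrad_truncate[OF g(1)]])
    have "ennreal (LINT y:ball 0 (\<sigma> * \<rho>)|lebesgue. norm (g' y) powr p) = (\<integral>\<^sup>+x\<in>ball 0 (\<sigma> * \<rho>). ennreal (if u' x > k then norm (g x) powr p else 0) \<partial>lborel)"
    proof (rule set_integral_lebesgue_lborel)
      show "(\<lambda>y. norm (g' y) powr p) \<in> borel_measurable lebesgue"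
        using weak_grad_measurable[OF g'(1)] by measurable
      show "0 \<le> (if u' x > k then norm (g x) powr p else 0)" for x by simp
      show "AE x in lborel. (if u' x > k then norm (g x) powr p else 0) = norm (g' x) powr p"
        using hg by (rule AE_mp, use h(2) in \<open>rule AE_mp\<close>) (use p in \<open>auto intro!: AE_I2\<close>)
      show "set_integrable lebesgue (ball 0 (\<sigma> * \<rho>)) (\<lambda>y. norm (g0 y) powr p)"
        using g0(2) by (simp add: Lp_loc_def)
      show "AE x in lborel. (if u' x > k then norm (g x) powr p else 0) \<le> norm (g0 x) powr p"
        using g(2) by (rule AE_mp) (auto intro!: AE_I2)
    qed
    then have "(\<integral>\<^sup>+x\<in>ball 0 (\<sigma> * \<rho>). ennreal (if u' x > k then norm (g x) powr p else 0) \<partial>lborel) \<le> ennreal (C * (LINT y:ball 0 \<rho>|lebesgue. \<bar>max (u y - k) 0\<bar> powr p))"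
      using ennreal_leI[OF g'(2)] by simp
    also have "\<dots> = ennreal C * ennreal (\<integral>y. indicator (ball 0 \<rho>) y *\<^sub>R (\<bar>max (u y - k) 0\<bar> powr p) \<partial>lebesgue)"
      unfolding set_lebesgue_integral_def using C by (intro ennreal_mult) auto
    also have "\<dots> \<le> ennreal C * (\<integral>\<^sup>+y. ennreal (indicator (ball 0 \<rho>) y *\<^sub>R (\<bar>max (u y - k) 0\<bar> powr p)) \<partial>lebesgue)"
      by (intro mult_left_mono ennreal_integral_le_nn_integral) auto
    also have "(\<integral>\<^sup>+y. ennreal (indicator (ball 0 \<rho>) y *\<^sub>R (\<bar>max (u y - k) 0\<bar> powr p)) \<partial>lebesgue) = (\<integral>\<^sup>+x\<in>ball 0 \<rho>. ennreal (max (u' x - k) 0 powr p) \<partial>lborel)"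
      by (rule nn_integral_lebesgue_lborel_cong, use u'(2) in \<open>rule AE_mp\<close>) (auto intro!: AE_I2 simp: indicator_def)
    finally show ?thesis by (simp add: C_def)
  qed
  then have "dg_pair p \<gamma> u' g" using g(1) by (simp add: dg_pair_def)
  then show ?thesis using u'(2) that by blast
qed

text \<open>Counting smaller indices is an order isomorphism from the index type onto the numbers
  below its cardinality. The coordinates that are forced to vanish are those of rank at least
  \<open>M\<close>.\<close>

lemma card_HM_codim:
  assumes "M \<le> CARD('n::{finite,linorder})"
  shows "card {i::'n. M \<le> card {j. j < i}} = CARD('n) - M"
proof -
  define f where "f i = card {j::'n. j < i}" for i
  have "f i < f j" if "i < j" for i j unfolding f_def using that by (intro psubset_card_mono) auto
  then have inj: "inj f" by (intro linorder_injI) (metis less_irrefl)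
  have "f i < CARD('n)" for i unfolding f_def by (intro psubset_card_mono) auto
  then have "range f = {..<CARD('n)}"
    using card_image[OF inj] by (intro card_subset_eq) auto
  moreover have "f ` {i. M \<le> f i} = {y\<in>range f. M \<le> y}" by auto
  ultimately have "f ` {i. M \<le> f i} = {M..<CARD('n)}" by auto
  then have "card {i. M \<le> f i} = CARD('n) - M"
    using card_image[OF inj_on_subset[OF inj], of "{i. M \<le> f i}"] by simp
  then show ?thesis by (simp add: f_def)
qed

section \<open>Growth of the essential supremum\<close>

lemma AE_mu_plus_iff:
  fixes u :: "real^'n::finite \<Rightarrow> real"
  assumes "u \<in> borel_measurable lebesgue"
  shows "mu_plus u r \<le> c \<longleftrightarrow> (AE x in lborel. x \<in> ball 0 r \<longrightarrow> ereal (u x) \<le> c)"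
proof -
  let ?R = "restrict_space lebesgue (ball (0::real^'n) r)"
  have m: "(\<lambda>x. ereal (u x)) \<in> borel_measurable ?R"
    by (intro measurable_restrict_space1 borel_measurable_ereal assms)
  have iff: "(AE x in ?R. ereal (u x) \<le> c) \<longleftrightarrow> (AE x in lborel. x \<in> ball 0 r \<longrightarrow> ereal (u x) \<le> c)" for c
    unfolding AE_lebesgue_iff[symmetric] by (rule AE_restrict_space_iff) simp
  show ?thesis
  proof
    assume "mu_plus u r \<le> c"
    then have "AE x in ?R. ereal (u x) \<le> c"
      using esssup_AE[of "\<lambda>x. ereal (u x)" ?R] unfolding mu_plus_def by (rule_tac AE_mp) (auto intro!: AE_I2)
    then show "AE x in lborel. x \<in> ball 0 r \<longrightarrow> ereal (u x) \<le> c" using iff by simp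
  next
    assume "AE x in lborel. x \<in> ball 0 r \<longrightarrow> ereal (u x) \<le> c"
    then show "mu_plus u r \<le> c" unfolding mu_plus_def using iff by (intro esssup_I[OF m]) simp
  qed
qed

theorem theorem1p2:
  fixes M :: nat and p \<gamma> :: real
  assumes "CARD('n::{finite,linorder}) \<ge> 2"
    and "1 \<le> M" and "M \<le> CARD('n::{finite,linorder}) - 1"
    and "1 < p" and "p \<le> real CARD('n::{finite,linorder})"
    and "\<gamma> > 1"
    and "real CARD('n::{finite,linorder}) - real M < p"
  shows "\<exists>\<alpha>. 0 < \<alpha> \<and> \<alpha> < 1 \<and>
    (\<forall>u :: real^'n::{finite,linorder} \<Rightarrow> real.
       DG_plus p \<gamma> u \<and> (AE x in lebesgue. u x \<ge> 0) \<and> \<not> (AE x in lebesgue. u x = 0) \<and>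
       vanishes_on p u (HM M)
       \<longrightarrow> 0 < Liminf at_top (\<lambda>r. mu_plus u r / ereal (r powr \<alpha>)))"
proof -
  define N where "N = CARD('n::{finite,linorder})"
  define J where "J = {i::'n::{finite,linorder}. M \<le> card {j. j < i}}"
  have N: "M \<le> N - 1" "N \<ge> 2" using assms by (auto simp: N_def)
  have cJ: "card J = N - M" unfolding J_def N_def using N by (intro card_HM_codim) (simp add: N_def)
  then have J: "real (card J) < p" "1 \<le> real (card J)" using assms(7) N by (auto simp: N_def of_nat_diff)
  \<comment> \<open>The midpoint between the codimension and \<open>p\<close>. The codimension is at
    least 1 since \<open>M \<le> N - 1\<close>, which gives \<open>q \<ge> 1\<close>.\<close>
  define q where "q = (p + real (card J)) / 2"
  have q: "1 \<le> q" "q < p" "real (card J) < q" using J by (auto simp: q_def)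
  have HM: "HM M = {x::real^'n::{finite,linorder}. \<forall>i\<in>J. x $ i = 0}" by (auto simp: HM_def J_def)
  have "\<gamma> > 0" using assms by simp
  from dg_decay[OF assms(4) this q] obtain \<eta> :: real where \<eta>: "0 < \<eta>" "\<eta> < 1"
    and decay: "\<And>(u :: real^'n::{finite,linorder} \<Rightarrow> real) g r \<mu>. dg_pair p \<gamma> u g \<Longrightarrow> (\<And>R. cap_vanish q R {x. \<forall>i\<in>J. x $ i = 0} u) \<Longrightarrow> r > 0 \<Longrightarrow> \<mu> > 0 \<Longrightarrow>
      AE x in lborel. x \<in> ball 0 (8 * r) \<longrightarrow> u x \<le> \<mu> \<Longrightarrow> AE x in lborel. x \<in> ball 0 r \<longrightarrow> u x \<le> \<eta> * \<mu>"
    by blast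
  \<comment> \<open>Each enlargement of the radius by the factor 8 multiplies the supremum by at
    least \<open>1 / \<eta>\<close>, hence the exponent \<open>log 8 (1 / \<eta>)\<close>. The cap
    1/2 enforces \<open>\<alpha> < 1\<close>.\<close>
  define \<alpha> where "\<alpha> = min (1/2) (log 8 (1 / \<eta>))"
  have "log 8 (1 / \<eta>) > 0" using \<eta> by (subst zero_less_log_cancel_iff) auto
  then have \<alpha>: "0 < \<alpha>" "\<alpha> < 1" "\<alpha> \<le> log 8 (1 / \<eta>)" by (auto simp: \<alpha>_def)
  have "8 powr \<alpha> \<le> 8 powr (log 8 (1 / \<eta>))" using \<alpha> by (intro powr_mono) auto
  then have \<alpha>\<eta>: "8 powr \<alpha> \<le> 1 / \<eta>" using \<eta> by simp
  show ?thesis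
  proof (intro exI[of _ \<alpha>] conjI \<alpha> allI impI)
    fix u :: "real^'n::{finite,linorder} \<Rightarrow> real"
    assume "DG_plus p \<gamma> u \<and> (AE x in lebesgue. u x \<ge> 0) \<and> \<not> (AE x in lebesgue. u x = 0) \<and> vanishes_on p u (HM M)"
    then have u: "DG_plus p \<gamma> u" "AE x in lborel. u x \<ge> 0" "\<not> (AE x in lborel. u x = 0)" "vanishes_on p u (HM M)"
      by (auto simp: AE_lebesgue_iff)
    have um: "u \<in> borel_measurable lebesgue"
      using u(1) by (auto simp: DG_plus_def W1p_loc_def Lp_loc_def)
    obtain u' g where u': "dg_pair p \<gamma> u' g" "AE x in lborel. u x = u' x"
      by (rule DG_plus_dg_pair[OF u(1) assms(4) \<open>\<gamma> > 0\<close>])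
    have cap: "cap_vanish q R {x. \<forall>i\<in>J. x $ i = 0} u'" for R
      unfolding HM[symmetric] by (rule vanishes_on_cap_vanish[OF u(4) u'(2) q(1,2)])
    note iff = AE_mu_plus_iff[OF um]
    have mono: "mu_plus u r \<le> mu_plus u s" if "r \<le> s" for r s
      unfolding iff[of r] using iff[of s "mu_plus u s", THEN iffD1, OF order_refl]
      by (rule AE_mp) (use that in \<open>auto intro!: AE_I2\<close>)
    have step: "ereal (a / \<eta>) \<le> mu_plus u (8 * r)" if "ereal a \<le> mu_plus u r" "a > 0" "r > 0" for a r
    proof (rule ccontr)
      assume "\<not> ?thesis"
      then have lt: "mu_plus u (8 * r) < ereal (a / \<eta>)" by simp
      have "ereal a \<le> mu_plus u (8 * r)" using that mono[of r "8 * r"] by (auto intro: order_trans)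
      \<comment> \<open>An infinite supremum over the larger ball would satisfy the claim at once,
        so assuming the contrary makes it a real number, as \<open>decay\<close> requires.\<close>
      with lt obtain \<mu> where \<mu>: "mu_plus u (8 * r) = ereal \<mu>" by (cases "mu_plus u (8 * r)") auto
      have \<mu>0: "\<mu> > 0" "\<mu> < a / \<eta>" using \<open>ereal a \<le> mu_plus u (8 * r)\<close> lt that(2) unfolding \<mu> by auto
      have "AE x in lborel. x \<in> ball 0 (8 * r) \<longrightarrow> ereal (u x) \<le> ereal \<mu>" using iff[of "8 * r" "ereal \<mu>"] \<mu> by simp
      then have "AE x in lborel. x \<in> ball 0 (8 * r) \<longrightarrow> u' x \<le> \<mu>"
        by (rule AE_mp, use u'(2) in \<open>rule AE_mp\<close>) (auto intro!: AE_I2)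
      from decay[OF u'(1) cap that(3) \<mu>0(1) this]
      have "AE x in lborel. x \<in> ball 0 r \<longrightarrow> ereal (u x) \<le> ereal (\<eta> * \<mu>)"
        by (rule AE_mp, use u'(2) in \<open>rule AE_mp\<close>) (auto intro!: AE_I2)
      then have "mu_plus u r \<le> ereal (\<eta> * \<mu>)" by (simp only: iff)
      then have "ereal a \<le> ereal (\<eta> * \<mu>)" using that(1) by (rule order_trans[rotated])
      then show False using \<mu>0(2) \<eta> by (simp add: field_simps)
    qed
    \<comment> \<open>Otherwise \<open>u\<close> is nonpositive almost everywhere on every ball,
      hence zero almost everywhere by nonnegativity.\<close>
    have "\<exists>r0. r0 > 0 \<and> mu_plus u r0 > 0"
    proof (rule ccontr)
      assume no: "\<not> ?thesis"
      have "AE x in lborel. x \<in> ball 0 R \<longrightarrow> u x \<le> 0" for R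
      proof (cases "R > 0")
        case True
        with no have "mu_plus u R \<le> 0" by (meson linorder_not_le)
        then show ?thesis by (simp only: iff) (simp add: zero_ereal_def)
      next
        case False
        then have "x \<notin> ball 0 R" for x :: "real^'n::{finite,linorder}" by (simp add: not_less order_trans[OF _ norm_ge_zero])
        then show ?thesis by simp
      qed
      then have "AE x in lborel. u x \<le> 0" by (rule AE_ball_all)
      then have "AE x in lborel. u x = 0"
        by (rule AE_mp, use u(2) in \<open>rule AE_mp\<close>) (auto intro!: AE_I2)
      then show False using u(3) by simp
    qed
    then obtain r0 where r0: "r0 > 0" "mu_plus u r0 > 0" by blast
    then obtain a where a: "a > 0" "ereal a \<le> mu_plus u r0"
      using ereal_dense2[of 0 "mu_plus u r0"] by (auto intro: less_imp_le)
    have grow: "ereal (a * (1 / \<eta>) ^ n) \<le> mu_plus u (8 ^ n * r0)" for n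
    proof (induction n)
      case (Suc n)
      have "ereal (a * (1 / \<eta>) ^ n / \<eta>) \<le> mu_plus u (8 * (8 ^ n * r0))"
        by (rule step[OF Suc]) (use a \<eta> r0 in auto)
      then show ?case by (simp add: mult.assoc)
    qed (use a in simp)
    \<comment> \<open>The factor 8 pays for rounding the logarithm down: \<open>r\<close> lies
      between \<open>8 ^ n * r0\<close> and \<open>8 * 8 ^ n * r0\<close>.\<close>
    define c where "c = a / (8 * r0) powr \<alpha>"
    have c: "c > 0" using a r0 by (simp add: c_def)
    have "ereal c \<le> mu_plus u r / ereal (r powr \<alpha>)" if r: "r \<ge> r0" for r
    proof -
      define n where "n = nat \<lfloor>log 8 (r / r0)\<rfloor>"
      have rr: "r > 0" "r / r0 \<ge> 1" using r r0 by auto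
      have l0: "log 8 (r / r0) \<ge> 0" using rr by simp
      have n: "real n \<le> log 8 (r / r0)" "log 8 (r / r0) < real n + 1"
        unfolding n_def using l0 by linarith+
      have "8 powr real n \<le> 8 powr log 8 (r / r0)" using n by (intro powr_mono) auto
      then have r1: "8 ^ n * r0 \<le> r" using rr r0 by (simp add: powr_realpow field_simps)
      have "8 powr log 8 (r / r0) \<le> 8 powr (real n + 1)" using n by (intro powr_mono) auto
      then have "r / r0 \<le> 8 * 8 ^ n" using rr r0 by (simp add: powr_add powr_realpow)
      then have r2: "r / (8 * r0) \<le> 8 ^ n" using r0 by (simp add: field_simps)
      have "c * r powr \<alpha> = a * (r / (8 * r0)) powr \<alpha>" using rr r0 by (simp add: c_def powr_divide)
      also have "\<dots> \<le> a * (8 ^ n) powr \<alpha>" using r2 a rr r0 \<alpha> by (intro mult_left_mono powr_mono2) auto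
      also have "(8 ^ n) powr \<alpha> = (8 powr \<alpha>) ^ n" by (simp add: powr_realpow[symmetric] powr_powr mult.commute)
      also have "a * (8 powr \<alpha>) ^ n \<le> a * (1 / \<eta>) ^ n" using a \<alpha>\<eta> by (intro mult_left_mono power_mono) auto
      finally have "ereal (c * r powr \<alpha>) \<le> mu_plus u (8 ^ n * r0)" using grow[of n] by (meson ereal_less_eq(3) order_trans)
      also have "\<dots> \<le> mu_plus u r" using r1 by (rule mono)
      finally have "ereal c * ereal (r powr \<alpha>) \<le> mu_plus u r" by simp
      then show ?thesis using rr by (subst ereal_le_divide_pos) (auto simp: mult.commute)
    qed
    then have "\<forall>\<^sub>F r in at_top. ereal c \<le> mu_plus u r / ereal (r powr \<alpha>)"
      by (auto simp: eventually_at_top_linorder)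
    then have "ereal c \<le> Liminf at_top (\<lambda>r. mu_plus u r / ereal (r powr \<alpha>))"
      by (rule Liminf_bounded)
    then show "0 < Liminf at_top (\<lambda>r. mu_plus u r / ereal (r powr \<alpha>))"
      using c by (metis ereal_less(2) less_le_trans)
  qed
qed

end
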